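(* Let $0<q<p\le\infty$, let $\gamma>0$, and let $\mu$ be a finite positive Borel measure on $[0,1)$. Define $$\frac1r=\frac1q-\frac1p,\qquad \sigma=\gamma-\frac1r=\gamma+\frac1p-\frac1q,\qquad \frac1\infty=0.$$ Thus $0<r<\infty$, $r=pq/(p-q)$ for $p<\infty$, and $r=q$ for $p=\infty$. For $j\ge0$ put $a_j=1-2^{-j}$, $m_j=\mu([a_j,1))$, $d_j=2^{j\sigma}m_j$. Then the following assertions are equivalent: (i) $\mathcal C_{\mu,\gamma}:H^p\to H^q$ is bounded; (ii) $\mathcal C_{\mu,\gamma}:H^p\to H^q$ is compact; (iii) $\{d_j\}_{j\ge0}\in\ell^r$; (iv) $\displaystyle\int_0^1\left(\frac{\mu([t,1))}{(1-t)^\sigma}\right)^r\frac{dt}{1-t}<\infty$; (v) the boundary potential $P_{\mu,\gamma}(e^{i\theta})=\int_{[0,1)}\frac{d\mu(t)}{|1-te^{i\theta}|^\gamma}$ belongs to $L^r(\mathbb T)$; (vi) $F_{\mu,\gamma}\in H^r$, where $F_{\mu,\gamma}=\mathcal C_{\mu,\gamma}(1)$; (vii) $\displaystyle\sum_{n=0}^\infty(n+1)^{r\gamma-2}\mu_n^r<\infty$. Moreover, $$\|\mathcal C_{\mu,\gamma}\|_{H^p\to H^q}\asymp\|F_{\mu,\gamma}\|_{H^r}\asymp\|P_{\mu,\gamma}\|_{L^r(\mathbb T)}\asymp\left(\sum_{j=0}^\infty d_j^r\right)^{1/r}\asymp\left(\sum_{n=0}^\infty(n+1)^{r\gamma-2}\mu_n^r\right)^{1/r}$$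 $$\asymp\left[\mu([0,1))^r+\int_0^1\left(\frac{\mu([t,1))}{(1-t)^\sigma}\right)^r\frac{dt}{1-t}\right]^{1/r},$$ where the comparison constants depend only on $p,q,\gamma$.
   Context: $\mathbb D$ is the open unit disc in $\mathbb C$ and $\mathbb T=\partial\mathbb D$ carries normalized arc measure $d\theta/(2\pi)$. For $0<p<\infty$, $H^p$ is the Hardy space of analytic functions $f$ on $\mathbb D$ with $\|f\|_{H^p}=\sup_{0\le\rho<1}\left(\frac1{2\pi}\int_0^{2\pi}|f(\rho e^{i\theta})|^p\,d\theta\right)^{1/p}<\infty$; $H^\infty$ is the space of bounded analytic functions with the supremum norm. For exponents below $1$, $\|\cdot\|_{H^p}$, $\|\cdot\|_{L^r}$ and $\ell^r$ are understood in the usual quasi-norm sense. For a finite positive Borel measure $\mu$ on $[0,1)$ put $\mu_n=\int_{[0,1)}t^n\,d\mu(t)$, $n\ge0$. For $\gamma>0$ and $f(z)=\sum_{k\ge0}a_kz^k$ analytic in $\mathbb D$, the generalized Cesàro operator is $$\mathcal C_{\mu,\gamma}f(z)=\sum_{n=0}^\infty\mu_n\left(\sum_{k=0}^n\frac{\Gamma(n-k+\gamma)}{\Gamma(\gamma)(n-k)!}a_k\right)z^n=\int_{[0,1)}\frac{f(tz)}{(1-tz)^\gamma}\,d\mu(t),\qquad z\in\mathbb D.$$ In particular $$F_{\mu,\gamma}(z)=\mathcal C_{\mu,\gamma}(1)(z)=\int_{[0,1)}\frac{d\mu(t)}{(1-tz)^\gamma}=\sum_{n=0}^\infty\frac{\Gamma(n+\gamma)}{\Gamma(\gamma)\,n!}\mu_nz^n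 .$$ $\|\mathcal C_{\mu,\gamma}\|_{H^p\to H^q}$ is the least constant $C$ with $\|\mathcal C_{\mu,\gamma}f\|_{H^q}\le C\|f\|_{H^p}$ for all $f\in H^p$. $X\asymp Y$ means $C^{-1}Y\le X\le CY$ with a constant $C>0$ independent of the functions, measures and indices under consideration. *)

theory Defs
  imports "HOL-Complex_Analysis.Complex_Analysis"
begin

(* Real powers on [0, \<infinity>]; used only with exponents a > 0. *)
definition ennpowr :: "ennreal \<Rightarrow> real \<Rightarrow> ennreal" where
  "ennpowr x a = (if x = \<infinity> then \<infinity> else ennreal (enn2real x powr a))"

(* The (quasi-)norm of L^r of the unit circle with normalized arc measure, 0 < r < \<infinity>,
   for nonnegative functions. *)
definition circle_norm :: "real \<Rightarrow> (complex \<Rightarrow> ennreal) \<Rightarrow> ennreal" where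
  "circle_norm r g =
     ennpowr ((\<integral>\<^sup>+\<theta>\<in>{0..2*pi}. ennpowr (g (cis \<theta>)) r \<partial>lborel) / ennreal (2*pi)) (1/r)"

definition circle_L :: "real \<Rightarrow> (complex \<Rightarrow> ennreal) set" where
  "circle_L r = {g. (\<lambda>\<theta>. g (cis \<theta>)) \<in> borel_measurable borel \<and> circle_norm r g < \<infinity>}"

(* Functions on the disc are total functions on the complex plane; their values outside
   the open unit disc are irrelevant to hardy_norm and hardy. *)
definition hardy_norm :: "ennreal \<Rightarrow> (complex \<Rightarrow> complex) \<Rightarrow> ennreal" where
  "hardy_norm p f =
     (if p = \<infinity> then (SUP z\<in>ball 0 1. ennreal (norm (f z)))
      else (SUP \<rho>\<in>{0..<1::real}.
              circle_norm (enn2real p) (\<lambda>w. ennreal (norm (f (of_real \<rho> * w))))))"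

definition hardy :: "ennreal \<Rightarrow> (complex \<Rightarrow> complex) set" where
  "hardy p = {f. f holomorphic_on ball 0 1 \<and> hardy_norm p f < \<infinity>}"

definition bounded_hardy ::
    "ennreal \<Rightarrow> ennreal \<Rightarrow> ((complex \<Rightarrow> complex) \<Rightarrow> complex \<Rightarrow> complex) \<Rightarrow> bool" where
  "bounded_hardy p q T \<longleftrightarrow>
     (\<forall>f\<in>hardy p. T f \<in> hardy q) \<and>
     (\<exists>C::real. \<forall>f\<in>hardy p. hardy_norm q (T f) \<le> ennreal C * hardy_norm p f)"

(* Compactness in sequential form, with respect to the topology of the (quasi-)norm. *)
definition compact_hardy ::
    "ennreal \<Rightarrow> ennreal \<Rightarrow> ((complex \<Rightarrow> complex) \<Rightarrow> complex \<Rightarrow> complex) \<Rightarrow> bool" where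
  "compact_hardy p q T \<longleftrightarrow>
     (\<forall>f\<in>hardy p. T f \<in> hardy q) \<and>
     (\<forall>f :: nat \<Rightarrow> complex \<Rightarrow> complex.
        (\<forall>n. f n \<in> hardy p) \<and> (\<exists>B::real. \<forall>n. hardy_norm p (f n) \<le> ennreal B) \<longrightarrow>
        (\<exists>g\<in>hardy q. \<exists>s :: nat \<Rightarrow> nat. strict_mono s \<and>
           (\<lambda>n. hardy_norm q (\<lambda>z. T (f (s n)) z - g z)) \<longlonglongrightarrow> 0))"

(* The least constant C in [0, \<infinity>]; it equals \<infinity> when T is not bounded. *)
definition hardy_opnorm ::
    "ennreal \<Rightarrow> ennreal \<Rightarrow> ((complex \<Rightarrow> complex) \<Rightarrow> complex \<Rightarrow> complex) \<Rightarrow> ennreal" where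
  "hardy_opnorm p q T =
     Inf {C. \<forall>f\<in>hardy p. hardy_norm q (T f) \<le> C * hardy_norm p f}"

definition unit_interval_measure :: "real measure \<Rightarrow> bool" where
  "unit_interval_measure \<mu> \<longleftrightarrow>
     sets \<mu> = sets (restrict_space borel {0..<1}) \<and> finite_measure \<mu>"

definition moment :: "real measure \<Rightarrow> nat \<Rightarrow> real" where
  "moment \<mu> n = (\<integral>t. t ^ n \<partial>\<mu>)"

definition taylor_coeff :: "(complex \<Rightarrow> complex) \<Rightarrow> nat \<Rightarrow> complex" where
  "taylor_coeff f k = (deriv ^^ k) f 0 / fact k"

(* Only the power series of f at 0 enters, so that cesaro depends on f near 0 only. *)
definition cesaro ::
    "real measure \<Rightarrow> real \<Rightarrow> (complex \<Rightarrow> complex) \<Rightarrow> complex \<Rightarrow> complex" where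
  "cesaro \<mu> \<gamma> f z =
     (\<Sum>n. of_real (moment \<mu> n) *
        (\<Sum>k\<le>n. of_real (Gamma (real (n - k) + \<gamma>) / (Gamma \<gamma> * fact (n - k)))
                 * taylor_coeff f k) * z ^ n)"

definition F_fun :: "real measure \<Rightarrow> real \<Rightarrow> complex \<Rightarrow> complex" where
  "F_fun \<mu> \<gamma> = cesaro \<mu> \<gamma> (\<lambda>z. 1)"

definition potential :: "real measure \<Rightarrow> real \<Rightarrow> complex \<Rightarrow> ennreal" where
  "potential \<mu> \<gamma> w = (\<integral>\<^sup>+t. ennreal (1 / norm (1 - of_real t * w) powr \<gamma>) \<partial>\<mu>)"

definition dyadic_weight :: "real measure \<Rightarrow> real \<Rightarrow> nat \<Rightarrow> real" where
  "dyadic_weight \<mu> \<sigma> j = 2 powr (real j * \<sigma>) * measure \<mu> {1 - 1 / 2 ^ j..<1}"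

definition tail_integral :: "real measure \<Rightarrow> real \<Rightarrow> real \<Rightarrow> ennreal" where
  "tail_integral \<mu> \<sigma> r =
     (\<integral>\<^sup>+t\<in>{0..<1}. ennreal ((measure \<mu> {t..<1} / (1 - t) powr \<sigma>) powr r / (1 - t)) \<partial>lborel)"

definition comparable :: "real \<Rightarrow> ennreal \<Rightarrow> ennreal \<Rightarrow> bool" where
  "comparable C X Y \<longleftrightarrow> ennreal (1 / C) * Y \<le> X \<and> X \<le> ennreal C * Y"

end

theory Submission
  imports Defs "HOL-Computational_Algebra.Fundamental_Theorem_Algebra"
begin

text \<open>
  Every quantity is compared with the dyadic sum \<open>D = \<Sum>j d\<^sub>j\<^sup>r\<close>.  Where \<open>|1 - e\<^sup>i\<^sup>\<theta>|\<close> is about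
  \<open>2\<^sup>-\<^sup>i\<close> the potential is at most a multiple of \<open>\<Sum>j\<le>i 2\<^sup>j\<^sup>\<gamma> m\<^sub>j\<close>, and a Hardy inequality for
  geometric weights bounds its norm by \<open>D\<close>; the potential dominates \<open>F\<close> on every circle.
  Conversely \<open>F(a\<^sub>j) \<ge> c 2\<^sup>j\<^sup>\<gamma> m\<^sub>j\<close>, and \<open>\<Sum>j 2\<^sup>-\<^sup>j |f(a\<^sub>j)|\<^sup>p\<close> is controlled by the Hardy norm of \<open>f\<close>.

  The operator is bounded above by Hoelder's inequality, because \<open>C f\<close> is dominated by the radial
  maximal function of \<open>f\<close> times the potential.  It is bounded below on sums of peak functions of
  prescribed size at the points \<open>a\<^sub>j\<close>, by applying the dyadic embedding to \<open>C f\<close>.  Compactness follows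
  from Montel's theorem after splitting \<open>\<mu>\<close> near the point 1.

  The maximal theorem and the dyadic embedding hold for all exponents \<open>p > 0\<close> since \<open>|f|\<^sup>p\<^sup>/\<^sup>2\<close> is
  dominated by its Poisson integral, which reduces both to the boundedness of the Poisson maximal
  operator on the square integrable functions.
\<close>

subsection \<open>Powers of extended nonnegative reals\<close>

text \<open>All comparisons rest on the identity \<sigma>r = \<gamma>r - 1, that is d_j^r = 2^-j
  (2^(j\<gamma>) m_j)^r: the dyadic sum is the r-th power of a size 2^(j\<gamma>) m_j, weighted by
  the length 2^-j of an arc or radial interval near the point 1. The obstacle is that q and r may
  lie below 1. Duality and the triangle inequality then fail, so estimates are stated for integrals
  of powers instead of norms, with the crude factor \<open>2 powr a\<close> for sums. Boundary
  values of Hardy functions are avoided: estimates are proved for dilates of f, which are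
  holomorphic beyond the closed disc, with constants that do not depend on the dilation. The
  comparison constants have to be chosen before \<mu>, which is why lemmas with an implicit constant
  have the form \<open>obtains C\<close> with a bound for every \<mu>, and stand outside the locale
  of a fixed measure.\<close>

lemma ennpowr_top [simp]: "ennpowr top a = top"
  by (simp add: ennpowr_def)

lemma ennpowr_ennreal [simp]: "0 \<le> x \<Longrightarrow> ennpowr (ennreal x) a = ennreal (x powr a)"
  by (simp add: ennpowr_def)

lemma ennpowr_0 [simp]: "ennpowr 0 a = 0"
  by (simp add: ennpowr_def)

lemma ennpowr_exp_1 [simp]: "ennpowr x 1 = x"
  by (cases x) auto

lemma ennpowr_1 [simp]: "ennpowr 1 a = 1"
  using ennpowr_ennreal[of 1 a] by simp

lemma ennpowr_mono: "x \<le> y \<Longrightarrow> 0 \<le> a \<Longrightarrow> ennpowr x a \<le> ennpowr y a"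
  by (cases x; cases y) (auto simp: powr_mono2 top_unique ennreal_leI)

text \<open>Holds for every real exponent, since \<open>ennpowr\<close> fixes 0 and infinity, and 0
  times infinity is 0 on both sides.\<close>

lemma ennpowr_mult: "ennpowr (x * y) a = ennpowr x a * ennpowr y a"
proof (cases x)
  case (real u)
  show ?thesis
  proof (cases y)
    case (real v)
    with \<open>x = ennreal u\<close> \<open>0 \<le> u\<close> show ?thesis
      by (simp flip: ennreal_mult add: powr_mult)
  next
    case top
    with \<open>x = ennreal u\<close> \<open>0 \<le> u\<close> show ?thesis
      by (cases "u = 0") (auto simp: ennreal_mult_top)
  qed
next
  case top
  show ?thesis
  proof (cases y)
    case (real v)
    with top show ?thesis by (cases "v = 0") (auto simp: ennreal_top_mult)
  next
    case top
    with \<open>x = top\<close> show ?thesis by simp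
  qed
qed

lemma ennpowr_ennpowr: "ennpowr (ennpowr x a) b = ennpowr x (a * b)"
  by (cases x) (auto simp: powr_powr)

lemma ennpowr_inverse_cancel [simp]:
  "a \<noteq> 0 \<Longrightarrow> ennpowr (ennpowr x (1/a)) a = x" "a \<noteq> 0 \<Longrightarrow> ennpowr (ennpowr x a) (1/a) = x"
  by (simp_all add: ennpowr_ennpowr)

lemma ennpowr_less_top_iff [simp]: "ennpowr x a < top \<longleftrightarrow> x < top"
  by (cases x) auto

lemma ennpowr_eq_top_iff [simp]: "ennpowr x a = top \<longleftrightarrow> x = top"
  by (cases x) auto

lemma ennpowr_eq_0_iff [simp]: "ennpowr x a = 0 \<longleftrightarrow> x = 0"
  by (cases x) auto

lemma ennpowr_le_iff [simp]: "0 < a \<Longrightarrow> ennpowr x a \<le> ennpowr y a \<longleftrightarrow> x \<le> y"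
  by (metis ennpowr_inverse_cancel(2) ennpowr_mono less_eq_real_def less_irrefl zero_less_divide_1_iff)

lemma ennpowr_le_swap: "0 < a \<Longrightarrow> ennpowr x (1/a) \<le> y \<longleftrightarrow> x \<le> ennpowr y a"
  by (metis ennpowr_inverse_cancel(1) ennpowr_le_iff less_irrefl)

text \<open>Stands in for the triangle inequality at all exponents: the sum is at most twice the
  larger term, and the power of the larger term is at most the sum of the powers.\<close>

lemma ennpowr_add_le:
  assumes "0 < a"
  shows "ennpowr (x + y) a \<le> ennreal (2 powr a) * (ennpowr x a + ennpowr y a)"
proof -
  have "x + y \<le> 2 * max x y"
    by (metis add_mono max.cobounded1 max.cobounded2 mult_2)
  then have "ennpowr (x + y) a \<le> ennpowr (2 * max x y) a"
    using assms by (intro ennpowr_mono) auto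
  also have "\<dots> = ennreal (2 powr a) * ennpowr (max x y) a"
    using ennpowr_ennreal[of 2 a] by (simp add: ennpowr_mult)
  also have "ennpowr (max x y) a \<le> ennpowr x a + ennpowr y a"
    by (simp add: max_def)
  finally show ?thesis
    by (simp add: mult_left_mono)
qed

lemma borel_measurable_ennpowr [measurable (raw)]:
  assumes [measurable]: "f \<in> borel_measurable M"
  shows "(\<lambda>x. ennpowr (f x) a) \<in> borel_measurable M"
  unfolding ennpowr_def by measurable

text \<open>For \<open>a > 0\<close> the power is an order isomorphism whose inverse is the power
  \<open>1/a\<close>, hence it commutes with suprema.\<close>

lemma ennpowr_SUP:
  assumes "0 < a" "I \<noteq> {}"
  shows "ennpowr (SUP i\<in>I. f i) a = (SUP i\<in>I. ennpowr (f i) a)"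
proof (rule antisym)
  have "(SUP i\<in>I. f i) \<le> ennpowr (SUP i\<in>I. ennpowr (f i) a) (1/a)"
  proof (rule SUP_least)
    fix i assume "i \<in> I"
    then have "ennpowr (f i) a \<le> (SUP i\<in>I. ennpowr (f i) a)" by (rule SUP_upper)
    then have "ennpowr (ennpowr (f i) a) (1/a) \<le> ennpowr (SUP i\<in>I. ennpowr (f i) a) (1/a)"
      using assms by (intro ennpowr_mono) auto
    then show "f i \<le> ennpowr (SUP i\<in>I. ennpowr (f i) a) (1/a)" using assms by simp
  qed
  then have "ennpowr (SUP i\<in>I. f i) a \<le> ennpowr (ennpowr (SUP i\<in>I. ennpowr (f i) a) (1/a)) a"
    using assms by (intro ennpowr_mono) auto
  then show "ennpowr (SUP i\<in>I. f i) a \<le> (SUP i\<in>I. ennpowr (f i) a)" using assms by simp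
  show "(SUP i\<in>I. ennpowr (f i) a) \<le> ennpowr (SUP i\<in>I. f i) a"
    using assms by (intro SUP_least ennpowr_mono SUP_upper) auto
qed

lemma tendsto_ennpowr_0:
  assumes "0 < a" "(f \<longlongrightarrow> 0) F"
  shows "((\<lambda>n. ennpowr (f n) a) \<longlongrightarrow> 0) F"
proof (rule order_tendstoI)
  fix e :: ennreal assume "0 < e"
  then have "0 < ennpowr e (1/a)" by (metis ennpowr_eq_0_iff not_gr_zero)
  then have "\<forall>\<^sub>F n in F. f n < ennpowr e (1/a)" using assms(2) order_tendstoD(2) by blast
  then show "\<forall>\<^sub>F n in F. ennpowr (f n) a < e"
  proof eventually_elim
    case (elim n)
    then show ?case using ennpowr_le_swap[OF assms(1), of e "f n"] by (simp add: not_le[symmetric])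
  qed
qed simp

text \<open>Only the ratios \<alpha> and \<beta> occur, so the inequality applies with \<alpha> =
  q/p and \<beta> = q/r even when q or r is below 1. After normalisation by the two integrals it is
  Young's inequality, integrated.\<close>

lemma nn_integral_Holder:
  assumes f: "f \<in> borel_measurable M" and g: "g \<in> borel_measurable M"
    and ab: "0 < \<alpha>" "0 < \<beta>" "\<alpha> + \<beta> = 1"
  shows "(\<integral>\<^sup>+x. ennpowr (f x) \<alpha> * ennpowr (g x) \<beta> \<partial>M)
           \<le> ennpowr (\<integral>\<^sup>+x. f x \<partial>M) \<alpha> * ennpowr (\<integral>\<^sup>+x. g x \<partial>M) \<beta>"
proof -
  note [measurable] = f g
  define A where "A = (\<integral>\<^sup>+x. f x \<partial>M)"
  define B where "B = (\<integral>\<^sup>+x. g x \<partial>M)"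
  \<comment> \<open>A zero integral makes the integrand vanish almost everywhere; an infinite one
    next to a nonzero one makes the right side infinite. Only the finite positive case needs an
    inequality.\<close>
  consider "A = 0 \<or> B = 0" | "A \<noteq> 0" "B \<noteq> 0" "A = top \<or> B = top"
    | a b where "0 < a" "0 < b" "A = ennreal a" "B = ennreal b"
    by (metis ennreal_cases ennreal_0 ennreal_eq_0_iff less_le not_le)
  then show ?thesis
  proof cases
    case 1
    then have "AE x in M. f x = 0 \<or> g x = 0"
      by (auto simp: A_def B_def nn_integral_0_iff_AE elim: eventually_mono)
    then have "AE x in M. ennpowr (f x) \<alpha> * ennpowr (g x) \<beta> = 0"
      by (rule eventually_mono) auto
    then have "(\<integral>\<^sup>+x. ennpowr (f x) \<alpha> * ennpowr (g x) \<beta> \<partial>M) = 0"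
      by (subst nn_integral_0_iff_AE) auto
    then show ?thesis by simp
  next
    case 2
    then have "ennpowr A \<alpha> * ennpowr B \<beta> = top"
      by (auto simp: ennreal_mult_eq_top_iff)
    then show ?thesis by (simp add: A_def B_def)
  next
    case 3
    define K where "K = a powr \<alpha> * b powr \<beta>"
    have K: "K > 0" using 3 by (simp add: K_def)
    \<comment> \<open>Young's inequality for u/a and v/b, multiplied by \<open>K\<close>.
      Integrating the right side gives K(\<alpha> + \<beta>) = K.\<close>
    have pt: "ennpowr u \<alpha> * ennpowr v \<beta> \<le> ennreal (K*\<alpha>/a) * u + ennreal (K*\<beta>/b) * v" for u v
    proof (cases "u = top \<or> v = top")
      case True
      then show ?thesis using K 3 ab by (auto simp: ennreal_mult_eq_top_iff ennreal_mult_top)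
    next
      case False
      then obtain x y where xy: "u = ennreal x" "0 \<le> x" "v = ennreal y" "0 \<le> y"
        by (metis ennreal_cases)
      have "x powr \<alpha> * y powr \<beta> \<le> K*\<alpha>/a * x + K*\<beta>/b * y"
      proof (cases "x = 0 \<or> y = 0")
        case True
        then show ?thesis using xy K 3 ab by auto
      next
        case False
        have "(x/a) powr \<alpha> * (y/b) powr \<beta> \<le> \<alpha> * (x/a) + \<beta> * (y/b)"
          using False xy 3 ab by (intro Youngs_inequality_0) auto
        then have "K * ((x/a) powr \<alpha> * (y/b) powr \<beta>) \<le> K * (\<alpha> * (x/a) + \<beta> * (y/b))"
          using K by simp
        also have "K * ((x/a) powr \<alpha> * (y/b) powr \<beta>) = x powr \<alpha> * y powr \<beta>"
          using 3 xy by (simp add: K_def powr_divide)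
        finally show ?thesis by (simp add: algebra_simps)
      qed
      then show ?thesis using xy K 3 ab
        by (simp flip: ennreal_mult ennreal_plus)
    qed
    have "(\<integral>\<^sup>+x. ennpowr (f x) \<alpha> * ennpowr (g x) \<beta> \<partial>M)
        \<le> (\<integral>\<^sup>+x. ennreal (K*\<alpha>/a) * f x + ennreal (K*\<beta>/b) * g x \<partial>M)"
      by (intro nn_integral_mono pt)
    also have "\<dots> = ennreal (K*\<alpha>/a) * A + ennreal (K*\<beta>/b) * B"
      by (simp add: A_def B_def nn_integral_add nn_integral_cmult)
    also have "\<dots> = ennreal (K*\<alpha>/a * a + K*\<beta>/b * b)"
      using 3 K ab by (simp flip: ennreal_mult ennreal_plus)
    also have "K*\<alpha>/a * a + K*\<beta>/b * b = K"
      using 3 ab by (simp flip: distrib_left)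
    also have "ennreal K = ennpowr A \<alpha> * ennpowr B \<beta>"
      using 3 by (simp add: K_def ennreal_mult)
    finally show ?thesis by (simp add: A_def B_def)
  qed
qed

subsection \<open>Convolution with geometric weights\<close>

text \<open>The indices on either side of \<open>k\<close> form a geometric series each; counting
  the diagonal twice gives a bound uniform in \<open>k\<close>.\<close>

lemma suminf_geometric_abs_diff_le:
  fixes c :: real
  assumes "0 < c" "c < 1"
  shows "(\<Sum>i. ennreal (c ^ nat \<bar>int i - int k\<bar>)) \<le> ennreal (2 / (1 - c))"
proof -
  have s: "summable (\<lambda>n. c ^ n)" using assms by simp
  have "(\<Sum>i<n. c ^ nat \<bar>int i - int k\<bar>) \<le> 2 / (1 - c)" for n
  proof -
    have "(\<Sum>i<n. c ^ nat \<bar>int i - int k\<bar>) \<le> (\<Sum>i\<in>{..k} \<union> {k..n+k}. c ^ nat \<bar>int i - int k\<bar>)"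
      using assms by (intro sum_mono2) auto
    also have "\<dots> \<le> (\<Sum>i\<le>k. c ^ nat \<bar>int i - int k\<bar>) + (\<Sum>i=k..n+k. c ^ nat \<bar>int i - int k\<bar>)"
      using assms by (subst sum_Un) (auto intro!: sum_nonneg)
    also have "(\<Sum>i\<le>k. c ^ nat \<bar>int i - int k\<bar>) = (\<Sum>i\<le>k. c ^ i)"
      by (rule sum.reindex_bij_witness[of _ "\<lambda>i. k - i" "\<lambda>i. k - i"])
         (auto intro!: arg_cong[where f="\<lambda>m. c ^ m"])
    also have "(\<Sum>i=k..n+k. c ^ nat \<bar>int i - int k\<bar>) = (\<Sum>i\<le>n. c ^ i)"
      by (rule sum.reindex_bij_witness[of _ "\<lambda>i. i + k" "\<lambda>i. i - k"])
         (auto intro!: arg_cong[where f="\<lambda>m. c ^ m"])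
    also have "(\<Sum>i\<le>k. c ^ i) \<le> (\<Sum>i. c ^ i)" using assms by (intro sum_le_suminf s) auto
    also have "(\<Sum>i\<le>n. c ^ i) \<le> (\<Sum>i. c ^ i)" using assms by (intro sum_le_suminf s) auto
    also have "(\<Sum>i. c ^ i) + (\<Sum>i. c ^ i) = 2 / (1 - c)"
      using assms by (simp add: suminf_geometric)
    finally show ?thesis by simp
  qed
  then show ?thesis
    using assms by (intro suminf_le_const) (auto simp: sum_ennreal ennreal_leI)
qed

text \<open>A Hardy inequality valid for all exponents: splitting the geometric factor in two halves bounds
  the inner sum by a constant times a maximum, and the power of a maximum is at most the sum
  of the powers, so no distinction between small and large exponents is needed.\<close>

lemma geometric_convolution_bound:
  fixes r \<delta> :: real
  assumes "0 < r" "0 < \<delta>"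
  obtains C :: real where "0 < C"
    "\<And>(x :: nat \<Rightarrow> real) y A. \<lbrakk>\<And>k. 0 \<le> x k; \<And>i. 0 \<le> y i; \<And>i. finite (A i);
        \<And>i. y i \<le> (\<Sum>k\<in>A i. 2 powr (-\<delta> * \<bar>real i - real k\<bar>) * x k)\<rbrakk>
      \<Longrightarrow> (\<Sum>i. ennreal (y i powr r)) \<le> ennreal C * (\<Sum>k. ennreal (x k powr r))"
proof -
  \<comment> \<open>\<open>b\<close> carries half of the decay, and \<open>S\<close> bounds the sum
    of its powers; \<open>c\<close> is the r-th power of the other half, and \<open>T\<close> bounds
    the sum of its powers.\<close>
  define b c S T where "b = 2 powr (-\<delta>/2)" and "c = b powr r"
    and "S = 2 / (1 - b)" and "T = 2 / (1 - c)"
  have b: "0 < b" "b < 1" using assms by (auto simp: b_def powr_less_one)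
  have c: "0 < c" "c < 1"
    using b assms powr_less_mono2[of r b 1] by (auto simp: c_def)
  have S: "S > 0" and T: "T > 0" using b c by (auto simp: S_def T_def)
  define e where "e = (\<lambda>i k::nat. nat \<bar>int i - int k\<bar>)"
  have e_sym: "e i k = e k i" for i k by (simp add: e_def)
  have Pe: "2 powr (-\<delta> * \<bar>real i - real k\<bar>) = b ^ e i k * b ^ e i k" for i k
  proof -
    have "\<bar>real i - real k\<bar> = real (e i k)" by (auto simp: e_def)
    then show ?thesis using b by (simp add: b_def powr_powr flip: powr_realpow powr_add)
  qed
  show ?thesis
  proof (rule that[of "S powr r * T"])
    show "0 < S powr r * T" using S T by simp
    fix x y :: "nat \<Rightarrow> real" and A :: "nat \<Rightarrow> nat set"
    assume x: "\<And>k. 0 \<le> x k" and y: "\<And>i. 0 \<le> y i" and fin: "\<And>i. finite (A i)"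
      and le: "\<And>i. y i \<le> (\<Sum>k\<in>A i. 2 powr (-\<delta> * \<bar>real i - real k\<bar>) * x k)"
    have one: "y i powr r \<le> S powr r * (\<Sum>k\<in>A i. c ^ e i k * x k powr r)" for i
    proof (cases "A i = {}")
      case True
      then show ?thesis using le[of i] y[of i] assms by simp
    next
      case False
      define m where "m = Max ((\<lambda>k. b ^ e i k * x k) ` A i)"
      have m_ge: "b ^ e i k * x k \<le> m" if "k \<in> A i" for k
        unfolding m_def using fin that by (intro Max_ge) auto
      have "m \<in> (\<lambda>k. b ^ e i k * x k) ` A i"
        unfolding m_def using fin False by (intro Max_in) auto
      then obtain k0 where k0: "k0 \<in> A i" "m = b ^ e i k0 * x k0" by auto
      have m0: "0 \<le> m" using k0 x b by simp
      have "(\<Sum>k\<in>A i. b ^ e i k) \<le> S"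
      proof -
        have "ennreal (\<Sum>k\<in>A i. b ^ e i k) = (\<Sum>k\<in>A i. ennreal (b ^ e k i))"
          using b by (simp add: sum_ennreal e_sym)
        also have "\<dots> \<le> (\<Sum>k. ennreal (b ^ e k i))"
          using fin by (intro sum_le_suminf) auto
        also have "\<dots> \<le> ennreal S"
          unfolding S_def e_def by (rule suminf_geometric_abs_diff_le[OF b])
        finally show ?thesis using S by (simp add: ennreal_le_iff2)
      qed
      have "y i \<le> (\<Sum>k\<in>A i. b ^ e i k * (b ^ e i k * x k))"
        using le[of i] unfolding Pe mult.assoc .
      also have "\<dots> \<le> (\<Sum>k\<in>A i. b ^ e i k * m)"
        using b m_ge by (intro sum_mono mult_left_mono) auto
      also have "\<dots> = (\<Sum>k\<in>A i. b ^ e i k) * m" by (simp add: sum_distrib_right)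
      also have "\<dots> \<le> S * m" using m0 \<open>_ \<le> S\<close> by (intro mult_right_mono)
      finally have "y i powr r \<le> (S * m) powr r" using y assms by (intro powr_mono2) auto
      also have "\<dots> = S powr r * m powr r" using S m0 by (simp add: powr_mult)
      also have "m powr r = c ^ e i k0 * x k0 powr r"
      proof -
        have "(b ^ e i k0) powr r = c ^ e i k0"
          using b by (simp add: c_def powr_powr mult.commute flip: powr_realpow)
        then show ?thesis using k0 b x by (simp add: powr_mult)
      qed
      also have "\<dots> \<le> (\<Sum>k\<in>A i. c ^ e i k * x k powr r)"
        using fin k0 c by (intro member_le_sum[where f = "\<lambda>k. c ^ e i k * x k powr r"]) auto
      finally show ?thesis using S by (simp add: mult_left_mono)
    qed
    have 1: "(\<Sum>i. ennreal (y i powr r)) \<le> (\<Sum>i. ennreal (S powr r) * (\<Sum>k. ennreal (c ^ e i k) * ennreal (x k powr r)))"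
    proof (intro suminf_le allI summableI)
      fix i
      have "ennreal (y i powr r) \<le> ennreal (S powr r * (\<Sum>k\<in>A i. c ^ e i k * x k powr r))"
        using one by (intro ennreal_leI)
      also have "\<dots> = ennreal (S powr r) * (\<Sum>k\<in>A i. ennreal (c ^ e i k) * ennreal (x k powr r))"
      proof -
        have "ennreal (\<Sum>k\<in>A i. c ^ e i k * x k powr r) = (\<Sum>k\<in>A i. ennreal (c ^ e i k * x k powr r))"
          using c by (intro sum_ennreal[symmetric]) auto
        also have "\<dots> = (\<Sum>k\<in>A i. ennreal (c ^ e i k) * ennreal (x k powr r))"
          using c by (intro sum.cong refl ennreal_mult) auto
        finally show ?thesis
          using c by (subst ennreal_mult) (auto intro!: sum_nonneg)
      qed
      also have "\<dots> \<le> ennreal (S powr r) * (\<Sum>k. ennreal (c ^ e i k) * ennreal (x k powr r))"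
        using fin by (intro mult_left_mono sum_le_suminf) auto
      finally show "ennreal (y i powr r) \<le> \<dots>" .
    qed
    have 2: "\<dots> = ennreal (S powr r) * (\<Sum>i. \<Sum>k. ennreal (c ^ e i k) * ennreal (x k powr r))"
      by (rule ennreal_suminf_cmult)
    \<comment> \<open>Summation over \<open>i\<close> is read as an integral over the counting
      measure, so that exchanging the two series is exchanging an integral with a series of
      nonnegative functions.\<close>
    have "(\<Sum>i. \<Sum>k. ennreal (c ^ e i k) * ennreal (x k powr r))
             = (\<Sum>k. \<Sum>i. ennreal (c ^ e i k) * ennreal (x k powr r))"
    proof -
      have "(\<integral>\<^sup>+i. (\<Sum>k. ennreal (c ^ e i k) * ennreal (x k powr r)) \<partial>count_space UNIV)
          = (\<Sum>k. \<integral>\<^sup>+i. ennreal (c ^ e i k) * ennreal (x k powr r) \<partial>count_space UNIV)"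
        by (rule nn_integral_suminf) auto
      then show ?thesis unfolding nn_integral_count_space_nat .
    qed
    also have "\<dots> = (\<Sum>k. (\<Sum>i. ennreal (c ^ e i k)) * ennreal (x k powr r))"
      by (simp only: ennreal_suminf_multc)
    also have "\<dots> \<le> (\<Sum>k. ennreal T * ennreal (x k powr r))"
      unfolding T_def e_def
      by (intro suminf_le allI summableI mult_right_mono suminf_geometric_abs_diff_le c) auto
    also have "\<dots> = ennreal T * (\<Sum>k. ennreal (x k powr r))" by (rule ennreal_suminf_cmult)
    finally have "ennreal (S powr r) * (\<Sum>i. \<Sum>k. ennreal (c ^ e i k) * ennreal (x k powr r))
        \<le> ennreal (S powr r) * (ennreal T * (\<Sum>k. ennreal (x k powr r)))"
      by (rule mult_left_mono) simp
    with 1 2 have "(\<Sum>i. ennreal (y i powr r)) \<le> ennreal (S powr r) * (ennreal T * (\<Sum>k. ennreal (x k powr r)))"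
      by (simp only:)
    also have "\<dots> = ennreal (S powr r * T) * (\<Sum>k. ennreal (x k powr r))"
      using T by (subst ennreal_mult) (simp_all only: mult.assoc powr_ge_zero less_imp_le)
    finally show "(\<Sum>i. ennreal (y i powr r)) \<le> ennreal (S powr r * T) * (\<Sum>k. ennreal (x k powr r))" .
  qed
qed

subsection \<open>The Poisson kernel\<close>

definition poisson :: "complex \<Rightarrow> complex \<Rightarrow> real" where
  "poisson z w = (1 - (cmod z)\<^sup>2) / (cmod (w - z))\<^sup>2"

text \<open>Normalised arc measure pulled back to the angle, as a measure on the reals: functions on
  the circle enter through \<open>cis \<theta>\<close>, so that measurability is Borel measurability
  in \<theta>.\<close>

definition arc :: "real measure" where
  "arc = density lborel (\<lambda>\<theta>. indicator {0..2*pi} \<theta> * ennreal (1 / (2*pi)))"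

lemma sets_arc [simp, measurable_cong]: "sets arc = sets borel"
  by (simp add: arc_def)

lemma space_arc [simp]: "space arc = UNIV"
  by (simp add: arc_def)

lemma nn_integral_arc:
  assumes [measurable]: "f \<in> borel_measurable borel"
  shows "(\<integral>\<^sup>+\<theta>. f \<theta> \<partial>arc) = (\<integral>\<^sup>+\<theta>\<in>{0..2*pi}. f \<theta> \<partial>lborel) / ennreal (2*pi)"
proof -
  have "(\<integral>\<^sup>+\<theta>. f \<theta> \<partial>arc) = (\<integral>\<^sup>+\<theta>. (f \<theta> * indicator {0..2*pi} \<theta>) * ennreal (1 / (2*pi)) \<partial>lborel)"
    by (simp add: arc_def nn_integral_density mult_ac)
  also have "\<dots> = (\<integral>\<^sup>+\<theta>\<in>{0..2*pi}. f \<theta> \<partial>lborel) * ennreal (1 / (2*pi))"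
    by (simp add: nn_integral_multc)
  also have "ennreal (1 / (2*pi)) = inverse (ennreal (2*pi))"
    by (simp add: inverse_ennreal inverse_eq_divide)
  finally show ?thesis by (simp add: divide_ennreal_def)
qed

lemma emeasure_arc_UNIV [simp]: "emeasure arc UNIV = 1"
proof -
  have "emeasure arc UNIV = (\<integral>\<^sup>+\<theta>. indicator {0..2*pi} \<theta> * ennreal (1 / (2*pi)) \<partial>lborel)"
    by (simp add: arc_def emeasure_density)
  also have "\<dots> = ennreal (2*pi) * ennreal (1 / (2*pi))"
    by (simp add: nn_integral_multc)
  also have "\<dots> = 1"
    by (subst ennreal_mult[symmetric]) auto
  finally show ?thesis .
qed

interpretation arc: finite_measure arc
  by standard simp

lemma AE_arc_strict: "AE \<theta> in arc. 0 < \<theta> \<and> \<theta> < 2*pi"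
proof -
  have "AE \<theta> in lborel. \<theta> \<noteq> (0::real)" "AE \<theta> in lborel. \<theta> \<noteq> (2*pi::real)"
    by (rule AE_lborel_singleton)+
  then have "AE \<theta> in lborel. 0 < indicator {0..2*pi} \<theta> * ennreal (1 / (2*pi)) \<longrightarrow> 0 < \<theta> \<and> \<theta> < 2*pi"
    by eventually_elim (auto simp: indicator_def)
  then show ?thesis unfolding arc_def by (subst AE_density) auto
qed

text \<open>Passes to the gauge integral over one period, the form in which contour integrals over
  the circle are evaluated.\<close>

lemma integral_arc:
  fixes f :: "real \<Rightarrow> 'a :: euclidean_space"
  assumes "continuous_on UNIV f"
  shows "integrable arc f"
    and "(LINT \<theta>|arc. f \<theta>) = (1 / (2*pi)) *\<^sub>R integral {0..2*pi} f"
proof -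
  have [measurable]: "f \<in> borel_measurable borel"
    using assms by (rule borel_measurable_continuous_onI)
  have i: "set_integrable lborel {0..2*pi} f"
    by (rule borel_integrable_atLeastAtMost') (use assms continuous_on_subset in blast)
  have arc_real: "arc = density lborel (\<lambda>\<theta>. ennreal (indicator {0..2*pi} \<theta> / (2*pi)))"
    unfolding arc_def by (rule arg_cong[where f="density lborel"]) (auto simp: indicator_def fun_eq_iff)
  have i': "integrable lborel (\<lambda>\<theta>. (1/(2*pi)) *\<^sub>R (indicator {0..2*pi} \<theta> *\<^sub>R f \<theta>))"
    using i unfolding set_integrable_def by (rule integrable_scaleR_right)
  then show "integrable arc f"
    unfolding arc_real by (subst integrable_density) auto
  have "(LINT \<theta>|arc. f \<theta>) = (LINT \<theta>|lborel. (1/(2*pi)) *\<^sub>R (indicator {0..2*pi} \<theta> *\<^sub>R f \<theta>))"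
    unfolding arc_real by (subst integral_density) auto
  also have "\<dots> = (1/(2*pi)) *\<^sub>R (LINT \<theta>:{0..2*pi}|lborel. f \<theta>)"
    by (simp only: integral_scaleR_right set_lebesgue_integral_def)
  also have "(LINT \<theta>:{0..2*pi}|lborel. f \<theta>) = integral {0..2*pi} f"
    using i by (rule set_borel_integral_eq_integral(2))
  finally show "(LINT \<theta>|arc. f \<theta>) = (1 / (2*pi)) *\<^sub>R integral {0..2*pi} f" .
qed

lemma poisson_nonneg: "cmod z < 1 \<Longrightarrow> 0 \<le> poisson z w"
  unfolding poisson_def by (auto intro!: divide_nonneg_nonneg simp: power_le_one)

lemma poisson_le:
  assumes "cmod z < 1" "cmod w = 1"
  shows "poisson z w \<le> 2 / (1 - cmod z)"
proof -
  have 1: "1 - cmod z \<le> cmod (w - z)"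
    using norm_triangle_ineq2[of w z] assms by simp
  have "poisson z w \<le> (1 - (cmod z)\<^sup>2) / (1 - cmod z)\<^sup>2"
    unfolding poisson_def using assms 1
    by (intro divide_left_mono power_mono mult_pos_pos) (auto simp: power_le_one)
  also have "\<dots> = (1 + cmod z) / (1 - cmod z)"
  proof -
    have "1 - (cmod z)\<^sup>2 = (1 - cmod z) * (1 + cmod z)" by (simp add: power2_eq_square algebra_simps)
    then show ?thesis using assms by (simp add: power2_eq_square)
  qed
  also have "\<dots> \<le> 2 / (1 - cmod z)"
    using assms by (intro divide_right_mono) auto
  finally show ?thesis .
qed

lemma borel_measurable_cis [measurable]: "cis \<in> borel_measurable borel"
  by (rule borel_measurable_continuous_onI) (auto intro!: continuous_intros)

lemma borel_measurable_poisson [measurable (raw)]: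
  assumes [measurable]: "f \<in> borel_measurable M" "g \<in> borel_measurable M"
  shows "(\<lambda>x. poisson (f x) (g x)) \<in> borel_measurable M"
  unfolding poisson_def by measurable

lemma cis_neq: "cmod z < 1 \<Longrightarrow> cis \<theta> \<noteq> z"
  by auto

lemma continuous_poisson:
  assumes "cmod z < 1"
  shows "continuous_on UNIV (\<lambda>\<theta>. poisson z (cis \<theta>))"
  unfolding poisson_def using assms
  by (intro continuous_intros) (simp add: cis_neq)

lemma cnj_mult_neq_1: "cmod z < 1 \<Longrightarrow> cmod w \<le> 1 \<Longrightarrow> cnj z * w \<noteq> 1"
proof
  assume "cmod z < 1" "cmod w \<le> 1" "cnj z * w = 1"
  then have "cmod z * cmod w = 1" by (metis complex_mod_cnj norm_mult norm_one)
  moreover have "cmod z * cmod w \<le> cmod z" using \<open>cmod w \<le> 1\<close> by (simp add: mult_left_le)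
  ultimately show False using \<open>cmod z < 1\<close> by simp
qed

text \<open>On the circle the Poisson kernel is \<open>w (1 - |z|\<^sup>2) / ((w - z) (1 - cnj z w))\<close>, so the Poisson
  formula for \<open>h\<close> is the Cauchy formula for \<open>h(w) (1 - |z|\<^sup>2) / (1 - cnj z w)\<close>.\<close>

lemma poisson_formula:
  assumes h: "continuous_on (cball 0 1) h" "h holomorphic_on ball 0 1" and z: "cmod z < 1"
  shows "integral {0..2*pi} (\<lambda>\<theta>. of_real (poisson z (cis \<theta>)) * h (cis \<theta>)) = of_real (2*pi) * h z"
proof -
  define H where "H = (\<lambda>w. h w * of_real (1 - (cmod z)\<^sup>2) / (1 - cnj z * w))"
  have nz: "1 - cnj z * w \<noteq> 0" if "cmod w \<le> 1" for w
    using cnj_mult_neq_1[OF z that] by auto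
  have "((\<lambda>u. H u / (u - z)) has_contour_integral (2 * of_real pi * \<i> * H z)) (circlepath 0 1)"
  proof (rule Cauchy_integral_circlepath)
    show "continuous_on (cball 0 1) H"
      unfolding H_def using nz by (intro continuous_intros h) auto
    show "H holomorphic_on ball 0 1"
      unfolding H_def using nz by (intro holomorphic_intros h) auto
    show "cmod (z - 0) < 1" using z by simp
  qed
  moreover have "H z = h z"
  proof -
    have "1 - cnj z * z = of_real (1 - (cmod z)\<^sup>2)"
      by (metis complex_norm_square mult.commute of_real_1 of_real_diff)
    moreover have "(cmod z)\<^sup>2 < 1" using z by (simp add: abs_square_less_1)
    ultimately show ?thesis by (simp add: H_def del: of_real_diff)
  qed
  ultimately have "((\<lambda>u. H u / (u - z)) has_contour_integral (2 * of_real pi * \<i> * h z))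
      (part_circlepath 0 1 0 (2*pi))"
    by (simp add: circlepath_def)
  then have "((\<lambda>\<theta>. H (cis \<theta>) / (cis \<theta> - z) * of_real 1 * \<i> * cis \<theta>) has_integral (2 * of_real pi * \<i> * h z)) {0..2*pi}"
    by (subst (asm) has_contour_integral_part_circlepath_iff) auto
  \<comment> \<open>The factor -i cancels the i of dw = i w d\<theta>; the remaining w turns the
    Cauchy kernel into the Poisson kernel.\<close>
  then have int: "((\<lambda>\<theta>. (-\<i>) * (H (cis \<theta>) / (cis \<theta> - z) * of_real 1 * \<i> * cis \<theta>)) has_integral ((-\<i>) * (2 * of_real pi * \<i> * h z))) {0..2*pi}"
    by (rule has_integral_mult_right)
  have eq: "(-\<i>) * (H (cis \<theta>) / (cis \<theta> - z) * of_real 1 * \<i> * cis \<theta>)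
      = of_real (poisson z (cis \<theta>)) * h (cis \<theta>)" for \<theta>
  proof -
    let ?w = "cis \<theta>"
    have w: "?w * cnj ?w = 1" by (simp add: cis_cnj cis_mult)
    have wz: "?w - z \<noteq> 0" using cis_neq[OF z] by simp
    have "of_real ((cmod (?w - z))\<^sup>2) = (?w - z) * (cnj ?w - cnj z)"
      by (metis complex_cnj_diff complex_norm_square)
    then have "of_real ((cmod (?w - z))\<^sup>2) * ?w = (?w - z) * (cnj ?w - cnj z) * ?w"
      by (simp only:)
    also have "\<dots> = (?w - z) * (?w * cnj ?w - cnj z * ?w)"
      by (simp add: algebra_simps)
    finally have *: "of_real ((cmod (?w - z))\<^sup>2) * ?w = (?w - z) * (1 - cnj z * ?w)"
      by (simp add: w)
    have i: "(-\<i>) * (X * of_real 1 * \<i> * w) = X * w" for X w :: complex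
      by (simp add: algebra_simps)
    have "(-\<i>) * (H ?w / (?w - z) * of_real 1 * \<i> * ?w) = H ?w * ?w / (?w - z)"
      unfolding i by simp
    also have "\<dots> = h ?w * of_real (1 - (cmod z)\<^sup>2) * ?w / ((?w - z) * (1 - cnj z * ?w))"
      by (simp add: H_def)
    also have "\<dots> = h ?w * of_real (1 - (cmod z)\<^sup>2) / of_real ((cmod (?w - z))\<^sup>2)"
      unfolding *[symmetric] by simp
    finally show ?thesis by (simp add: poisson_def)
  qed
  show ?thesis
    using integral_unique[OF int] unfolding eq by simp
qed

lemma poisson_formula_arc:
  assumes h: "continuous_on (cball 0 1) h" "h holomorphic_on ball 0 1" and z: "cmod z < 1"
  shows "(LINT \<theta>|arc. of_real (poisson z (cis \<theta>)) * h (cis \<theta>)) = h z"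
proof -
  have "continuous_on UNIV (\<lambda>\<theta>. of_real (poisson z (cis \<theta>)) * h (cis \<theta>))"
    by (intro continuous_intros continuous_poisson z continuous_on_compose2[OF h(1)]) auto
  from integral_arc(2)[OF this] show ?thesis
    by (simp add: poisson_formula[OF assms] scaleR_conv_of_real)
qed

text \<open>The Poisson formula is applied to h(w) = (1 + cnj z' w)/(1 - cnj z' w), whose real part
  on the circle is the Poisson kernel of z'. The right side is again a Poisson kernel, with the
  radii multiplied and the angles subtracted.\<close>

lemma poisson_semigroup:
  assumes "cmod z < 1" "cmod z' < 1"
  shows "(LINT \<theta>|arc. poisson z (cis \<theta>) * poisson z' (cis \<theta>))
           = (1 - (cmod z * cmod z')\<^sup>2) / (cmod (1 - cnj z' * z))\<^sup>2"
proof -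
  define h where "h = (\<lambda>w. (1 + cnj z' * w) / (1 - cnj z' * w))"
  have nz: "1 - cnj z' * w \<noteq> 0" if "cmod w \<le> 1" for w
    using cnj_mult_neq_1[OF assms(2) that] by auto
  have Re_h: "Re (h w) = (1 - (cmod z' * cmod w)\<^sup>2) / (cmod (1 - cnj z' * w))\<^sup>2" for w
  proof -
    have "Re (h w) = Re ((1 + cnj z' * w) * cnj (1 - cnj z' * w)) / (cmod (1 - cnj z' * w))\<^sup>2"
      unfolding h_def by (subst complex_div_cnj) (simp only: Re_divide_of_real flip: of_real_power) 
    also have "Re ((1 + cnj z' * w) * cnj (1 - cnj z' * w)) = 1 - (cmod (cnj z' * w))\<^sup>2"
      unfolding cmod_power2 by (simp add: algebra_simps power2_eq_square)
    finally show ?thesis by (simp add: norm_mult)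
  qed
  have Re_h_cis: "Re (h (cis \<theta>)) = poisson z' (cis \<theta>)" for \<theta>
  proof -
    have "cmod (1 - cnj z' * cis \<theta>) = cmod (cnj (1 - cnj z' * cis \<theta>)) * cmod (cis \<theta>)"
      by (simp only: norm_cis complex_mod_cnj mult_1_right)
    also have "\<dots> = cmod (cnj (1 - cnj z' * cis \<theta>) * cis \<theta>)"
      by (simp only: norm_mult)
    also have "cnj (1 - cnj z' * cis \<theta>) * cis \<theta> = cis \<theta> - z'"
      by (simp add: algebra_simps cis_cnj cis_mult)
    finally show ?thesis by (simp add: Re_h poisson_def)
  qed
  have hc: "continuous_on (cball 0 1) h"
    unfolding h_def using nz by (intro continuous_intros) auto
  have hh: "h holomorphic_on ball 0 1"
    unfolding h_def using nz by (intro holomorphic_intros) auto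
  have "continuous_on UNIV (\<lambda>\<theta>. of_real (poisson z (cis \<theta>)) * h (cis \<theta>))"
    by (intro continuous_intros continuous_poisson assms continuous_on_compose2[OF hc]) auto
  note int = integral_arc(1)[OF this]
  have "(LINT \<theta>|arc. Re (of_real (poisson z (cis \<theta>)) * h (cis \<theta>))) = Re (h z)"
    by (subst integral_Re[OF int]) (simp add: poisson_formula_arc[OF hc hh assms(1)])
  moreover have "Re (of_real c * h w) = c * Re (h w)" for c w by simp
  ultimately show ?thesis by (simp only: Re_h_cis Re_h[of z] mult.commute[of "cmod z'"])
qed

text \<open>Multiplying the smaller radius by the larger one, which lies between it and 1, changes
  the kernel by a bounded factor only. The 8 is 2 from the numerator times 4 from the squared
  distance.\<close>

lemma poisson_semigroup_le:
  assumes "cmod z \<le> cmod z'" "cmod z' < 1" "z' = of_real (cmod z') * cis \<theta>'"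
  shows "(LINT \<theta>|arc. poisson z (cis \<theta>) * poisson z' (cis \<theta>)) \<le> 8 * poisson z (cis \<theta>')"
proof -
  define t t' where "t = cmod z" and "t' = cmod z'"
  have t: "0 \<le> t" "t \<le> t'" "t' < 1" using assms by (auto simp: t_def t'_def)
  have tt: "t * t' < 1" using t
    using mult_left_le[of t' t] by linarith
  have d0: "1 - t * t' \<le> cmod (1 - cnj z' * z)"
    using norm_triangle_ineq2[of 1 "cnj z' * z"] by (simp add: norm_mult t_def t'_def mult.commute)
  have "cis \<theta>' - z = cis \<theta>' * (1 - cis (-\<theta>') * z)"
    by (simp add: algebra_simps cis_mult)
  then have "cmod (cis \<theta>' - z) = cmod (1 - cis (-\<theta>') * z)" by (metis norm_mult norm_cis mult_1)
  also have "1 - cis (-\<theta>') * z = (1 - cnj z' * z) - of_real (1 - t') * (cis (-\<theta>') * z)"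
    by (subst assms(3)) (simp add: t'_def cis_cnj algebra_simps)
  also have "cmod \<dots> \<le> cmod (1 - cnj z' * z) + cmod (of_real (1 - t') * (cis (-\<theta>') * z))"
    by (rule norm_triangle_ineq4)
  also have "cmod (of_real (1 - t') * (cis (-\<theta>') * z)) = (1 - t') * t"
    using t by (simp add: norm_mult t_def del: of_real_diff)
  also have "(1 - t') * t \<le> 1 - t * t'" using t by (simp add: algebra_simps)
  also note d0
  finally have d: "cmod (cis \<theta>' - z) \<le> 2 * cmod (1 - cnj z' * z)" by simp
  have pos: "0 < cmod (cis \<theta>' - z)"
    using cis_neq[of z \<theta>'] t by (auto simp: t_def)
  \<comment> \<open>Since t \<le> t', the left side is at most 1 - t^4, and 2(1 - t^2) - (1 - t^4)
    is the square of 1 - t^2.\<close>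
  have n: "1 - (t * t')\<^sup>2 \<le> 2 * (1 - t\<^sup>2)"
  proof -
    have "t * t \<le> t * t'" using t by (intro mult_left_mono)
    then have "(t * t)\<^sup>2 \<le> (t * t')\<^sup>2" using t by (intro power_mono) auto
    moreover have "2 * (1 - t\<^sup>2) - (1 - (t * t)\<^sup>2) = (1 - t\<^sup>2)\<^sup>2" by (simp add: power2_eq_square algebra_simps)
    moreover have "0 \<le> (1 - t\<^sup>2)\<^sup>2" by simp
    ultimately show ?thesis by linarith
  qed
  have "(1 - (t * t')\<^sup>2) / (cmod (1 - cnj z' * z))\<^sup>2 \<le> (2 * (1 - t\<^sup>2)) / (cmod (cis \<theta>' - z) / 2)\<^sup>2"
    using n d pos t by (intro frac_le power_mono) (auto simp: power_le_one)
  also have "\<dots> = 8 * poisson z (cis \<theta>')" by (simp add: poisson_def t_def power_divide)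
  finally show ?thesis
    using assms by (subst poisson_semigroup) (auto simp: t_def t'_def)
qed

subsection \<open>Powers of holomorphic functions and the Poisson kernel\<close>

text \<open>A zero \<open>a\<close> of the polynomial in the closed disc is traded for the factor \<open>1 - cnj a z\<close>, which
  has the same modulus on the circle and a holomorphic \<open>s\<close>-th power in the disc.\<close>

lemma polynomial_holomorphic_majorant:
  fixes P :: "complex poly"
  assumes s: "0 < s"
  shows "\<exists>H. continuous_on (cball 0 1) H \<and> H holomorphic_on ball 0 1 \<and>
           (\<forall>z\<in>cball 0 1. cmod (poly P z) powr s \<le> cmod (H z)) \<and>
           (\<forall>z\<in>sphere 0 1. cmod (H z) = cmod (poly P z) powr s)"
proof -
  \<comment> \<open>For |b| \<le> 1 the real part of 1 - bz is nonnegative on the closed disc and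
    positive inside. The principal branch of the power is therefore holomorphic in the disc and
    continuous up to the circle, even where 1 - bz vanishes.\<close>
  define G :: "complex \<Rightarrow> complex \<Rightarrow> complex" where "G = (\<lambda>b z. (1 - b * z) powr of_real s)"
  have re: "0 < Re (1 - b * z)" if "cmod b \<le> 1" "cmod z < 1" for b z
  proof -
    have "cmod (b * z) < 1" using that mult_left_le[of "cmod b" "cmod z"]
      by (simp add: norm_mult mult.commute)
    then show ?thesis using complex_Re_le_cmod[of "b * z"] by simp
  qed
  have re': "0 \<le> Re (1 - b * z)" if "cmod b \<le> 1" "cmod z \<le> 1" for b z
    using that mult_le_one[of "cmod b" "cmod z"] complex_Re_le_cmod[of "b * z"] by (simp add: norm_mult)
  have Gc: "continuous_on (cball 0 1) (G b)" if "cmod b \<le> 1" for b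
    unfolding G_def using s re'[OF that] by (intro continuous_on_powr_complex continuous_intros) auto
  have Gh: "G b holomorphic_on ball 0 1" if "cmod b \<le> 1" for b
  proof -
    have "1 - b * z \<notin> \<real>\<^sub>\<le>\<^sub>0" if "z \<in> ball 0 1" for z
      using re[OF \<open>cmod b \<le> 1\<close>, of z] that unfolding complex_nonpos_Reals_iff by simp
    then show ?thesis unfolding G_def by (intro holomorphic_intros) auto
  qed
  have Gn: "cmod (G b z) = cmod (1 - b * z) powr s" for b z
    by (simp add: G_def norm_powr_real_powr')
  show ?thesis
  proof (induction "degree P" arbitrary: P)
    case 0
    then obtain c where "P = [:c:]" by (metis degree_0_id)
    then show ?case by (intro exI[of _ "\<lambda>z. of_real (cmod c powr s)"]) auto
  next
    case (Suc n)
    then have "\<not> constant (poly P)" by (simp add: constant_degree)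
    then obtain a where "poly P a = 0" using fundamental_theorem_of_algebra by blast
    then obtain Q where Q: "P = [:-a, 1:] * Q" by (metis dvdE poly_eq_0_iff_dvd)
    then have "Q \<noteq> 0" using Suc(2) by auto
    then have "degree P = Suc (degree Q)" unfolding Q by (subst degree_mult_eq) auto
    then have "n = degree Q" using Suc(2) by simp
    from Suc(1)[OF this] obtain H where H: "continuous_on (cball 0 1) H" "H holomorphic_on ball 0 1"
      "\<And>z. cmod z \<le> 1 \<Longrightarrow> cmod (poly Q z) powr s \<le> cmod (H z)"
      "\<And>z. cmod z = 1 \<Longrightarrow> cmod (H z) = cmod (poly Q z) powr s"
      by (auto simp: Ball_def)
    \<comment> \<open>A zero in the closed disc is reflected, with b = cnj a and c = 1. A zero
      outside keeps its factor: z - a = -a(1 - z/a), so b = 1/a and c = |a|.\<close>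
    have "\<exists>b c. cmod b \<le> 1 \<and> 0 \<le> c \<and> (\<forall>z. cmod z \<le> 1 \<longrightarrow> cmod (z - a) \<le> c * cmod (1 - b * z)) \<and>
        (\<forall>z. cmod z = 1 \<longrightarrow> cmod (z - a) = c * cmod (1 - b * z))"
    proof (cases "cmod a \<le> 1")
      case True
      have id: "(cmod (1 - cnj a * z))\<^sup>2 - (cmod (z - a))\<^sup>2 = (1 - (cmod a)\<^sup>2) * (1 - (cmod z)\<^sup>2)" for z
        unfolding cmod_power2 by (simp add: power2_eq_square algebra_simps)
      have "cmod (z - a) \<le> cmod (1 - cnj a * z)" if "cmod z \<le> 1" for z
      proof (rule power2_le_imp_le)
        have "0 \<le> (1 - (cmod a)\<^sup>2) * (1 - (cmod z)\<^sup>2)"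
          using True that by (intro mult_nonneg_nonneg) (auto simp: power_le_one)
        then show "(cmod (z - a))\<^sup>2 \<le> (cmod (1 - cnj a * z))\<^sup>2" using id[of z] by linarith
      qed simp
      moreover have "cmod (z - a) = cmod (1 - cnj a * z)" if "cmod z = 1" for z
        using id[of z] that by simp
      ultimately show ?thesis using True by (intro exI[of _ "cnj a"] exI[of _ 1]) auto
    next
      case False
      then have "a \<noteq> 0" by auto
      then have "z - a = - a * (1 - (1/a) * z)" for z by (simp add: field_simps)
      then have "cmod (z - a) = cmod a * cmod (1 - (1/a) * z)" for z by (metis norm_minus_cancel norm_mult)
      then show ?thesis using False by (intro exI[of _ "1/a"] exI[of _ "cmod a"]) (auto simp: norm_divide divide_simps)
    qed
    then obtain b c where b: "cmod b \<le> 1" and c: "0 \<le> c"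
      and le: "\<And>z. cmod z \<le> 1 \<Longrightarrow> cmod (z - a) \<le> c * cmod (1 - b * z)"
      and eq: "\<And>z. cmod z = 1 \<Longrightarrow> cmod (z - a) = c * cmod (1 - b * z)" by blast
    have P: "cmod (poly P z) powr s = cmod (z - a) powr s * cmod (poly Q z) powr s" for z
    proof -
      have "poly P z = (z - a) * poly Q z" by (simp add: Q algebra_simps)
      then show ?thesis by (simp add: norm_mult powr_mult)
    qed
    show ?case
    proof (intro exI[of _ "\<lambda>z. of_real (c powr s) * G b z * H z"] conjI ballI)
      show "continuous_on (cball 0 1) (\<lambda>z. of_real (c powr s) * G b z * H z)"
        by (intro continuous_intros Gc b H)
      show "(\<lambda>z. of_real (c powr s) * G b z * H z) holomorphic_on ball 0 1"
        by (intro holomorphic_intros Gh b H)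
      fix z :: complex assume "z \<in> cball 0 1"
      then have z: "cmod z \<le> 1" by simp
      have "cmod (z - a) powr s \<le> (c * cmod (1 - b * z)) powr s"
        using le[OF z] s by (intro powr_mono2) auto
      then show "cmod (poly P z) powr s \<le> cmod (of_real (c powr s) * G b z * H z)"
        unfolding P norm_mult using H(3)[OF z] c by (intro mult_mono) (auto simp: Gn powr_mult)
    next
      fix z :: complex assume "z \<in> sphere 0 1"
      then have z: "cmod z = 1" by simp
      show "cmod (of_real (c powr s) * G b z * H z) = cmod (poly P z) powr s"
        unfolding P norm_mult H(4)[OF z] eq[OF z] Gn using c by (simp add: powr_mult)
    qed
  qed
qed

text \<open>Subharmonicity of |P|^s in Poisson form: the majorant \<open>H\<close> is reproduced by
  its boundary values, whose modulus is exactly |P|^s.\<close>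

lemma polynomial_powr_sub_poisson:
  fixes P :: "complex poly"
  assumes s: "0 < s" and z: "cmod z < 1"
  shows "cmod (poly P z) powr s \<le> (LINT \<theta>|arc. poisson z (cis \<theta>) * cmod (poly P (cis \<theta>)) powr s)"
proof -
  obtain H where H: "continuous_on (cball 0 1) H" "H holomorphic_on ball 0 1"
      "\<And>z. cmod z \<le> 1 \<Longrightarrow> cmod (poly P z) powr s \<le> cmod (H z)"
      "\<And>z. cmod z = 1 \<Longrightarrow> cmod (H z) = cmod (poly P z) powr s"
    using polynomial_holomorphic_majorant[OF s, of P] by (auto simp: Ball_def)
  have "cmod (poly P z) powr s \<le> cmod (H z)" using H(3) z by simp
  also have "H z = (LINT \<theta>|arc. of_real (poisson z (cis \<theta>)) * H (cis \<theta>))"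
    using poisson_formula_arc[OF H(1,2) z] by simp
  also have "cmod \<dots> \<le> (LINT \<theta>|arc. cmod (of_real (poisson z (cis \<theta>)) * H (cis \<theta>)))"
    by (rule integral_norm_bound)
  also have "\<dots> = (LINT \<theta>|arc. poisson z (cis \<theta>) * cmod (poly P (cis \<theta>)) powr s)"
    using poisson_nonneg[OF z] by (intro Bochner_Integration.integral_cong) (auto simp: norm_mult H(4))
  finally show ?thesis .
qed

lemma continuous_on_circle:
  assumes f: "f holomorphic_on ball 0 R" and R: "1 < R"
  shows "continuous_on UNIV (\<lambda>\<theta>. f (cis \<theta>))"
proof (rule continuous_on_compose2[OF holomorphic_on_imp_continuous_on[OF f]])
  show "continuous_on UNIV cis" by (intro continuous_intros)
qed (use R in auto)

text \<open>The Taylor polynomials converge on the closed disc with a common bound, because the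
  series converges absolutely beyond radius 1. Both sides of the polynomial inequality therefore
  pass to the limit.\<close>

lemma holomorphic_powr_sub_poisson:
  assumes f: "f holomorphic_on ball 0 R" and R: "1 < R" and s: "0 < s" and z: "cmod z < 1"
  shows "cmod (f z) powr s \<le> (LINT \<theta>|arc. poisson z (cis \<theta>) * cmod (f (cis \<theta>)) powr s)"
proof -
  define a where "a = (\<lambda>n. (deriv ^^ n) f 0 / fact n)"
  define P where "P = (\<lambda>n. \<Sum>k<n. monom (a k) k)"
  have sums: "(\<lambda>n. a n * w ^ n) sums f w" if "cmod w < R" for w
    using holomorphic_power_series[OF f, of w] that by (simp add: a_def)
  obtain R' where R': "1 < R'" "R' < R" using dense R by blast
  have "summable (\<lambda>n. a n * of_real R' ^ n)"
    using sums[of "of_real R'"] R' by (auto simp: sums_iff)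
  then have sa: "summable (\<lambda>n. cmod (a n))"
    using powser_insidea[of a "of_real R'" 1] R' by simp
  define B where "B = (\<Sum>n. cmod (a n))"
  have poly_P: "poly (P n) w = (\<Sum>k<n. a k * w ^ k)" for n w
    by (simp add: P_def poly_sum poly_monom)
  have lim: "(\<lambda>n. poly (P n) w) \<longlonglongrightarrow> f w" if "cmod w \<le> 1" for w
    using sums[of w] that R by (simp add: poly_P sums_def)
  have bd: "cmod (poly (P n) w) \<le> B" if "cmod w \<le> 1" for n w
  proof -
    have "cmod (poly (P n) w) \<le> (\<Sum>k<n. cmod (a k * w ^ k))" unfolding poly_P by (rule norm_sum)
    also have "\<dots> \<le> (\<Sum>k<n. cmod (a k))"
      using that by (intro sum_mono) (auto simp: norm_mult norm_power power_le_one mult_left_le)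
    also have "\<dots> \<le> B" unfolding B_def by (intro sum_le_suminf sa) auto
    finally show ?thesis .
  qed
  note fm = continuous_on_circle[OF f R]
  have [measurable]: "(\<lambda>\<theta>. f (cis \<theta>)) \<in> borel_measurable borel"
    using fm by (rule borel_measurable_continuous_onI)
  have [measurable]: "(\<lambda>\<theta>. poly (P n) (cis \<theta>)) \<in> borel_measurable borel" for n
    by (rule borel_measurable_continuous_onI) (intro continuous_intros)
  have "(\<lambda>n. LINT \<theta>|arc. poisson z (cis \<theta>) * cmod (poly (P n) (cis \<theta>)) powr s)
      \<longlonglongrightarrow> (LINT \<theta>|arc. poisson z (cis \<theta>) * cmod (f (cis \<theta>)) powr s)"
  proof (rule integral_dominated_convergence[where w = "\<lambda>_. 2 / (1 - cmod z) * B powr s"])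
    show "AE \<theta> in arc. (\<lambda>n. poisson z (cis \<theta>) * cmod (poly (P n) (cis \<theta>)) powr s)
        \<longlonglongrightarrow> poisson z (cis \<theta>) * cmod (f (cis \<theta>)) powr s"
      using s by (intro AE_I2 tendsto_intros lim) auto
    show "AE \<theta> in arc. norm (poisson z (cis \<theta>) * cmod (poly (P n) (cis \<theta>)) powr s) \<le> 2 / (1 - cmod z) * B powr s" for n
    proof (intro AE_I2)
      fix \<theta>
      have "poisson z (cis \<theta>) * cmod (poly (P n) (cis \<theta>)) powr s \<le> 2 / (1 - cmod z) * B powr s"
        using s z by (intro mult_mono poisson_le powr_mono2 bd) auto
      then show "norm (poisson z (cis \<theta>) * cmod (poly (P n) (cis \<theta>)) powr s) \<le> 2 / (1 - cmod z) * B powr s"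
        by (simp add: norm_mult poisson_nonneg z)
    qed
  qed (simp_all)
  moreover have "(\<lambda>n. cmod (poly (P n) z) powr s) \<longlonglongrightarrow> cmod (f z) powr s"
    using s z by (intro tendsto_intros lim) auto
  ultimately show ?thesis
    using polynomial_powr_sub_poisson[OF s z] by (intro LIMSEQ_le) auto
qed

subsection \<open>The maximal theorem\<close>

interpretation arc_pair: pair_sigma_finite arc arc
  by standard

text \<open>The \<open>T T\<^sup>*\<close> method: by the semigroup property the kernel of \<open>T T\<^sup>*\<close> is again a Poisson
  kernel, and it is dominated by the sum of the kernels of \<open>T\<close> and \<open>T\<^sup>*\<close>.\<close>

lemma poisson_maximal_L2:
  fixes t :: "real \<Rightarrow> real" and u :: "real \<Rightarrow> ennreal"
  assumes [measurable]: "t \<in> borel_measurable borel" "u \<in> borel_measurable borel"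
    and t: "\<And>\<theta>. 0 \<le> t \<theta>" "\<And>\<theta>. t \<theta> \<le> \<tau>" "\<tau> < 1" and u: "\<And>\<theta>. u \<theta> \<le> ennreal M"
  shows "(\<integral>\<^sup>+\<theta>. (\<integral>\<^sup>+\<phi>. ennreal (poisson (of_real (t \<theta>) * cis \<theta>) (cis \<phi>)) * u \<phi> \<partial>arc)\<^sup>2 \<partial>arc)
           \<le> 256 * (\<integral>\<^sup>+\<theta>. (u \<theta>)\<^sup>2 \<partial>arc)"
proof -
  define Z where "Z \<theta> = of_real (t \<theta>) * cis \<theta>" for \<theta>
  have nZ: "cmod (Z \<theta>) = t \<theta>" for \<theta> using t by (simp add: Z_def norm_mult)
  have Z1: "cmod (Z \<theta>) < 1" for \<theta> using nZ t(2)[of \<theta>] t(3) by simp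
  define k where "k \<theta> \<phi> = ennreal (poisson (Z \<theta>) (cis \<phi>))" for \<theta> \<phi>
  have Zm [measurable]: "Z \<in> borel_measurable borel" unfolding Z_def by measurable
  have km [measurable]: "(\<lambda>x. k (a x) (b x)) \<in> borel_measurable N"
    if [measurable]: "a \<in> borel_measurable N" "b \<in> borel_measurable N" for a b N
    unfolding k_def by measurable
  \<comment> \<open>\<open>t\<close> is an arbitrary measurable choice of radius, which makes the
    maximal operator linear; \<open>S\<close> is the transpose of \<open>T\<close>.\<close>
  define T where "T b \<theta> = (\<integral>\<^sup>+\<phi>. k \<theta> \<phi> * b \<phi> \<partial>arc)" for b \<theta>
  define S where "S a \<phi> = (\<integral>\<^sup>+\<theta>. k \<theta> \<phi> * a \<theta> \<partial>arc)" for a \<phi>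
  have Tm [measurable]: "T b \<in> borel_measurable borel" if [measurable]: "b \<in> borel_measurable borel" for b
    unfolding T_def by measurable
  have Sm [measurable]: "S b \<in> borel_measurable borel" if [measurable]: "b \<in> borel_measurable borel" for b
    unfolding S_def by measurable
  have dual: "(\<integral>\<^sup>+\<theta>. a \<theta> * T b \<theta> \<partial>arc) = (\<integral>\<^sup>+\<phi>. b \<phi> * S a \<phi> \<partial>arc)"
    if [measurable]: "a \<in> borel_measurable borel" "b \<in> borel_measurable borel" for a b
  proof -
    have "(\<integral>\<^sup>+\<theta>. a \<theta> * T b \<theta> \<partial>arc) = (\<integral>\<^sup>+\<theta>. \<integral>\<^sup>+\<phi>. k \<theta> \<phi> * a \<theta> * b \<phi> \<partial>arc \<partial>arc)"
      unfolding T_def by (subst nn_integral_cmult[symmetric]) (auto simp: mult_ac)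
    also have "\<dots> = (\<integral>\<^sup>+\<phi>. \<integral>\<^sup>+\<theta>. k \<theta> \<phi> * a \<theta> * b \<phi> \<partial>arc \<partial>arc)"
      by (rule arc_pair.Fubini') measurable
    also have "\<dots> = (\<integral>\<^sup>+\<phi>. b \<phi> * S a \<phi> \<partial>arc)"
      unfolding S_def by (subst nn_integral_cmult[symmetric]) (auto simp: mult_ac)
    finally show ?thesis .
  qed
  have K: "(\<integral>\<^sup>+\<phi>. k \<theta> \<phi> * k \<theta>' \<phi> \<partial>arc) \<le> 8 * (k \<theta> \<theta>' + k \<theta>' \<theta>)" for \<theta> \<theta>'
  proof -
    have c: "continuous_on UNIV (\<lambda>\<phi>. poisson (Z \<theta>) (cis \<phi>) * poisson (Z \<theta>') (cis \<phi>))"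
      by (intro continuous_intros continuous_poisson Z1)
    have nn: "0 \<le> poisson (Z \<theta>) w" for \<theta> w by (rule poisson_nonneg[OF Z1])
    have "(\<integral>\<^sup>+\<phi>. k \<theta> \<phi> * k \<theta>' \<phi> \<partial>arc) = (\<integral>\<^sup>+\<phi>. ennreal (poisson (Z \<theta>) (cis \<phi>) * poisson (Z \<theta>') (cis \<phi>)) \<partial>arc)"
      by (simp add: k_def ennreal_mult nn)
    also have "\<dots> = ennreal (LINT \<phi>|arc. poisson (Z \<theta>) (cis \<phi>) * poisson (Z \<theta>') (cis \<phi>))"
      by (rule nn_integral_eq_integral[OF integral_arc(1)[OF c]]) (simp add: nn)
    also have "(LINT \<phi>|arc. poisson (Z \<theta>) (cis \<phi>) * poisson (Z \<theta>') (cis \<phi>))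
        \<le> 8 * (poisson (Z \<theta>) (cis \<theta>') + poisson (Z \<theta>') (cis \<theta>))"
    proof (cases "t \<theta> \<le> t \<theta>'")
      case True
      then have "(LINT \<phi>|arc. poisson (Z \<theta>) (cis \<phi>) * poisson (Z \<theta>') (cis \<phi>)) \<le> 8 * poisson (Z \<theta>) (cis \<theta>')"
        by (intro poisson_semigroup_le) (auto simp: nZ Z1[unfolded nZ], simp add: Z_def)
      then show ?thesis using nn[of \<theta>' "cis \<theta>"] by simp
    next
      case False
      then have "(LINT \<phi>|arc. poisson (Z \<theta>') (cis \<phi>) * poisson (Z \<theta>) (cis \<phi>)) \<le> 8 * poisson (Z \<theta>') (cis \<theta>)"
        by (intro poisson_semigroup_le) (auto simp: nZ Z1[unfolded nZ], simp add: Z_def)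
      then show ?thesis using nn[of \<theta> "cis \<theta>'"] by (simp add: mult.commute)
    qed
    also have "ennreal (8 * (poisson (Z \<theta>) (cis \<theta>') + poisson (Z \<theta>') (cis \<theta>))) = 8 * (k \<theta> \<theta>' + k \<theta>' \<theta>)"
      by (simp add: k_def ennreal_mult nn)
    finally show ?thesis by (simp add: ennreal_leI)
  qed
  define g where "g = T u"
  define G where "G = S g"
  have [measurable]: "g \<in> borel_measurable borel" "G \<in> borel_measurable borel"
    unfolding g_def G_def by measurable
  define A B X U where "A = (\<integral>\<^sup>+\<theta>. (g \<theta>)\<^sup>2 \<partial>arc)" and "B = (\<integral>\<^sup>+\<theta>. (G \<theta>)\<^sup>2 \<partial>arc)"
    and "X = (\<integral>\<^sup>+\<theta>. g \<theta> * G \<theta> \<partial>arc)" and "U = (\<integral>\<^sup>+\<theta>. (u \<theta>)\<^sup>2 \<partial>arc)"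
  have TG: "T G \<theta> \<le> 8 * (T g \<theta> + G \<theta>)" for \<theta>
  proof -
    have "T G \<theta> = (\<integral>\<^sup>+\<phi>. \<integral>\<^sup>+\<theta>'. k \<theta> \<phi> * k \<theta>' \<phi> * g \<theta>' \<partial>arc \<partial>arc)"
      unfolding T_def G_def S_def by (subst nn_integral_cmult[symmetric]) (auto simp: mult_ac)
    also have "\<dots> = (\<integral>\<^sup>+\<theta>'. \<integral>\<^sup>+\<phi>. k \<theta> \<phi> * k \<theta>' \<phi> * g \<theta>' \<partial>arc \<partial>arc)"
      by (rule arc_pair.Fubini') measurable
    also have "\<dots> = (\<integral>\<^sup>+\<theta>'. (\<integral>\<^sup>+\<phi>. k \<theta> \<phi> * k \<theta>' \<phi> \<partial>arc) * g \<theta>' \<partial>arc)"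
      by (subst nn_integral_multc) auto
    also have "\<dots> \<le> (\<integral>\<^sup>+\<theta>'. 8 * (k \<theta> \<theta>' + k \<theta>' \<theta>) * g \<theta>' \<partial>arc)"
      by (intro nn_integral_mono mult_right_mono K) auto
    also have "\<dots> = (\<integral>\<^sup>+\<theta>'. 8 * (k \<theta> \<theta>' * g \<theta>' + k \<theta>' \<theta> * g \<theta>') \<partial>arc)"
      by (simp add: distrib_right distrib_left mult.assoc)
    also have "\<dots> = 8 * (T g \<theta> + G \<theta>)"
      by (simp add: T_def G_def S_def nn_integral_cmult nn_integral_add)
    finally show ?thesis .
  qed
  \<comment> \<open>Writing <a, b> for the integral of the product, B = <Sg, Sg> = <g, TSg> is at
    most 8(<g, Tg> + <g, Sg>), and both pairings equal X.\<close>
  have "B = (\<integral>\<^sup>+\<theta>. g \<theta> * T G \<theta> \<partial>arc)"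
    unfolding B_def by (subst dual) (auto simp: G_def power2_eq_square)
  also have "\<dots> \<le> (\<integral>\<^sup>+\<theta>. 8 * (g \<theta> * T g \<theta> + g \<theta> * G \<theta>) \<partial>arc)"
  proof (rule nn_integral_mono)
    fix \<theta>
    have "g \<theta> * T G \<theta> \<le> g \<theta> * (8 * (T g \<theta> + G \<theta>))" by (rule mult_left_mono[OF TG]) simp
    then show "g \<theta> * T G \<theta> \<le> 8 * (g \<theta> * T g \<theta> + g \<theta> * G \<theta>)" by (simp add: distrib_left mult_ac)
  qed
  also have "\<dots> = 8 * ((\<integral>\<^sup>+\<theta>. g \<theta> * T g \<theta> \<partial>arc) + X)"
    by (simp add: X_def nn_integral_cmult nn_integral_add)
  also have "(\<integral>\<^sup>+\<theta>. g \<theta> * T g \<theta> \<partial>arc) = X"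
    by (subst dual) (auto simp: X_def G_def)
  finally have BX: "B \<le> 16 * X" by (simp flip: mult_2)
  have XAB: "X\<^sup>2 \<le> A * B"
    unfolding X_def A_def B_def by (rule Cauchy_Schwarz_nn_integral) auto
  have "A = (\<integral>\<^sup>+\<theta>. u \<theta> * G \<theta> \<partial>arc)"
    unfolding A_def G_def using dual[of g u] by (simp add: g_def power2_eq_square)
  then have AUB: "A\<^sup>2 \<le> U * B"
    unfolding U_def B_def using Cauchy_Schwarz_nn_integral[of u arc G] by simp
  \<comment> \<open>The bounds \<tau> < 1 and \<open>M\<close> make A, B and U finite, so that the
    final inequalities may be divided by \<open>b\<close> and by \<open>a\<close>.\<close>
  define \<kappa> where "\<kappa> = 2 / (1 - \<tau>)"
  have kk: "k \<theta> \<phi> \<le> ennreal \<kappa>" for \<theta> \<phi>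
    unfolding k_def \<kappa>_def using t(2)[of \<theta>] t(3) Z1[of \<theta>]
    by (intro ennreal_leI order_trans[OF poisson_le] frac_le) (auto simp: nZ)
  have gb: "g \<theta> \<le> ennreal \<kappa> * ennreal M" for \<theta>
  proof -
    have "g \<theta> \<le> (\<integral>\<^sup>+\<phi>. ennreal \<kappa> * ennreal M \<partial>arc)"
      unfolding g_def T_def by (intro nn_integral_mono mult_mono kk u) auto
    then show ?thesis by simp
  qed
  have Gb: "G \<theta> \<le> ennreal \<kappa> * (ennreal \<kappa> * ennreal M)" for \<theta>
  proof -
    have "G \<theta> \<le> (\<integral>\<^sup>+\<phi>. ennreal \<kappa> * (ennreal \<kappa> * ennreal M) \<partial>arc)"
      unfolding G_def S_def by (intro nn_integral_mono mult_mono kk gb) auto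
    then show ?thesis by simp
  qed
  have fin: "(\<integral>\<^sup>+\<theta>. (h \<theta>)\<^sup>2 \<partial>arc) < top" if "\<And>\<theta>. h \<theta> \<le> c" "c < top" for h :: "real \<Rightarrow> ennreal" and c
  proof -
    have "(\<integral>\<^sup>+\<theta>. (h \<theta>)\<^sup>2 \<partial>arc) \<le> (\<integral>\<^sup>+\<theta>. c\<^sup>2 \<partial>arc)"
      by (intro nn_integral_mono power_mono that) auto
    also have "\<dots> < top" using that by (simp add: power2_eq_square ennreal_mult_less_top)
    finally show ?thesis .
  qed
  have "A < top" "B < top" "U < top"
    unfolding A_def B_def U_def using gb Gb u by (auto intro!: fin simp: ennreal_mult_less_top)
  then obtain a b v where r: "A = ennreal a" "0 \<le> a" "B = ennreal b" "0 \<le> b" "U = ennreal v" "0 \<le> v"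
    by (metis ennreal_cases less_irrefl)
  have "X < top"
    using XAB r by (auto simp: power2_eq_square ennreal_mult_less_top less_top[symmetric] top_unique
      simp flip: ennreal_mult)
  then obtain x where x: "X = ennreal x" "0 \<le> x" by (metis ennreal_cases less_irrefl)
  have "b \<le> 16 * x" "x\<^sup>2 \<le> a * b" "a\<^sup>2 \<le> v * b"
    using BX XAB AUB r x by (simp_all add: ennreal_power flip: ennreal_mult ennreal_numeral)
  \<comment> \<open>B \<le> 16 X and X^2 \<le> A B give B \<le> 256 A; with A^2 \<le> U B this
    yields A \<le> 256 U.\<close>
  then have "b * b \<le> 256 * (a * b)"
  proof -
    have "b\<^sup>2 \<le> (16 * x)\<^sup>2" using \<open>b \<le> 16 * x\<close> r by (intro power_mono)
    then show ?thesis using \<open>x\<^sup>2 \<le> a * b\<close> by (simp add: power2_eq_square)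
  qed
  then have "b \<le> 256 * a" using r by (cases "b = 0") auto
  then have "v * b \<le> v * (256 * a)" using r by (intro mult_left_mono)
  then have "a * a \<le> (256 * v) * a" using \<open>a\<^sup>2 \<le> v * b\<close> by (simp add: power2_eq_square mult_ac)
  then have "a \<le> 256 * v" using r by (cases "a = 0") auto
  then have "A \<le> 256 * U"
    using ennreal_leI[OF \<open>a \<le> 256 * v\<close>] r by (simp add: ennreal_mult)
  then show ?thesis by (simp add: A_def U_def g_def T_def k_def Z_def)
qed

lemma powr_nn_sub_poisson:
  assumes f: "f holomorphic_on ball 0 R" and R: "1 < R" and s: "0 < s" and z: "cmod z < 1"
  shows "ennreal (cmod (f z) powr s)
    \<le> (\<integral>\<^sup>+\<theta>. ennreal (poisson z (cis \<theta>)) * ennreal (cmod (f (cis \<theta>)) powr s) \<partial>arc)"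
proof -
  note fc = continuous_on_circle[OF f R]
  have c: "continuous_on UNIV (\<lambda>\<theta>. poisson z (cis \<theta>) * cmod (f (cis \<theta>)) powr s)"
    by (intro continuous_intros continuous_poisson z fc continuous_on_powr') (use s in auto)
  have "ennreal (cmod (f z) powr s) \<le> ennreal (LINT \<theta>|arc. poisson z (cis \<theta>) * cmod (f (cis \<theta>)) powr s)"
    by (intro ennreal_leI holomorphic_powr_sub_poisson[OF assms])
  also have "\<dots> = (\<integral>\<^sup>+\<theta>. ennreal (poisson z (cis \<theta>) * cmod (f (cis \<theta>)) powr s) \<partial>arc)"
    using poisson_nonneg[OF z] by (intro nn_integral_eq_integral[symmetric] integral_arc(1)[OF c]) auto
  finally show ?thesis by (simp add: ennreal_mult poisson_nonneg[OF z])
qed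

lemma holomorphic_poisson_maximal:
  assumes f: "f holomorphic_on ball 0 R" and R: "1 < R" and p: "0 < p"
    and t: "t \<in> borel_measurable borel" "\<And>\<theta>. 0 \<le> t \<theta>" "\<And>\<theta>. t \<theta> \<le> \<tau>" "\<tau> < 1"
  shows "(\<integral>\<^sup>+\<theta>. (\<integral>\<^sup>+\<phi>. ennreal (poisson (of_real (t \<theta>) * cis \<theta>) (cis \<phi>)) *
              ennreal (cmod (f (cis \<phi>)) powr (p/2)) \<partial>arc)\<^sup>2 \<partial>arc)
           \<le> 256 * (\<integral>\<^sup>+\<theta>. ennreal (cmod (f (cis \<theta>)) powr p) \<partial>arc)"
proof -
  note fc = continuous_on_circle[OF f R]
  have [measurable]: "(\<lambda>\<theta>. f (cis \<theta>)) \<in> borel_measurable borel"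
    using fc by (rule borel_measurable_continuous_onI)
  have "compact (f ` sphere 0 1)"
    by (intro compact_continuous_image continuous_on_subset[OF holomorphic_on_imp_continuous_on[OF f]])
       (use R in auto)
  then obtain M where "\<forall>w\<in>f ` sphere 0 1. cmod w \<le> M"
    using compact_imp_bounded bounded_iff by blast
  then have M: "cmod (f w) \<le> M" if "cmod w = 1" for w using that by auto
  have "(ennreal (x powr (p/2)))\<^sup>2 = ennreal (x powr p)" for x
    by (simp add: power2_eq_square flip: ennreal_mult powr_add)
  moreover have "ennreal (cmod (f (cis \<phi>)) powr (p/2)) \<le> ennreal (M powr (p/2))" for \<phi>
    using M[of "cis \<phi>"] p by (intro ennreal_leI powr_mono2) auto
  ultimately show ?thesis
    using poisson_maximal_L2[OF t(1) _ t(2-4), of "\<lambda>\<phi>. ennreal (cmod (f (cis \<phi>)) powr (p/2))" "M powr (p/2)"]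
    by simp
qed

definition radial_max :: "(complex \<Rightarrow> complex) \<Rightarrow> real \<Rightarrow> ennreal" where
  "radial_max f \<theta> = (SUP t\<in>{0..<1::real}. ennreal (cmod (f (of_real t * cis \<theta>))))"

lemma radial_max_upper: "0 \<le> t \<Longrightarrow> t < 1 \<Longrightarrow> ennreal (cmod (f (of_real t * cis \<theta>))) \<le> radial_max f \<theta>"
  unfolding radial_max_def by (intro SUP_upper) auto

text \<open>Continuity along the radius reduces the supremum to countably many radii, which makes
  the maximal function measurable. The approximating rationals lie above \<open>t\<close>, hence are
  nonnegative, and within (1-t)/(n+1) of it, hence below 1.\<close>

lemma radial_max_rational:
  assumes "continuous_on (ball 0 1) f"
  shows "radial_max f \<theta> = (SUP t\<in>\<rat> \<inter> {0..<1::real}. ennreal (cmod (f (of_real t * cis \<theta>))))"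
proof (rule antisym)
  define S where "S = (SUP t\<in>\<rat> \<inter> {0..<1::real}. ennreal (cmod (f (of_real t * cis \<theta>))))"
  show "radial_max f \<theta> \<le> S"
    unfolding radial_max_def
  proof (rule SUP_least)
    fix t :: real assume "t \<in> {0..<1}"
    define e where "e n = (1 - t) / (real n + 1)" for n
    have "\<forall>n. \<exists>q\<in>\<rat>. t < q \<and> q < t + e n"
      using \<open>t \<in> _\<close> by (intro allI Rats_dense_in_real) (auto simp: e_def)
    then obtain q where q: "\<And>n. q n \<in> \<rat>" "\<And>n. t < q n" "\<And>n. q n < t + e n" by metis
    have e: "e \<longlonglongrightarrow> 0" unfolding e_def by real_asymp
    have "(\<lambda>n. t + e n) \<longlonglongrightarrow> t + 0" by (intro tendsto_intros e)
    then have ql: "q \<longlonglongrightarrow> t"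
      by (intro tendsto_sandwich[of "\<lambda>_. t" q _ "\<lambda>n. t + e n"]) (auto simp: less_imp_le q)
    have q1: "q n < 1" for n
    proof -
      have "e n \<le> 1 - t" using \<open>t \<in> _\<close> unfolding e_def using mult_right_mono[of t 1 "real n"]
        by (simp add: field_simps)
      then show ?thesis using q(3)[of n] by simp
    qed
    have "isCont f (of_real t * cis \<theta>)"
      using \<open>t \<in> _\<close> by (intro continuous_on_interior[OF assms]) (auto simp: norm_mult)
    then have "(\<lambda>n. ennreal (cmod (f (of_real (q n) * cis \<theta>)))) \<longlonglongrightarrow> ennreal (cmod (f (of_real t * cis \<theta>)))"
      by (intro tendsto_intros isCont_tendsto_compose[of _ f] ql)
    moreover have S: "ennreal (cmod (f (of_real (q n) * cis \<theta>))) \<le> S" for n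
      unfolding S_def using q(1,2)[of n] q1[of n] \<open>t \<in> _\<close> by (intro SUP_upper) auto
    ultimately show "ennreal (cmod (f (of_real t * cis \<theta>))) \<le> S"
      using S by (intro LIMSEQ_le_const2[of _ "ennreal (cmod (f (of_real t * cis \<theta>)))" S]) blast+
  qed
  show "S \<le> radial_max f \<theta>"
    unfolding S_def radial_max_def by (rule SUP_subset_mono) auto
qed

lemma countable_rats_unit: "countable (\<rat> \<inter> {0..<1::real})"
  by (intro countable_subset[OF _ countable_rat]) auto

lemma continuous_circle_slice:
  assumes "continuous_on (ball 0 1) f" "0 \<le> t" "t < 1"
  shows "continuous_on UNIV (\<lambda>\<theta>. f (complex_of_real t * cis \<theta>))"
proof (rule continuous_on_compose2[OF assms(1)])
  show "continuous_on UNIV (\<lambda>\<theta>. complex_of_real t * cis \<theta>)" by (intro continuous_intros)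
qed (use assms in \<open>auto simp: norm_mult\<close>)

lemma borel_measurable_circle_slice:
  assumes "continuous_on (ball 0 1) f" "0 \<le> t" "t < 1"
  shows "(\<lambda>\<theta>. f (complex_of_real t * cis \<theta>)) \<in> borel_measurable borel"
  using continuous_circle_slice[OF assms] by (rule borel_measurable_continuous_onI)

lemma borel_measurable_radial_max:
  assumes "continuous_on (ball 0 1) f"
  shows "radial_max f \<in> borel_measurable borel"
proof -
  have "(\<lambda>\<theta>. SUP t\<in>\<rat> \<inter> {0..<1::real}. ennreal (cmod (f (of_real t * cis \<theta>)))) \<in> borel_measurable borel"
    using borel_measurable_circle_slice[OF assms]
    by (intro borel_measurable_SUP countable_rats_unit measurable_compose[OF _ measurable_ennreal]
        measurable_compose[OF _ borel_measurable_norm]) auto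
  then show ?thesis using radial_max_rational[OF assms] by (simp add: fun_eq_iff[symmetric] cong: measurable_cong)
qed

text \<open>The supremum over finitely many rational radii is attained at a measurable radius, so the
  linearised bound applies to it.\<close>

lemma radial_max_bound_closed:
  assumes f: "f holomorphic_on ball 0 R" and R: "1 < R" and p: "0 < p"
  shows "(\<integral>\<^sup>+\<theta>. ennpowr (radial_max f \<theta>) p \<partial>arc)
           \<le> 256 * (\<integral>\<^sup>+\<theta>. ennreal (cmod (f (cis \<theta>)) powr p) \<partial>arc)"
proof -
  define e where "e = from_nat_into (\<rat> \<inter> {0..<1::real})"
  have "0 \<in> \<rat> \<inter> {0..<1::real}" by auto
  then have ne: "\<rat> \<inter> {0..<1::real} \<noteq> {}" by blast
  then have er: "range e = \<rat> \<inter> {0..<1::real}"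
    unfolding e_def by (intro range_from_nat_into countable_rats_unit)
  have e: "0 \<le> e n" "e n < 1" for n using er by auto
  have fc: "continuous_on (ball 0 1) f"
    by (rule continuous_on_subset[OF holomorphic_on_imp_continuous_on[OF f]]) (use R in auto)
  define v where "v t \<theta> = cmod (f (of_real t * cis \<theta>))" for t \<theta>
  have vm: "(\<lambda>\<theta>. v (t \<theta>) \<theta>) \<in> borel_measurable borel"
    if "t \<in> borel_measurable borel" "\<And>\<theta>. 0 \<le> t \<theta>" "\<And>\<theta>. t \<theta> < 1" for t
  proof -
    note that(1)[measurable]
    have m: "(\<lambda>\<theta>. of_real (t \<theta>) * cis \<theta>) \<in> borel \<rightarrow>\<^sub>M restrict_space borel (ball 0 1)"
      using that(2,3) by (intro measurable_restrict_space2) (auto simp: norm_mult)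
    show ?thesis unfolding v_def
      by (intro measurable_compose[OF m] measurable_compose[OF _ borel_measurable_norm]
          borel_measurable_continuous_on_restrict fc)
  qed
  \<comment> \<open>\<open>best n \<theta>\<close> is a radius among the first n + 1 rationals at
    which |f| is largest along the ray of angle \<theta>; the recursion keeps it measurable in
    \<theta>.\<close>
  define best where "best = rec_nat (\<lambda>_. e 0)
    (\<lambda>n b \<theta>. if v (b \<theta>) \<theta> < v (e (Suc n)) \<theta> then e (Suc n) else b \<theta>)"
  have best0: "best 0 = (\<lambda>_. e 0)" by (simp add: best_def)
  have bestS: "best (Suc n) = (\<lambda>\<theta>. if v (best n \<theta>) \<theta> < v (e (Suc n)) \<theta> then e (Suc n) else best n \<theta>)" for n
    unfolding best_def by (rule old.nat.rec(2))
  have best_in: "best n \<theta> \<in> e ` {..n}" for n \<theta>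
    by (induction n) (auto simp: best0 bestS atMost_Suc)
  have best01: "0 \<le> best n \<theta>" "best n \<theta> < 1" for n \<theta>
    using best_in[of n \<theta>] e by auto
  have best_m: "best n \<in> borel_measurable borel" for n
  proof (induction n)
    case (Suc n)
    note Suc[measurable]
    have [measurable]: "(\<lambda>\<theta>. v (best n \<theta>) \<theta>) \<in> borel_measurable borel"
      by (intro vm Suc best01)
    have [measurable]: "(\<lambda>\<theta>. v (e (Suc n)) \<theta>) \<in> borel_measurable borel"
      by (intro vm e) auto
    show ?case unfolding bestS by measurable
  qed (simp add: best0)
  have ge: "v (e i) \<theta> \<le> v (best n \<theta>) \<theta>" if "i \<le> n" for i n \<theta>
    using that by (induction n) (auto simp: best0 bestS le_Suc_eq dest: order_trans[OF _ less_imp_le])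
  have "incseq (\<lambda>n. ennreal (v (best n \<theta>) \<theta>))" for \<theta>
    by (intro incseq_SucI ennreal_leI) (auto simp: bestS)
  then have inc: "incseq (\<lambda>n \<theta>. ennpowr (ennreal (v (best n \<theta>) \<theta>)) p)"
    using p by (auto simp: incseq_def le_fun_def intro!: ennpowr_mono)
  have rm: "radial_max f \<theta> = (SUP n. ennreal (v (best n \<theta>) \<theta>))" for \<theta>
  proof (rule antisym)
    have "radial_max f \<theta> = (SUP n. ennreal (v (e n) \<theta>))"
      unfolding radial_max_rational[OF fc] er[symmetric] v_def by (simp add: image_image)
    also have "\<dots> \<le> (SUP n. ennreal (v (best n \<theta>) \<theta>))"
      by (intro SUP_mono) (auto intro: ennreal_leI ge)
    finally show "radial_max f \<theta> \<le> \<dots>" .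
    show "(SUP n. ennreal (v (best n \<theta>) \<theta>)) \<le> radial_max f \<theta>"
      unfolding v_def by (intro SUP_least radial_max_upper best01)
  qed
  have "(\<integral>\<^sup>+\<theta>. ennpowr (radial_max f \<theta>) p \<partial>arc) = (\<integral>\<^sup>+\<theta>. (SUP n. ennpowr (ennreal (v (best n \<theta>) \<theta>)) p) \<partial>arc)"
    unfolding rm using p by (subst ennpowr_SUP) auto
  also have "\<dots> = (SUP n. \<integral>\<^sup>+\<theta>. ennpowr (ennreal (v (best n \<theta>) \<theta>)) p \<partial>arc)"
  proof (rule nn_integral_monotone_convergence_SUP[OF inc])
    show "(\<lambda>\<theta>. ennpowr (ennreal (v (best n \<theta>) \<theta>)) p) \<in> borel_measurable arc" for n
      using vm[OF best_m best01] by measurable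
  qed
  also have "\<dots> \<le> 256 * (\<integral>\<^sup>+\<theta>. ennreal (cmod (f (cis \<theta>)) powr p) \<partial>arc)"
  proof (rule SUP_least)
    fix n
    \<comment> \<open>Finitely many radii stay away from 1, as the linearised bound requires; its
      constant 256 does not depend on \<tau>.\<close>
    define \<tau> where "\<tau> = Max (e ` {..n})"
    have \<tau>: "best n \<theta> \<le> \<tau>" for \<theta> unfolding \<tau>_def using best_in by (intro Max_ge) auto
    have "\<tau> \<in> e ` {..n}" unfolding \<tau>_def by (intro Max_in) auto
    then have \<tau>1: "\<tau> < 1" using e by auto
    have "ennpowr (ennreal (v (best n \<theta>) \<theta>)) p \<le>
        (\<integral>\<^sup>+\<phi>. ennreal (poisson (of_real (best n \<theta>) * cis \<theta>) (cis \<phi>)) *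
              ennreal (cmod (f (cis \<phi>)) powr (p/2)) \<partial>arc)\<^sup>2" for \<theta>
    proof -
      have "ennpowr (ennreal (v (best n \<theta>) \<theta>)) p = (ennreal (v (best n \<theta>) \<theta> powr (p/2)))\<^sup>2"
        by (simp add: v_def power2_eq_square flip: ennreal_mult powr_add)
      also have "\<dots> \<le> (\<integral>\<^sup>+\<phi>. ennreal (poisson (of_real (best n \<theta>) * cis \<theta>) (cis \<phi>)) *
              ennreal (cmod (f (cis \<phi>)) powr (p/2)) \<partial>arc)\<^sup>2"
        unfolding v_def using best01[of n \<theta>] p
        by (intro power_mono powr_nn_sub_poisson[OF f R]) (auto simp: norm_mult)
      finally show ?thesis .
    qed
    then have "(\<integral>\<^sup>+\<theta>. ennpowr (ennreal (v (best n \<theta>) \<theta>)) p \<partial>arc) \<le>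
        (\<integral>\<^sup>+\<theta>. (\<integral>\<^sup>+\<phi>. ennreal (poisson (of_real (best n \<theta>) * cis \<theta>) (cis \<phi>)) *
              ennreal (cmod (f (cis \<phi>)) powr (p/2)) \<partial>arc)\<^sup>2 \<partial>arc)"
      by (rule nn_integral_mono)
    also have "\<dots> \<le> 256 * (\<integral>\<^sup>+\<theta>. ennreal (cmod (f (cis \<theta>)) powr p) \<partial>arc)"
      by (rule holomorphic_poisson_maximal[OF f R p best_m best01(1) \<tau> \<tau>1])
    finally show "(\<integral>\<^sup>+\<theta>. ennpowr (ennreal (v (best n \<theta>) \<theta>)) p \<partial>arc) \<le> \<dots>" .
  qed
  finally show ?thesis .
qed

subsection \<open>Values at dyadic radii\<close>

lemma norm_cis_diff_1_le: "cmod (cis \<theta> - 1) \<le> \<bar>\<theta>\<bar>"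
  using dist_exp_i_1[of \<theta>] abs_sin_x_le_abs_x[of "\<theta>/2"] by (simp add: cis_conv_exp)

text \<open>A Harnack inequality: the points 1 - 2^-j and (1-\<theta>)e^(i\<theta>) are at most 2 *
  2^-j apart, comparable to their distances from the circle. The 36 is 4 from the numerators times
  3^2 from the distances. The curve spreads the single radius 1 - 2^-j over an interval of angles,
  where an integral can see it.\<close>

lemma poisson_dyadic_le:
  assumes \<theta>: "2 powr - real j / 2 < \<theta>" "\<theta> \<le> 2 powr - real j" and w: "cmod w = 1"
  shows "poisson (of_real (1 - 2 powr - real j)) w \<le> 36 * poisson (of_real (1 - \<theta>) * cis \<theta>) w"
proof -
  define d where "d = 2 powr - real j"
  have d: "0 < d" "d \<le> 1" unfolding d_def using powr_mono[of "- real j" 0 2] by auto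
  have \<theta>': "0 < \<theta>" "\<theta> \<le> 1" "d/2 < \<theta>" "\<theta> \<le> d" using \<theta> d unfolding d_def by auto
  define z where "z = of_real (1 - \<theta>) * cis \<theta>"
  have nz: "cmod z = 1 - \<theta>" using \<theta>' by (simp add: z_def norm_mult del: of_real_diff)
  have lower: "d \<le> cmod (w - of_real (1 - d))"
    using norm_triangle_ineq2[of w "of_real (1 - d)"] d w by (simp del: of_real_diff)
  have "cmod (of_real (1 - d) - z) \<le> 2 * d"
  proof -
    have "of_real (1 - d) - z = of_real (\<theta> - d) - of_real (1 - \<theta>) * (cis \<theta> - 1)"
      by (simp add: z_def algebra_simps)
    also have "cmod \<dots> \<le> cmod (of_real (\<theta> - d)) + cmod (of_real (1 - \<theta>) * (cis \<theta> - 1))"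
      by (rule norm_triangle_ineq4)
    also have "cmod (of_real (\<theta> - d)) \<le> d" using \<theta>' d by (simp del: of_real_diff)
    also have "cmod (of_real (1 - \<theta>) * (cis \<theta> - 1)) \<le> 1 * d"
      unfolding norm_mult using norm_cis_diff_1_le[of \<theta>] \<theta>' by (intro mult_mono) (auto simp del: of_real_diff)
    finally show ?thesis by simp
  qed
  moreover have "cmod (w - z) \<le> cmod (w - of_real (1 - d)) + cmod (of_real (1 - d) - z)"
    using norm_triangle_ineq[of "w - of_real (1 - d)" "of_real (1 - d) - z"] by simp
  ultimately have wz: "cmod (w - z) \<le> 3 * cmod (w - of_real (1 - d))" using lower by linarith
  have "z \<noteq> w" using nz w \<theta>' by auto
  then have pos: "0 < cmod (w - z)" by simp
  have num: "1 - (cmod (of_real (1 - d)))\<^sup>2 \<le> 4 * (1 - (cmod z)\<^sup>2)"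
  proof -
    have "1 - (1 - d)\<^sup>2 \<le> 2 * d" by (simp add: power2_eq_square algebra_simps)
    also have "\<dots> \<le> 4 * \<theta>" using \<theta>' by simp
    also have "\<theta> \<le> 1 - (1 - \<theta>)\<^sup>2" using \<theta>' by (simp add: power2_eq_square algebra_simps mult_left_le)
    finally show ?thesis using d by (simp add: nz del: of_real_diff)
  qed
  have "poisson (of_real (1 - d)) w \<le> 4 * (1 - (cmod z)\<^sup>2) / (cmod (w - z) / 3)\<^sup>2"
    unfolding poisson_def using num wz pos \<theta>' by (intro frac_le power_mono) (auto simp: nz power_le_one)
  also have "\<dots> = 36 * poisson z w" by (simp add: poisson_def power_divide)
  finally show ?thesis by (simp add: d_def z_def)
qed

lemma emeasure_arc_interval:
  assumes "0 \<le> a" "a \<le> b" "b \<le> 2*pi"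
  shows "emeasure arc {a<..b} = ennreal ((b - a) / (2*pi))"
proof -
  have "emeasure arc {a<..b} = (\<integral>\<^sup>+\<theta>. indicator {0..2*pi} \<theta> * ennreal (1 / (2*pi)) * indicator {a<..b} \<theta> \<partial>lborel)"
    by (simp add: arc_def emeasure_density)
  also have "\<dots> = (\<integral>\<^sup>+\<theta>. ennreal (1 / (2*pi)) * indicator {a<..b} \<theta> \<partial>lborel)"
    using assms by (intro nn_integral_cong) (auto simp: indicator_def)
  also have "\<dots> = ennreal (1 / (2*pi)) * ennreal (b - a)"
    using assms by (simp add: nn_integral_cmult_indicator)
  finally show ?thesis using assms by (simp flip: ennreal_mult)
qed

text \<open>The linearised maximal operator with radius 1 - \<theta> at angle \<theta> dominates f(1
  - 2^-j) on 2^-j/2 < \<theta> \<le> 2^-j. These intervals are disjoint and have arc measure 2^-j/(4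
  pi), so integration produces the sum. The constant is 36^2 * 256 * 4 pi: Harnack, maximal theorem,
  arc measure.\<close>

lemma radial_dyadic_embedding_closed:
  assumes f: "f holomorphic_on ball 0 R" and R: "1 < R" and p: "0 < p"
  shows "(\<Sum>j\<le>J. ennreal (2 powr - real j * cmod (f (of_real (1 - 2 powr - real j))) powr p))
           \<le> ennreal (1327104 * pi) * (\<integral>\<^sup>+\<theta>. ennreal (cmod (f (cis \<theta>)) powr p) \<partial>arc)"
proof -
  define \<delta> where "\<delta> j = 2 powr - real j" for j
  have \<delta>: "0 < \<delta> j" "\<delta> j \<le> 1" for j unfolding \<delta>_def using powr_mono[of "- real j" 0 2] by auto
  have \<delta>Suc: "\<delta> (Suc j) = \<delta> j / 2" for j
    by (simp add: \<delta>_def powr_diff powr_minus field_simps powr_add)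
  have \<delta>mono: "\<delta> k \<le> \<delta> j" if "j \<le> k" for j k unfolding \<delta>_def using that by (intro powr_mono) auto
  define I where "I j = {\<delta> j / 2<..\<delta> j}" for j
  \<comment> \<open>The clamp keeps the radius nonnegative and uniformly below 1 at all angles; on
    the intervals with j \<le> J it is inactive.\<close>
  define t where "t \<theta> = max 0 (min (1 - \<theta>) (1 - \<delta> (Suc J)))" for \<theta>
  have [measurable]: "t \<in> borel_measurable borel" unfolding t_def by measurable
  have t: "0 \<le> t \<theta>" "t \<theta> \<le> 1 - \<delta> (Suc J)" "1 - \<delta> (Suc J) < 1" for \<theta>
    using \<delta>[of "Suc J"] by (auto simp: t_def)
  have t_eq: "t \<theta> = 1 - \<theta>" if "\<theta> \<in> I j" "j \<le> J" for \<theta> j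
  proof -
    have "\<delta> (Suc J) \<le> \<theta>" using that \<delta>mono[of "Suc j" "Suc J"] by (auto simp: I_def \<delta>Suc)
    moreover have "\<theta> \<le> 1" using that \<delta>(2)[of j] by (auto simp: I_def)
    ultimately show ?thesis by (auto simp: t_def)
  qed
  define u where "u \<phi> = ennreal (cmod (f (cis \<phi>)) powr (p/2))" for \<phi>
  define T where "T \<theta> = (\<integral>\<^sup>+\<phi>. ennreal (poisson (of_real (t \<theta>) * cis \<theta>) (cis \<phi>)) * u \<phi> \<partial>arc)" for \<theta>
  define c where "c j = ennreal (cmod (f (of_real (1 - \<delta> j))) powr p)" for j
  note fc = continuous_on_circle[OF f R]
  have [measurable]: "(\<lambda>\<theta>. f (cis \<theta>)) \<in> borel_measurable borel"
    using fc by (rule borel_measurable_continuous_onI)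
  have um [measurable]: "u \<in> borel_measurable borel" unfolding u_def by measurable
  have one: "c j \<le> 1296 * (T \<theta>)\<^sup>2" if "\<theta> \<in> I j" "j \<le> J" for j \<theta>
  proof -
    have \<theta>: "0 < \<theta>" "\<theta> \<le> 1" using that \<delta>[of j] by (auto simp: I_def)
    have "ennreal (cmod (f (of_real (1 - \<delta> j))) powr (p/2)) \<le>
        (\<integral>\<^sup>+\<phi>. ennreal (poisson (of_real (1 - \<delta> j)) (cis \<phi>)) * u \<phi> \<partial>arc)"
      unfolding u_def using \<delta>[of j] p by (intro powr_nn_sub_poisson[OF f R]) (auto simp del: of_real_diff)
    also have "\<dots> \<le> (\<integral>\<^sup>+\<phi>. 36 * (ennreal (poisson (of_real (t \<theta>) * cis \<theta>) (cis \<phi>)) * u \<phi>) \<partial>arc)"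
    proof (rule nn_integral_mono)
      fix \<phi>
      have le: "poisson (of_real (1 - \<delta> j)) (cis \<phi>) \<le> 36 * poisson (of_real (t \<theta>) * cis \<theta>) (cis \<phi>)"
        unfolding t_eq[OF that] \<delta>_def using that by (intro poisson_dyadic_le) (auto simp: I_def \<delta>_def)
      have "ennreal (poisson (of_real (1 - \<delta> j)) (cis \<phi>)) \<le> 36 * ennreal (poisson (of_real (t \<theta>) * cis \<theta>) (cis \<phi>))"
        using ennreal_leI[OF le] poisson_nonneg[of "of_real (t \<theta>) * cis \<theta>" "cis \<phi>"] t(1,2)[of \<theta>] t(3)
        by (simp add: ennreal_mult norm_mult)
      then show "ennreal (poisson (of_real (1 - \<delta> j)) (cis \<phi>)) * u \<phi>
          \<le> 36 * (ennreal (poisson (of_real (t \<theta>) * cis \<theta>) (cis \<phi>)) * u \<phi>)"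
        unfolding mult.assoc[symmetric] by (rule mult_right_mono) simp
    qed
    also have "\<dots> = 36 * T \<theta>" unfolding T_def by (simp add: nn_integral_cmult)
    finally have "(ennreal (cmod (f (of_real (1 - \<delta> j))) powr (p/2)))\<^sup>2 \<le> (36 * T \<theta>)\<^sup>2"
      by (intro power_mono) auto
    also have "(36 * T \<theta>)\<^sup>2 = 1296 * (T \<theta>)\<^sup>2" by (simp add: power_mult_distrib)
    also have "(ennreal (cmod (f (of_real (1 - \<delta> j))) powr (p/2)))\<^sup>2 = c j"
      by (simp add: c_def power2_eq_square flip: ennreal_mult powr_add)
    finally show ?thesis .
  qed
  have sum_one: "(\<Sum>j\<le>J. c j * indicator (I j) \<theta>) \<le> 1296 * (T \<theta>)\<^sup>2" for \<theta>
  proof (cases "\<exists>j\<le>J. \<theta> \<in> I j")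
    case True
    then obtain j where j: "j \<le> J" "\<theta> \<in> I j" by blast
    have "\<theta> \<notin> I k" if "k \<noteq> j" for k
    proof (cases "k < j")
      case True
      then show ?thesis using \<delta>mono[of "Suc k" j] j by (auto simp: I_def \<delta>Suc)
    next
      case False
      then show ?thesis using \<delta>mono[of "Suc j" k] that j by (auto simp: I_def \<delta>Suc)
    qed
    then have "(\<Sum>k\<le>J. c k * indicator (I k) \<theta>) = (\<Sum>k\<le>J. if k = j then c j else 0)"
      using j by (intro sum.cong) auto
    also have "\<dots> = c j" using j by simp
    finally show ?thesis using one[OF j(2,1)] by simp
  next
    case False
    then have "(\<Sum>j\<le>J. c j * indicator (I j) \<theta>) = 0" by (intro sum.neutral) auto
    then show ?thesis by simp
  qed
  have "(\<Sum>j\<le>J. c j * emeasure arc (I j)) = (\<integral>\<^sup>+\<theta>. (\<Sum>j\<le>J. c j * indicator (I j) \<theta>) \<partial>arc)"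
    by (subst nn_integral_sum) (auto simp: I_def nn_integral_cmult_indicator)
  also have "\<dots> \<le> (\<integral>\<^sup>+\<theta>. 1296 * (T \<theta>)\<^sup>2 \<partial>arc)"
    by (intro nn_integral_mono sum_one)
  also have "\<dots> = 1296 * (\<integral>\<^sup>+\<theta>. (T \<theta>)\<^sup>2 \<partial>arc)"
    by (rule nn_integral_cmult) (simp add: T_def)
  also have "(\<integral>\<^sup>+\<theta>. (T \<theta>)\<^sup>2 \<partial>arc) \<le> 256 * (\<integral>\<^sup>+\<theta>. ennreal (cmod (f (cis \<theta>)) powr p) \<partial>arc)"
    unfolding T_def u_def by (rule holomorphic_poisson_maximal[OF f R p _ t]) measurable
  also have "1296 * (256 * N) = 331776 * N" for N :: ennreal
    by (simp add: mult.assoc[symmetric])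
  finally have *: "(\<Sum>j\<le>J. c j * emeasure arc (I j)) \<le> 331776 * (\<integral>\<^sup>+\<theta>. ennreal (cmod (f (cis \<theta>)) powr p) \<partial>arc)"
    by (simp add: mult_left_mono)
  have "ennreal (\<delta> j * cmod (f (of_real (1 - \<delta> j))) powr p) = ennreal (4*pi) * (c j * emeasure arc (I j))" for j
  proof -
    have "\<delta> j \<le> 2 * pi" using \<delta>(2)[of j] pi_ge_two by linarith
    then have "emeasure arc (I j) = ennreal (\<delta> j / (4*pi))"
      unfolding I_def using \<delta>[of j] by (subst emeasure_arc_interval) auto
    then have "ennreal (4*pi) * (c j * emeasure arc (I j))
        = ennreal (4*pi) * (ennreal (cmod (f (of_real (1 - \<delta> j))) powr p) * ennreal (\<delta> j / (4*pi)))"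
      by (simp only: c_def)
    also have "\<dots> = ennreal (4*pi * (cmod (f (of_real (1 - \<delta> j))) powr p * (\<delta> j / (4*pi))))"
      using \<delta>[of j] by (subst (1 2) ennreal_mult) auto
    also have "4*pi * (cmod (f (of_real (1 - \<delta> j))) powr p * (\<delta> j / (4*pi))) = \<delta> j * cmod (f (of_real (1 - \<delta> j))) powr p"
      by simp
    finally show ?thesis by simp
  qed
  then have "(\<Sum>j\<le>J. ennreal (\<delta> j * cmod (f (of_real (1 - \<delta> j))) powr p)) = ennreal (4*pi) * (\<Sum>j\<le>J. c j * emeasure arc (I j))"
    by (simp only: sum_distrib_left)
  also have "\<dots> \<le> ennreal (4*pi) * (331776 * (\<integral>\<^sup>+\<theta>. ennreal (cmod (f (cis \<theta>)) powr p) \<partial>arc))"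
    by (intro mult_left_mono *) auto
  also have "\<dots> = ennreal (1327104 * pi) * (\<integral>\<^sup>+\<theta>. ennreal (cmod (f (cis \<theta>)) powr p) \<partial>arc)"
  proof -
    have "ennreal (4*pi) * 331776 = ennreal (4*pi) * ennreal 331776" by simp
    also have "\<dots> = ennreal (1327104 * pi)" by (subst ennreal_mult[symmetric]) auto
    finally show ?thesis by (simp only: mult.assoc[symmetric])
  qed
  finally show ?thesis by (simp add: \<delta>_def)
qed

subsection \<open>Hardy integrals\<close>

abbreviation slice_int :: "real \<Rightarrow> (complex \<Rightarrow> complex) \<Rightarrow> real \<Rightarrow> ennreal" where
  "slice_int p f \<rho> \<equiv> \<integral>\<^sup>+\<theta>. ennreal (cmod (f (of_real \<rho> * cis \<theta>)) powr p) \<partial>arc"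

abbreviation dilate :: "real \<Rightarrow> (complex \<Rightarrow> complex) \<Rightarrow> complex \<Rightarrow> complex" where
  "dilate \<rho> f \<equiv> \<lambda>z. f (of_real \<rho> * z)"

abbreviation potential_int :: "real measure \<Rightarrow> real \<Rightarrow> real \<Rightarrow> ennreal" where
  "potential_int \<mu> \<gamma> r \<equiv> \<integral>\<^sup>+\<theta>. ennpowr (potential \<mu> \<gamma> (cis \<theta>)) r \<partial>arc"

abbreviation dyadic_sum :: "real measure \<Rightarrow> real \<Rightarrow> real \<Rightarrow> ennreal" where
  "dyadic_sum \<mu> \<sigma> r \<equiv> \<Sum>j. ennreal (dyadic_weight \<mu> \<sigma> j powr r)"

abbreviation moment_sum :: "real measure \<Rightarrow> real \<Rightarrow> real \<Rightarrow> ennreal" where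
  "moment_sum \<mu> \<gamma> r \<equiv> \<Sum>n. ennreal (real (n + 1) powr (r * \<gamma> - 2) * moment \<mu> n powr r)"

text \<open>The p-th power of the Hardy norm for finite p, kept without the root so that integral
  estimates apply directly.\<close>

definition hardy_int :: "real \<Rightarrow> (complex \<Rightarrow> complex) \<Rightarrow> ennreal" where
  "hardy_int p f = (SUP \<rho>\<in>{0..<1::real}. slice_int p f \<rho>)"

lemma circle_norm_arc:
  assumes [measurable]: "(\<lambda>\<theta>. g (cis \<theta>)) \<in> borel_measurable borel"
  shows "circle_norm r g = ennpowr (\<integral>\<^sup>+\<theta>. ennpowr (g (cis \<theta>)) r \<partial>arc) (1/r)"
  unfolding circle_norm_def by (subst nn_integral_arc) auto

lemma hardy_norm_eq:
  assumes f: "continuous_on (ball 0 1) f" and p: "0 < p"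
  shows "hardy_norm (ennreal p) f = ennpowr (hardy_int p f) (1/p)"
proof -
  have "hardy_norm (ennreal p) f
      = (SUP \<rho>\<in>{0..<1::real}. circle_norm p (\<lambda>w. ennreal (cmod (f (of_real \<rho> * w)))))"
    using p by (simp add: hardy_norm_def)
  also have "\<dots> = (SUP \<rho>\<in>{0..<1::real}. ennpowr (slice_int p f \<rho>) (1/p))"
  proof (rule SUP_cong[OF refl])
    fix \<rho> :: real assume "\<rho> \<in> {0..<1}"
    then have [measurable]: "(\<lambda>\<theta>. f (of_real \<rho> * cis \<theta>)) \<in> borel_measurable borel"
      by (intro borel_measurable_circle_slice f) auto
    show "circle_norm p (\<lambda>w. ennreal (cmod (f (of_real \<rho> * w))))
        = ennpowr (slice_int p f \<rho>) (1/p)"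
      by (subst circle_norm_arc) auto
  qed
  also have "\<dots> = ennpowr (hardy_int p f) (1/p)"
    unfolding hardy_int_def using p by (subst ennpowr_SUP) auto
  finally show ?thesis .
qed

lemma hardy_int_eq:
  assumes "continuous_on (ball 0 1) f" and "0 < p"
  shows "hardy_int p f = ennpowr (hardy_norm (ennreal p) f) p"
  using hardy_norm_eq[OF assms] assms by simp

lemma slice_le_hardy_int:
  "0 \<le> \<rho> \<Longrightarrow> \<rho> < 1 \<Longrightarrow> slice_int p f \<rho> \<le> hardy_int p f"
  unfolding hardy_int_def by (rule SUP_upper2[of \<rho>]) auto

lemma dilation_holomorphic:
  assumes f: "f holomorphic_on ball 0 1" and \<rho>: "0 \<le> \<rho>" "\<rho> < 1"
  obtains R where "1 < R" "dilate \<rho> f holomorphic_on ball 0 R"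
proof
  \<comment> \<open>A radius strictly between 1 and 1/\<rho> that also makes sense for \<rho> =
    0.\<close>
  show "1 < 2 / (1 + \<rho>)" using \<rho> by simp
  have "cmod (of_real \<rho> * z) < 1" if "cmod z < 2 / (1 + \<rho>)" for z
  proof -
    have "\<rho> * cmod z \<le> \<rho> * (2 / (1 + \<rho>))" using that \<rho> by (intro mult_left_mono) auto
    also have "\<dots> < 1" using \<rho> by (simp add: field_simps)
    finally show ?thesis using \<rho> by (simp add: norm_mult)
  qed
  then have "(f \<circ> (\<lambda>z. of_real \<rho> * z)) holomorphic_on ball 0 (2 / (1 + \<rho>))"
    by (intro holomorphic_on_compose_gen[OF _ f] holomorphic_intros) auto
  then show "dilate \<rho> f holomorphic_on ball 0 (2 / (1 + \<rho>))"
    by (simp add: o_def)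
qed

lemma radial_max_hardy:
  assumes f: "f holomorphic_on ball 0 1" and \<rho>: "0 \<le> \<rho>" "\<rho> < 1" and p: "0 < p"
  shows "(\<integral>\<^sup>+\<theta>. ennpowr (radial_max (dilate \<rho> f) \<theta>) p \<partial>arc) \<le> 256 * hardy_int p f"
proof -
  obtain R where R: "1 < R" "dilate \<rho> f holomorphic_on ball 0 R"
    by (rule dilation_holomorphic[OF f \<rho>])
  have "(\<integral>\<^sup>+\<theta>. ennpowr (radial_max (dilate \<rho> f) \<theta>) p \<partial>arc)
      \<le> 256 * slice_int p f \<rho>"
    by (rule radial_max_bound_closed[OF R(2,1) p])
  also have "\<dots> \<le> 256 * hardy_int p f"
    by (intro mult_left_mono slice_le_hardy_int \<rho>) auto
  finally show ?thesis .
qed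

text \<open>The bound is uniform over the dilates of f, and in a finite partial sum the dilation
  factor may tend to 1 termwise.\<close>

lemma radial_dyadic_embedding:
  assumes f: "f holomorphic_on ball 0 1" and p: "0 < p"
  shows "(\<Sum>j. ennreal (2 powr - real j * cmod (f (of_real (1 - 2 powr - real j))) powr p))
           \<le> ennreal (1327104 * pi) * hardy_int p f"
proof (rule suminf_le_const)
  fix n
  define \<rho> where "\<rho> k = 1 - 1 / (real k + 2)" for k
  have \<rho>: "0 \<le> \<rho> k" "\<rho> k < 1" for k by (auto simp: \<rho>_def field_simps)
  have \<rho>lim: "\<rho> \<longlonglongrightarrow> 1" unfolding \<rho>_def by real_asymp
  define a where "a j = 1 - 2 powr - real j" for j
  have a: "0 \<le> a j" "a j < 1" for j unfolding a_def using powr_mono[of "- real j" 0 2] by auto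
  have le: "(\<Sum>j\<le>n. ennreal (2 powr - real j * cmod (f (of_real (\<rho> k) * of_real (a j))) powr p))
      \<le> ennreal (1327104 * pi) * hardy_int p f" for k
  proof -
    obtain R where R: "1 < R" "(\<lambda>z. f (of_real (\<rho> k) * z)) holomorphic_on ball 0 R"
      by (rule dilation_holomorphic[OF f \<rho>])
    have "(\<Sum>j\<le>n. ennreal (2 powr - real j * cmod (f (of_real (\<rho> k) * of_real (a j))) powr p))
        \<le> ennreal (1327104 * pi) * slice_int p f (\<rho> k)"
      unfolding a_def by (rule radial_dyadic_embedding_closed[OF R(2,1) p])
    also have "\<dots> \<le> ennreal (1327104 * pi) * hardy_int p f"
      by (intro mult_left_mono slice_le_hardy_int \<rho>) auto
    finally show ?thesis .
  qed
  have "(\<lambda>k. \<Sum>j\<le>n. ennreal (2 powr - real j * cmod (f (of_real (\<rho> k) * of_real (a j))) powr p))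
      \<longlonglongrightarrow> (\<Sum>j\<le>n. ennreal (2 powr - real j * cmod (f (of_real 1 * of_real (a j))) powr p))"
  proof (intro tendsto_sum tendsto_ennrealI tendsto_mult tendsto_const tendsto_powr' tendsto_norm)
    fix j
    have "isCont f (of_real 1 * of_real (a j))"
      using a[of j] by (intro continuous_on_interior[OF holomorphic_on_imp_continuous_on[OF f]]) auto
    then show "(\<lambda>k. f (of_real (\<rho> k) * of_real (a j))) \<longlonglongrightarrow> f (of_real 1 * of_real (a j))"
      by (intro isCont_tendsto_compose[of _ f] tendsto_mult tendsto_of_real \<rho>lim tendsto_const)
  qed (use p in auto)
  then have "(\<Sum>j\<le>n. ennreal (2 powr - real j * cmod (f (of_real 1 * of_real (a j))) powr p))
      \<le> ennreal (1327104 * pi) * hardy_int p f"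
    by (rule LIMSEQ_le_const2) (use le in blast)
  then show "(\<Sum>j<n. ennreal (2 powr - real j * cmod (f (of_real (1 - 2 powr - real j))) powr p))
      \<le> ennreal (1327104 * pi) * hardy_int p f"
    unfolding a_def of_real_1 mult_1 by (rule order_trans[rotated]) (intro sum_mono2, auto)
qed simp

text \<open>Point evaluations are controlled by the Hardy norm for every exponent; this supplies the
  local boundedness for Montel's theorem.\<close>

lemma hardy_int_growth:
  assumes f: "f holomorphic_on ball 0 1" and p: "0 < p" and z: "cmod z < 1"
  shows "ennreal (cmod (f z) powr p) \<le> ennreal (4 / (1 - cmod z)) * hardy_int p f"
proof -
  \<comment> \<open>With \<rho> half way between |z| and 1, the point w = z/\<rho> keeps distance at
    least (1-|z|)/2 from the circle, which bounds the Poisson kernel by 4/(1-|z|).\<close>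
  define \<rho> where "\<rho> = (1 + cmod z) / 2"
  have \<rho>: "0 < \<rho>" "\<rho> < 1" using z by (auto simp: \<rho>_def add_pos_nonneg)
  define w where "w = z / of_real \<rho>"
  have zw: "z = of_real \<rho> * w" using \<rho> by (simp add: w_def)
  have nw: "cmod w = cmod z / \<rho>" using \<rho> by (simp add: w_def norm_divide)
  have w: "1 - cmod w \<ge> (1 - cmod z) / 2"
  proof -
    have "0 < 1 + cmod z" by (simp add: add_pos_nonneg)
    then have "1 - cmod w = (1 - cmod z) / (1 + cmod z)"
      unfolding nw \<rho>_def by (simp add: divide_simps)
    also have "\<dots> \<ge> (1 - cmod z) / 2" using z by (intro divide_left_mono) (auto simp: add_pos_nonneg)
    finally show ?thesis .
  qed
  then have w1: "cmod w < 1" using z by simp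
  obtain R where R: "1 < R" "dilate \<rho> f holomorphic_on ball 0 R"
    by (rule dilation_holomorphic[OF f, of \<rho>]) (use \<rho> in auto)
  have [measurable]: "(\<lambda>\<theta>. f (of_real \<rho> * cis \<theta>)) \<in> borel_measurable borel"
    using \<rho> by (intro borel_measurable_circle_slice holomorphic_on_imp_continuous_on f) auto
  have "ennreal (cmod (f z) powr p)
      \<le> (\<integral>\<^sup>+\<theta>. ennreal (poisson w (cis \<theta>)) * ennreal (cmod (f (of_real \<rho> * cis \<theta>)) powr p) \<partial>arc)"
    unfolding zw by (rule powr_nn_sub_poisson[OF R(2,1) p w1])
  also have "\<dots> \<le> (\<integral>\<^sup>+\<theta>. ennreal (4 / (1 - cmod z)) * ennreal (cmod (f (of_real \<rho> * cis \<theta>)) powr p) \<partial>arc)"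
  proof (intro nn_integral_mono mult_right_mono ennreal_leI)
    fix \<theta>
    have "poisson w (cis \<theta>) \<le> 2 / (1 - cmod w)" by (intro poisson_le w1) simp
    also have "\<dots> \<le> 2 / ((1 - cmod z) / 2)" using w z w1 by (intro divide_left_mono) auto
    finally show "poisson w (cis \<theta>) \<le> 4 / (1 - cmod z)" by simp
  qed simp
  also have "\<dots> = ennreal (4 / (1 - cmod z)) * slice_int p f \<rho>"
    by (rule nn_integral_cmult) simp
  also have "\<dots> \<le> ennreal (4 / (1 - cmod z)) * hardy_int p f"
    using \<rho> by (intro mult_left_mono slice_le_hardy_int) auto
  finally show ?thesis .
qed

subsection \<open>The boundary potential\<close>

text \<open>Jordan's inequality: the concave sine lies above its chord from 0 to pi/2.\<close>

lemma sin_ge_two_over_pi: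
  assumes "0 \<le> x" "x \<le> pi / 2"
  shows "2 * x / pi \<le> sin x"
proof -
  have "convex_on {0..pi} (\<lambda>x. - sin x)"
    by (rule f''_ge0_imp_convex[where f' = "\<lambda>x. - cos x" and f'' = sin])
       (auto intro!: derivative_eq_intros sin_ge_zero)
  from convex_onD[OF this, of "2 * x / pi" 0 "pi/2"] show ?thesis
    using assms by (simp add: field_simps)
qed

lemma norm_one_minus_cis: "cmod (1 - cis \<theta>) = 2 * \<bar>sin (\<theta> / 2)\<bar>"
  using dist_exp_i_1[of \<theta>] by (simp add: cis_conv_exp norm_minus_commute)

text \<open>By Jordan's inequality \<theta> lies within a = pi x/2 of 0 or of 2 pi, both of which
  stand for the point 1; the two intervals have arc measure x/2 together. For x > 2 the total mass 1
  is bound enough.\<close>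

lemma emeasure_arc_near_one:
  assumes "0 \<le> x"
  shows "emeasure arc {\<theta> \<in> {0<..<2*pi}. cmod (1 - cis \<theta>) \<le> x} \<le> ennreal (x / 2)"
proof (cases "x \<le> 2")
  case True
  define a where "a = pi * x / 2"
  have a: "0 \<le> a" "a \<le> pi" using assms True by (auto simp: a_def)
  have "{\<theta> \<in> {0<..<2*pi}. cmod (1 - cis \<theta>) \<le> x} \<subseteq> {0<..a} \<union> {2*pi - a - 0..<2*pi}"
  proof safe
    fix \<theta> assume \<theta>: "\<theta> \<in> {0<..<2*pi}" "cmod (1 - cis \<theta>) \<le> x" "\<theta> \<notin> {2*pi - a - 0..<2*pi}"
    have s: "2 * sin (\<theta>/2) \<le> x"
      using \<theta> sin_ge_zero[of "\<theta>/2"] by (simp add: norm_one_minus_cis)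
    have "\<theta> \<le> a"
    proof (cases "\<theta> \<le> pi")
      case True
      then have "2 * (\<theta>/2) / pi \<le> sin (\<theta>/2)" using \<theta> by (intro sin_ge_two_over_pi) auto
      then have "2 * (\<theta> / pi) \<le> x" using s by simp
      then show ?thesis by (simp add: a_def field_simps)
    next
      case False
      have "2 * (pi - \<theta>/2) / pi \<le> sin (pi - \<theta>/2)" using False \<theta> by (intro sin_ge_two_over_pi) auto
      then have "2 * (2 * (pi - \<theta>/2) / pi) \<le> 2 * sin (pi - \<theta>/2)" by (rule mult_left_mono) simp
      also have "\<dots> \<le> x" using s by simp
      finally have "2 * (2 * (pi - \<theta>/2) / pi) \<le> x" .
      then have "2*pi - \<theta> \<le> a" by (simp add: a_def field_simps)
      then show ?thesis using \<theta> by auto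
    qed
    then show "\<theta> \<in> {0<..a}" using \<theta> by auto
  qed
  then have "emeasure arc {\<theta> \<in> {0<..<2*pi}. cmod (1 - cis \<theta>) \<le> x}
      \<le> emeasure arc ({0<..a} \<union> {2*pi - a..<2*pi})"
    by (intro emeasure_mono) auto
  also have "\<dots> \<le> emeasure arc {0<..a} + emeasure arc {2*pi - a..<2*pi}"
    by (rule emeasure_subadditive) auto
  also have "emeasure arc {0<..a} = ennreal (a / (2*pi))"
    using a pi_gt_zero by (subst emeasure_arc_interval) auto
  also have "emeasure arc {2*pi - a..<2*pi} = emeasure arc {2*pi - a<..2*pi}"
  proof (rule emeasure_eq_AE)
    have "AE \<theta> in lborel. \<theta> \<noteq> (2*pi - a)" "AE \<theta> in lborel. \<theta> \<noteq> (2*pi::real)"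
      by (rule AE_lborel_singleton)+
    then have "AE \<theta> in lborel. 0 < indicator {0..2*pi} \<theta> * ennreal (1 / (2*pi)) \<longrightarrow>
        (\<theta> \<in> {2*pi - a..<2*pi} \<longleftrightarrow> \<theta> \<in> {2*pi - a<..2*pi})"
      by eventually_elim auto
    then show "AE \<theta> in arc. \<theta> \<in> {2*pi - a..<2*pi} \<longleftrightarrow> \<theta> \<in> {2*pi - a<..2*pi}"
      unfolding arc_def by (subst AE_density) auto
  qed auto
  also have "\<dots> = ennreal (a / (2*pi))"
    using a pi_gt_zero by (subst emeasure_arc_interval) auto
  also have "ennreal (a / (2*pi)) + ennreal (a / (2*pi)) = ennreal (x / 2)"
    using assms by (subst ennreal_plus[symmetric]) (auto simp: a_def)
  finally show ?thesis .
next
  case False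
  have "emeasure arc {\<theta> \<in> {0<..<2*pi}. cmod (1 - cis \<theta>) \<le> x} \<le> emeasure arc UNIV"
    by (intro emeasure_mono) auto
  also have "\<dots> \<le> ennreal (x / 2)" using False by (simp add: ennreal_le_iff flip: ennreal_1)
  finally show ?thesis .
qed

text \<open>Almost every angle lies in a shell 2^-i < |1 - e^(i\<theta>)| \<le> 2 * 2^-i, and each
  shell has arc measure at most 2^-i. Serves the potential and the test functions alike.\<close>

lemma shell_integral_bound:
  assumes G: "\<And>\<theta> i. 1 / 2 ^ i < cmod (1 - cis \<theta>) \<Longrightarrow> G \<theta> \<le> h i"
  shows "(\<integral>\<^sup>+\<theta>. G \<theta> \<partial>arc) \<le> (\<Sum>i. ennreal (1 / 2 ^ i) * h i)"
proof -
  define E where "E i = {\<theta> \<in> {0<..<2*pi}. cmod (1 - cis \<theta>) \<le> 2 / 2 ^ i}" for i :: nat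
  have E [measurable]: "E i \<in> sets borel" for i unfolding E_def by measurable
  have "AE \<theta> in arc. G \<theta> \<le> (\<Sum>i. h i * indicator (E i) \<theta>)"
    using AE_arc_strict
  proof eventually_elim
    case (elim \<theta>)
    define x where "x = cmod (1 - cis \<theta>)"
    have "0 < sin (\<theta>/2)" using elim by (intro sin_gt_zero) auto
    then have x0: "0 < x" by (simp add: x_def norm_one_minus_cis)
    have x2: "x \<le> 2" using norm_triangle_ineq4[of 1 "cis \<theta>"] by (simp add: x_def)
    obtain n where "(1/2) ^ n < x" using real_arch_pow_inv[OF x0, of "1/2"] by auto
    then have ex: "\<exists>n. 1 / 2 ^ n < x" by (auto simp: power_divide)
    define i where "i = (LEAST n. 1 / 2 ^ n < x)"
    have i: "1 / 2 ^ i < x" unfolding i_def using ex by (rule LeastI_ex)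
    have "x \<le> 2 / 2 ^ i"
    proof (cases i)
      case (Suc k)
      then have "\<not> 1 / 2 ^ k < x" unfolding i_def by (intro not_less_Least) (simp add: i_def)
      then show ?thesis using Suc by simp
    qed (use x2 in simp)
    then have iE: "\<theta> \<in> E i" using elim by (auto simp: E_def x_def)
    have "G \<theta> \<le> h i" using G[of i \<theta>] i by (simp add: x_def)
    also have "\<dots> = (\<Sum>k\<in>{i}. h k * indicator (E k) \<theta>)" using iE by simp
    also have "\<dots> \<le> (\<Sum>k. h k * indicator (E k) \<theta>)" by (intro sum_le_suminf) auto
    finally show ?case .
  qed
  then have "(\<integral>\<^sup>+\<theta>. G \<theta> \<partial>arc) \<le> (\<integral>\<^sup>+\<theta>. (\<Sum>i. h i * indicator (E i) \<theta>) \<partial>arc)"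
    by (rule nn_integral_mono_AE)
  also have "\<dots> = (\<Sum>i. \<integral>\<^sup>+\<theta>. h i * indicator (E i) \<theta> \<partial>arc)"
    by (rule nn_integral_suminf) measurable
  also have "\<dots> = (\<Sum>i. h i * emeasure arc (E i))"
    by (intro suminf_cong nn_integral_cmult_indicator) simp
  also have "\<dots> \<le> (\<Sum>i. ennreal (1 / 2 ^ i) * h i)"
  proof (intro suminf_le allI summableI)
    fix i
    have "emeasure arc (E i) \<le> ennreal (2 / 2 ^ i / 2)"
      unfolding E_def by (rule emeasure_arc_near_one) simp
    then show "h i * emeasure arc (E i) \<le> ennreal (1 / 2 ^ i) * h i"
      by (simp add: mult.commute mult_left_mono)
  qed
  finally show ?thesis .
qed

lemma dyadic_interval:
  fixes t :: real
  assumes "0 \<le> t" "t < 1"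
  obtains j :: nat where "1 - 1 / 2 ^ j \<le> t" "t < 1 - 1 / 2 ^ Suc j"
proof -
  define n where "n = (LEAST n. t < 1 - 1 / 2 ^ n)"
  obtain k where "(1/2) ^ k < 1 - t" using real_arch_pow_inv[of "1 - t" "1/2"] assms by auto
  then have "t < 1 - 1 / 2 ^ k" by (simp add: power_divide)
  then have n: "t < 1 - 1 / 2 ^ n" unfolding n_def by (rule LeastI)
  then have "n \<noteq> 0" using assms by (intro notI) simp
  then obtain j where j: "n = Suc j" by (cases n) auto
  then have "\<not> t < 1 - 1 / 2 ^ j" unfolding n_def by (intro not_less_Least) (simp add: n_def)
  then show ?thesis using that[of j] n j by (simp add: not_less)
qed

text \<open>Moving from radius \<open>s\<close> out to \<open>t\<close> changes the distance to 1 by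
  at most t - s \<le> 1 - s, which the distance itself dominates. Kernels inside the disc can thus
  be compared with those on the circle.\<close>

lemma norm_one_minus_scaled:
  assumes "cmod w = 1" "0 \<le> s" "s \<le> t" "t \<le> 1"
  shows "1 - s \<le> cmod (1 - of_real s * w)" "cmod (1 - of_real t * w) \<le> 2 * cmod (1 - of_real s * w)"
proof -
  show 1: "1 - s \<le> cmod (1 - of_real s * w)"
    using norm_triangle_ineq2[of 1 "of_real s * w"] assms by (simp add: norm_mult)
  have "1 - of_real t * w = (1 - of_real s * w) - of_real (t - s) * w" by (simp add: algebra_simps)
  also have "cmod \<dots> \<le> cmod (1 - of_real s * w) + cmod (of_real (t - s) * w)"
    by (rule norm_triangle_ineq4)
  also have "cmod (of_real (t - s) * w) = t - s" using assms by (simp add: norm_mult del: of_real_diff)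
  finally show "cmod (1 - of_real t * w) \<le> 2 * cmod (1 - of_real s * w)" using 1 assms by simp
qed

section \<open>Measures on [0,1), their dyadic tails and boundary potentials\<close>

locale unit_measure = finite_measure \<mu> for \<mu> :: "real measure" +
  assumes sets_eq: "sets \<mu> = sets (restrict_space borel {0..<1})"
begin

lemma space_eq: "space \<mu> = {0..<1}"
  using sets_eq_imp_space_eq[OF sets_eq] by (simp add: space_restrict_space)

lemma measurable_borel: "f \<in> borel_measurable borel \<Longrightarrow> f \<in> borel_measurable \<mu>"
  using measurable_restrict_space1[of f borel borel "{0..<1}"] measurable_cong_sets[OF sets_eq refl] by blast

lemma tail_sets: "0 \<le> a \<Longrightarrow> {a..<1} \<in> sets \<mu>"
  unfolding sets_eq sets_restrict_space by (auto intro!: image_eqI[of _ _ "{a..<1}"])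

definition tail :: "nat \<Rightarrow> real" where "tail j = measure \<mu> {1 - 1 / 2 ^ j..<1}"

lemma tail_nonneg [simp]: "0 \<le> tail j"
  by (simp add: tail_def)

lemma emeasure_tail: "emeasure \<mu> {1 - 1 / 2 ^ j..<1} = ennreal (tail j)"
  by (simp add: tail_def emeasure_eq_measure)

lemma tail_sets' [simp]: "{1 - 1 / 2 ^ j..<1} \<in> sets \<mu>"
  by (rule tail_sets) simp

lemma dyadic_weight_eq: "dyadic_weight \<mu> \<sigma> j = 2 powr (real j * \<sigma>) * tail j"
  by (simp add: dyadic_weight_def tail_def)

lemma dyadic_weight_nonneg [simp]: "0 \<le> dyadic_weight \<mu> \<sigma> j"
  by (simp add: dyadic_weight_eq)

text \<open>On the pushforward to the Borel sets of the line the integrand is jointly measurable, so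
  that integration in \<open>t\<close> leaves a measurable function of \<theta>. The cutoff
  \<open>{a..}\<close> covers the tail potentials as well.\<close>

lemma borel_measurable_potential:
  "(\<lambda>\<theta>. \<integral>\<^sup>+t. ennreal (1 / norm (1 - of_real t * cis \<theta>) powr \<gamma>) * indicator {a..} t \<partial>\<mu>) \<in> borel_measurable borel"
proof -
  define \<nu> where "\<nu> = distr \<mu> borel (\<lambda>t. t)"
  have id: "(\<lambda>t. t) \<in> borel_measurable \<mu>" by (rule measurable_borel) simp
  interpret \<nu>: finite_measure \<nu>
    unfolding \<nu>_def by (rule finite_measure_distr[OF id])
  have [measurable_cong]: "sets \<nu> = sets borel" by (simp add: \<nu>_def)
  have "(\<integral>\<^sup>+t. ennreal (1 / norm (1 - of_real t * cis \<theta>) powr \<gamma>) * indicator {a..} t \<partial>\<mu>)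
      = (\<integral>\<^sup>+t. ennreal (1 / norm (1 - of_real t * cis \<theta>) powr \<gamma>) * indicator {a..} t \<partial>\<nu>)" for \<theta>
    unfolding \<nu>_def by (subst nn_integral_distr[OF id]) auto
  then show ?thesis by simp
qed

lemma potential_alt:
  "potential \<mu> \<gamma> w = (\<integral>\<^sup>+t. ennreal (1 / norm (1 - of_real t * w) powr \<gamma>) * indicator {0..} t \<partial>\<mu>)"
  unfolding potential_def by (intro nn_integral_cong) (auto simp: space_eq)

lemma potential_measurable [measurable]: "(\<lambda>\<theta>. potential \<mu> \<gamma> (cis \<theta>)) \<in> borel_measurable borel"
  unfolding potential_alt by (rule borel_measurable_potential)

text \<open>The kernel is bounded by a sum of indicators of the nested intervals [a_j, 1) rather
  than of the dyadic pieces, so that the tails m_j appear directly instead of their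
  differences.\<close>

lemma potential_dyadic_bound:
  assumes \<gamma>: "0 < \<gamma>" and x: "1 / 2 ^ i < cmod (1 - w)" and w: "cmod w = 1"
  shows "potential \<mu> \<gamma> w \<le> ennreal (2 powr \<gamma> * (\<Sum>j\<le>i. 2 powr (real j * \<gamma>) * tail j))"
proof -
  have pt: "ennreal (1 / norm (1 - of_real t * w) powr \<gamma>)
      \<le> ennreal (2 powr \<gamma>) * (\<Sum>j\<le>i. ennreal (2 powr (real j * \<gamma>)) * indicator {1 - 1 / 2 ^ j..<1} t)"
    if t: "t \<in> {0..<1}" for t
  proof -
    define N where "N = norm (1 - of_real t * w)"
    have N1: "1 - t \<le> N" and N2: "cmod (1 - w) \<le> 2 * N"
      using norm_one_minus_scaled[OF w, of t 1] t by (auto simp: N_def)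
    \<comment> \<open>Beyond a_i the distance of \<open>w\<close> from 1 gives |1 - tw| \<ge> |1 -
      w|/2 > 2^-i/2; before a_i the dyadic interval containing \<open>t\<close> gives |1 - tw| \<ge>
      1 - t > 2^-j/2.\<close>
    have main: "\<exists>j\<le>i. 1 - 1 / 2 ^ j \<le> t \<and> 1 / (2 * 2 ^ j) \<le> N"
    proof (cases "1 - 1 / 2 ^ i \<le> t")
      case True
      then show ?thesis using N2 x by (intro exI[of _ i]) auto
    next
      case False
      obtain k where k: "1 - 1 / 2 ^ k \<le> t" "t < 1 - 1 / 2 ^ Suc k"
        using t by (auto elim: dyadic_interval)
      have "1 / (2 ^ i :: real) < 1 / 2 ^ k" using k(1) False by linarith
      then have "(2::real) ^ k < 2 ^ i" by (simp add: field_simps)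
      then have "k < i" by simp
      then show ?thesis using k N1 by (intro exI[of _ k]) auto
    qed
    then obtain j where j: "j \<le> i" "1 - 1 / 2 ^ j \<le> t" "1 / (2 * 2 ^ j) \<le> N" by blast
    have "0 < 1 / (2 * 2 ^ j :: real)" by simp
    then have N0: "0 < N" using j(3) by linarith
    have p2: "(2 * 2 ^ j) powr \<gamma> = 2 powr \<gamma> * 2 powr (real j * \<gamma>)"
      by (simp add: powr_mult powr_powr flip: powr_realpow)
    have "1 / N powr \<gamma> \<le> 1 / (1 / (2 * 2 ^ j)) powr \<gamma>"
      using j \<gamma> N0 by (intro divide_left_mono powr_mono2 mult_pos_pos) auto
    also have "\<dots> = (2 * 2 ^ j) powr \<gamma>" by (simp add: powr_divide)
    also note p2
    finally have "ennreal (1 / N powr \<gamma>) \<le> ennreal (2 powr \<gamma>) * ennreal (2 powr (real j * \<gamma>))"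
      by (simp add: ennreal_leI flip: ennreal_mult)
    also have "ennreal (2 powr (real j * \<gamma>)) = ennreal (2 powr (real j * \<gamma>)) * indicator {1 - 1 / 2 ^ j..<1} t"
      using j t by simp
    also have "\<dots> \<le> (\<Sum>j\<le>i. ennreal (2 powr (real j * \<gamma>)) * indicator {1 - 1 / 2 ^ j..<1} t)"
      using j by (intro member_le_sum[where f = "\<lambda>j. ennreal (2 powr (real j * \<gamma>)) * indicator {1 - 1 / 2 ^ j..<1} t"]) auto
    finally show ?thesis by (simp add: N_def mult_left_mono)
  qed
  have "potential \<mu> \<gamma> w \<le> (\<integral>\<^sup>+t. ennreal (2 powr \<gamma>) *
      (\<Sum>j\<le>i. ennreal (2 powr (real j * \<gamma>)) * indicator {1 - 1 / 2 ^ j..<1} t) \<partial>\<mu>)"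
    unfolding potential_def by (intro nn_integral_mono pt) (simp add: space_eq)
  also have "\<dots> = ennreal (2 powr \<gamma>) * (\<Sum>j\<le>i. ennreal (2 powr (real j * \<gamma>)) * ennreal (tail j))"
  proof -
    have m: "(\<lambda>t. ennreal (2 powr (real j * \<gamma>)) * indicator {1 - 1 / 2 ^ j..<1} t) \<in> borel_measurable \<mu>" for j
      by (intro borel_measurable_times_ennreal borel_measurable_indicator) auto
    have "(\<integral>\<^sup>+t. ennreal (2 powr \<gamma>) *
        (\<Sum>j\<le>i. ennreal (2 powr (real j * \<gamma>)) * indicator {1 - 1 / 2 ^ j..<1} t) \<partial>\<mu>)
      = ennreal (2 powr \<gamma>) * (\<integral>\<^sup>+t. (\<Sum>j\<le>i. ennreal (2 powr (real j * \<gamma>)) * indicator {1 - 1 / 2 ^ j..<1} t) \<partial>\<mu>)"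
      by (intro nn_integral_cmult borel_measurable_sum m)
    also have "(\<integral>\<^sup>+t. (\<Sum>j\<le>i. ennreal (2 powr (real j * \<gamma>)) * indicator {1 - 1 / 2 ^ j..<1} t) \<partial>\<mu>)
      = (\<Sum>j\<le>i. \<integral>\<^sup>+t. ennreal (2 powr (real j * \<gamma>)) * indicator {1 - 1 / 2 ^ j..<1} t \<partial>\<mu>)"
      by (rule nn_integral_sum) (rule m)
    also have "\<dots> = (\<Sum>j\<le>i. ennreal (2 powr (real j * \<gamma>)) * ennreal (tail j))"
      by (intro sum.cong refl) (subst nn_integral_cmult_indicator, auto simp: emeasure_tail)
    finally show ?thesis .
  qed
  also have "\<dots> = ennreal (2 powr \<gamma> * (\<Sum>j\<le>i. 2 powr (real j * \<gamma>) * tail j))"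
    by (simp add: ennreal_mult sum_nonneg flip: sum_ennreal)
  finally show ?thesis .
qed

end

lemma unit_measure_iff: "unit_interval_measure \<mu> \<longleftrightarrow> unit_measure \<mu>"
  by (auto simp: unit_interval_measure_def unit_measure_def unit_measure_axioms_def)

text \<open>On the i-th shell the weighted bound 2^(-i/r) H_i is the sum over k \<le> i of
  2^(-(i-k)/r) 2^\<gamma> d_k, since 2^(k\<gamma>) m_k = 2^(k/r) d_k. This is a geometric
  convolution with rate 1/r.\<close>

lemma potential_le_dyadic:
  assumes r: "0 < r" and \<gamma>: "0 < \<gamma>"
  obtains C :: real where "0 < C" "\<And>\<mu>. unit_measure \<mu> \<Longrightarrow>
    potential_int \<mu> \<gamma> r
      \<le> ennreal C * dyadic_sum \<mu> (\<gamma> - 1/r) r"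
proof -
  obtain C0 :: real where C0: "0 < C0"
    "\<And>(x :: nat \<Rightarrow> real) y A. \<lbrakk>\<And>k. 0 \<le> x k; \<And>i. 0 \<le> y i; \<And>i. finite (A i);
        \<And>i. y i \<le> (\<Sum>k\<in>A i. 2 powr (-(1/r) * \<bar>real i - real k\<bar>) * x k)\<rbrakk>
      \<Longrightarrow> (\<Sum>i. ennreal (y i powr r)) \<le> ennreal C0 * (\<Sum>k. ennreal (x k powr r))"
    by (rule geometric_convolution_bound[OF r, of "1/r"]) (use r in simp, blast)
  show ?thesis
  proof (rule that[of "C0 * 2 powr (\<gamma> * r)"])
    show "0 < C0 * 2 powr (\<gamma> * r)" using C0(1) by simp
    fix \<mu> assume "unit_measure \<mu>"
    then interpret unit_measure \<mu> .
    define d where "d = dyadic_weight \<mu> (\<gamma> - 1/r)"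
    define H where "H i = 2 powr \<gamma> * (\<Sum>j\<le>i. 2 powr (real j * \<gamma>) * tail j)" for i
    have H0: "0 \<le> H i" for i unfolding H_def by (intro mult_nonneg_nonneg sum_nonneg) auto
    define y where "y i = 2 powr (- real i / r) * H i" for i
    have "potential_int \<mu> \<gamma> r \<le> (\<Sum>i. ennreal (1 / 2 ^ i) * ennreal (H i powr r))"
    proof (rule shell_integral_bound)
      fix \<theta> :: real and i :: nat assume "1 / 2 ^ i < cmod (1 - cis \<theta>)"
      then have "potential \<mu> \<gamma> (cis \<theta>) \<le> ennreal (H i)"
        unfolding H_def by (intro potential_dyadic_bound \<gamma>) auto
      then have "ennpowr (potential \<mu> \<gamma> (cis \<theta>)) r \<le> ennpowr (ennreal (H i)) r"
        using r by (intro ennpowr_mono) auto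
      then show "ennpowr (potential \<mu> \<gamma> (cis \<theta>)) r \<le> ennreal (H i powr r)" using H0 by simp
    qed
    also have "\<dots> = (\<Sum>i. ennreal (y i powr r))"
    proof (rule suminf_cong)
      fix i
      have "y i powr r = 2 powr (- real i) * H i powr r"
        using r H0 by (simp add: y_def powr_mult powr_powr)
      also have "2 powr (- real i) = 1 / 2 ^ i"
        by (simp add: powr_minus powr_realpow inverse_eq_divide)
      finally show "ennreal (1 / 2 ^ i) * ennreal (H i powr r) = ennreal (y i powr r)"
        by (simp only: ennreal_mult powr_ge_zero zero_le_divide_1_iff zero_le_power zero_le_numeral)
    qed
    also have "\<dots> \<le> ennreal C0 * (\<Sum>k. ennreal ((2 powr \<gamma> * d k) powr r))"
    proof (rule C0(2)[where A = "\<lambda>i. {..i}"])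
      fix i
      have "y i = (\<Sum>j\<le>i. 2 powr (- real i / r) * (2 powr \<gamma> * (2 powr (real j * \<gamma>) * tail j)))"
        by (simp only: y_def H_def sum_distrib_left)
      also have "\<dots> = (\<Sum>k\<le>i. 2 powr (-(1/r) * \<bar>real i - real k\<bar>) * (2 powr \<gamma> * d k))"
      proof (rule sum.cong[OF refl])
        fix k assume "k \<in> {..i}"
        then have "-(1/r) * \<bar>real i - real k\<bar> = - real i / r + real k / r"
          by (simp add: diff_divide_distrib)
        then have e1: "2 powr (-(1/r) * \<bar>real i - real k\<bar>) = 2 powr (- real i / r) * 2 powr (real k / r)"
          by (simp only: powr_add)
        have "real k * (\<gamma> - 1/r) = real k * \<gamma> + - (real k / r)" by (simp add: right_diff_distrib)
        then have e2: "d k = 2 powr (real k * \<gamma>) * 2 powr (- (real k / r)) * tail k"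
          by (simp only: d_def dyadic_weight_eq powr_add)
        have "2 powr (real k / r) * 2 powr (- (real k / r)) = 2 powr (real k / r + - (real k / r))"
          by (simp only: powr_add)
        then have e3: "2 powr (real k / r) * 2 powr (- (real k / r)) = 1" by simp
        have "2 powr (-(1/r) * \<bar>real i - real k\<bar>) * (2 powr \<gamma> * d k)
            = 2 powr (- real i / r) * (2 powr \<gamma> * (2 powr (real k * \<gamma>) * tail k)) *
              (2 powr (real k / r) * 2 powr (- (real k / r)))"
          unfolding e1 e2 by (simp only: mult_ac)
        then show "2 powr (- real i / r) * (2 powr \<gamma> * (2 powr (real k * \<gamma>) * tail k))
            = 2 powr (-(1/r) * \<bar>real i - real k\<bar>) * (2 powr \<gamma> * d k)"
          unfolding e3 by simp
      qed
      finally show "y i \<le> (\<Sum>k\<le>i. 2 powr (-(1/r) * \<bar>real i - real k\<bar>) * (2 powr \<gamma> * d k))"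
        by (rule eq_refl)
    qed (auto simp: d_def y_def H0)
    also have "(\<Sum>k. ennreal ((2 powr \<gamma> * d k) powr r)) = (\<Sum>k. ennreal (2 powr (\<gamma> * r)) * ennreal (d k powr r))"
    proof (rule suminf_cong)
      fix k
      have "(2 powr \<gamma> * d k) powr r = 2 powr (\<gamma> * r) * d k powr r"
        by (simp add: d_def powr_mult powr_powr)
      then show "ennreal ((2 powr \<gamma> * d k) powr r) = ennreal (2 powr (\<gamma> * r)) * ennreal (d k powr r)"
        by (simp only: ennreal_mult powr_ge_zero)
    qed
    also have "\<dots> = ennreal (2 powr (\<gamma> * r)) * (\<Sum>k. ennreal (d k powr r))"
      by (rule ennreal_suminf_cmult)
    also have "ennreal C0 * \<dots> = ennreal (C0 * 2 powr (\<gamma> * r)) * (\<Sum>k. ennreal (d k powr r))"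
      using C0(1) by (simp only: ennreal_mult mult.assoc powr_ge_zero less_imp_le)
    finally show "potential_int \<mu> \<gamma> r
      \<le> ennreal (C0 * 2 powr (\<gamma> * r)) * dyadic_sum \<mu> (\<gamma> - 1/r) r"
      by (simp only: d_def)
  qed
qed

subsection \<open>The integral representation of the operator\<close>

text \<open>The k-th Taylor coefficient of (1 - w)^(-\<gamma>).\<close>

definition kernel_coeff :: "real \<Rightarrow> nat \<Rightarrow> real" where
  "kernel_coeff \<gamma> k = Gamma (real k + \<gamma>) / (Gamma \<gamma> * fact k)"

definition cesaro_coeff :: "real \<Rightarrow> (complex \<Rightarrow> complex) \<Rightarrow> nat \<Rightarrow> complex" where
  "cesaro_coeff \<gamma> f n = (\<Sum>k\<le>n. of_real (kernel_coeff \<gamma> (n - k)) * taylor_coeff f k)"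

text \<open>The generalised binomial series of exponent -\<gamma> at -w: the sign of the binomial
  coefficient cancels that of (-w)^n, and the Pochhammer symbol is a quotient of Gamma
  values.\<close>

lemma kernel_coeff_sums:
  assumes \<gamma>: "0 < \<gamma>" and w: "cmod w < 1"
  shows "(\<lambda>k. of_real (kernel_coeff \<gamma> k) * w ^ k) sums ((1 - w) powr (- of_real \<gamma>))"
proof -
  have "((- of_real \<gamma>) gchoose n) * (- w) ^ n = of_real (kernel_coeff \<gamma> n) * w ^ n" for n
  proof -
    have "((- of_real \<gamma> :: complex) gchoose n) = (-1) ^ n * of_real (pochhammer \<gamma> n) / fact n"
      by (simp add: gbinomial_pochhammer pochhammer_of_real)
    also have "pochhammer \<gamma> n = Gamma (real n + \<gamma>) / Gamma \<gamma>"
      using \<gamma> by (subst pochhammer_Gamma) (auto simp: add.commute elim!: nonpos_Ints_cases)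
    finally have "((- of_real \<gamma> :: complex) gchoose n) = (-1) ^ n * of_real (kernel_coeff \<gamma> n)"
      by (simp add: kernel_coeff_def)
    moreover have "(- w) ^ n = (-1) ^ n * w ^ n" by (rule power_minus)
    moreover have "((-1) ^ n * (-1) ^ n :: complex) = 1" by (simp flip: power_mult_distrib)
    ultimately show ?thesis by (metis (no_types, lifting) mult.assoc mult.commute mult_1)
  qed
  moreover have "(\<lambda>n. ((- of_real \<gamma>) gchoose n) * (- w) ^ n) sums (1 + (- w)) powr (- of_real \<gamma>)"
    by (rule gen_binomial_complex) (simp add: w)
  ultimately show ?thesis by simp
qed

lemma powser_sums_ball_abs_summable:
  fixes a :: "nat \<Rightarrow> complex"
  assumes s: "\<And>w. cmod w < 1 \<Longrightarrow> (\<lambda>k. a k * w ^ k) sums g w" and w: "cmod w < 1"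
  shows "summable (\<lambda>k. cmod (a k * w ^ k))"
proof -
  obtain x where x: "cmod w < x" "x < 1" using dense[OF w] by blast
  then have "0 < x" using norm_ge_zero[of w] by linarith
  then have "summable (\<lambda>k. a k * of_real x ^ k)"
    using s[of "of_real x"] x by (auto simp: sums_iff)
  then show ?thesis using powser_insidea[of a "of_real x" w] x \<open>0 < x\<close> by simp
qed

text \<open>The inner sums of the operator are the Cauchy product of the series of f and of (1 -
  w)^(-\<gamma>).\<close>

lemma cesaro_coeff_sums:
  assumes f: "f holomorphic_on ball 0 1" and \<gamma>: "0 < \<gamma>" and w: "cmod w < 1"
  shows "(\<lambda>n. cesaro_coeff \<gamma> f n * w ^ n) sums (f w * (1 - w) powr (- of_real \<gamma>))"
proof -
  have fs: "(\<lambda>k. taylor_coeff f k * w ^ k) sums f w" if "cmod w < 1" for w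
    using holomorphic_power_series[OF f, of w] that by (simp add: taylor_coeff_def)
  note sa = powser_sums_ball_abs_summable[OF fs w]
  note sb = powser_sums_ball_abs_summable[OF kernel_coeff_sums[OF \<gamma>] w]
  have "(\<lambda>n. \<Sum>i\<le>n. (taylor_coeff f i * w ^ i) * (of_real (kernel_coeff \<gamma> (n - i)) * w ^ (n - i)))
      sums ((\<Sum>k. taylor_coeff f k * w ^ k) * (\<Sum>k. of_real (kernel_coeff \<gamma> k) * w ^ k))"
    by (rule Cauchy_product_sums[OF sa sb])
  also have "(\<Sum>k. taylor_coeff f k * w ^ k) = f w" using fs[OF w] by (simp add: sums_iff)
  also have "(\<Sum>k. of_real (kernel_coeff \<gamma> k) * w ^ k) = (1 - w) powr (- of_real \<gamma>)"
    using kernel_coeff_sums[OF \<gamma> w] by (simp add: sums_iff)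
  also have "(\<lambda>n. \<Sum>i\<le>n. (taylor_coeff f i * w ^ i) * (of_real (kernel_coeff \<gamma> (n - i)) * w ^ (n - i)))
      = (\<lambda>n. cesaro_coeff \<gamma> f n * w ^ n)"
  proof
    fix n
    have "(taylor_coeff f i * w ^ i) * (of_real (kernel_coeff \<gamma> (n - i)) * w ^ (n - i))
        = (of_real (kernel_coeff \<gamma> (n - i)) * taylor_coeff f i) * w ^ n" if "i \<le> n" for i
    proof -
      have "w ^ i * w ^ (n - i) = w ^ n" using that by (simp flip: power_add)
      then show ?thesis by (metis (no_types, lifting) mult.assoc mult.commute)
    qed
    then show "(\<Sum>i\<le>n. (taylor_coeff f i * w ^ i) * (of_real (kernel_coeff \<gamma> (n - i)) * w ^ (n - i)))
        = cesaro_coeff \<gamma> f n * w ^ n"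
      unfolding cesaro_coeff_def sum_distrib_right by (intro sum.cong refl) (simp only: atMost_iff)
  qed
  finally show ?thesis .
qed

context unit_measure begin

lemma integrable_bounded:
  fixes g :: "real \<Rightarrow> 'a :: {banach, second_countable_topology}"
  assumes "g \<in> borel_measurable \<mu>" "\<And>t. 0 \<le> t \<Longrightarrow> t < 1 \<Longrightarrow> norm (g t) \<le> B"
  shows "integrable \<mu> g"
  by (rule integrable_const_bound[of _ B]) (use assms in \<open>auto intro!: AE_I2 simp: space_eq\<close>)

text \<open>Termwise integration: for \<open>t\<close> in [0,1) the n-th term is at most |b_n z^n|,
  independently of \<open>t\<close>, and these bounds are summable since |z| < 1. All three
  conclusions come from this one exchange of sum and integral.\<close>

lemma
  assumes f: "f holomorphic_on ball 0 1" and \<gamma>: "0 < \<gamma>" and z: "cmod z < 1"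
  shows cesaro_sums: "(\<lambda>n. of_real (moment \<mu> n) * cesaro_coeff \<gamma> f n * z ^ n) sums cesaro \<mu> \<gamma> f z"
    and cesaro_integrable: "integrable \<mu> (\<lambda>t. f (of_real t * z) * (1 - of_real t * z) powr (- of_real \<gamma>))"
    and cesaro_integral: "cesaro \<mu> \<gamma> f z = (LINT t|\<mu>. f (of_real t * z) * (1 - of_real t * z) powr (- of_real \<gamma>))"
proof -
  define b where "b = cesaro_coeff \<gamma> f"
  define g where "g n t = b n * (of_real t * z) ^ n" for n and t :: real
  have bs: "(\<lambda>n. b n * w ^ n) sums (f w * (1 - w) powr (- of_real \<gamma>))" if "cmod w < 1" for w
    unfolding b_def by (rule cesaro_coeff_sums[OF f \<gamma> that])
  have tz: "cmod (of_real t * z) < 1" if "0 \<le> t" "t < 1" for t :: real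
    using that z mult_left_le_one_le[of "cmod z" t] by (simp add: norm_mult)
  have sz: "summable (\<lambda>n. cmod (b n * z ^ n))"
    by (rule powser_sums_ball_abs_summable[OF bs z])
  have gm: "g n \<in> borel_measurable \<mu>" for n
    unfolding g_def by (intro measurable_borel) measurable
  have gb: "norm (g n t) \<le> cmod (b n * z ^ n)" if "0 \<le> t" "t < 1" for n t
    using that by (simp add: g_def norm_mult norm_power power_mult_distrib power_le_one mult_left_le_one_le mult_left_mono)
  have gi: "integrable \<mu> (g n)" for n
    using gm gb by (rule integrable_bounded)
  have as: "AE t in \<mu>. summable (\<lambda>n. norm (g n t))"
    using gb by (intro AE_I2 summable_comparison_test'[OF sz]) (auto simp: space_eq)
  have si: "summable (\<lambda>n. LINT t|\<mu>. norm (g n t))"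
  proof (rule summable_comparison_test')
    show "summable (\<lambda>n. measure \<mu> (space \<mu>) * cmod (b n * z ^ n))" by (intro summable_mult sz)
    fix n
    have "(LINT t|\<mu>. norm (g n t)) \<le> (LINT t|\<mu>. cmod (b n * z ^ n))"
      using gb gi by (intro integral_mono) (auto simp: space_eq)
    then show "norm (LINT t|\<mu>. norm (g n t)) \<le> measure \<mu> (space \<mu>) * cmod (b n * z ^ n)"
      by simp
  qed
  have eq: "(\<Sum>n. g n t) = f (of_real t * z) * (1 - of_real t * z) powr (- of_real \<gamma>)" if "0 \<le> t" "t < 1" for t
    using bs[OF tz[OF that]] by (simp add: g_def sums_iff)
  have "integrable \<mu> (\<lambda>t. \<Sum>n. g n t)" by (rule integrable_suminf[OF gi as si])
  then show "integrable \<mu> (\<lambda>t. f (of_real t * z) * (1 - of_real t * z) powr (- of_real \<gamma>))"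
    using eq by (subst Bochner_Integration.integrable_cong[OF refl, of _ _ "\<lambda>t. \<Sum>n. g n t"]) (auto simp: space_eq)
  have "(\<lambda>n. integral\<^sup>L \<mu> (g n)) sums (LINT t|\<mu>. (\<Sum>n. g n t))" by (rule sums_integral[OF gi as si])
  moreover have "integral\<^sup>L \<mu> (g n) = of_real (moment \<mu> n) * b n * z ^ n" for n
  proof -
    have "integral\<^sup>L \<mu> (g n) = (LINT t|\<mu>. (b n * z ^ n) * complex_of_real (t ^ n))"
      unfolding g_def by (intro Bochner_Integration.integral_cong refl) (simp add: power_mult_distrib mult_ac)
    also have "\<dots> = (b n * z ^ n) * (LINT t|\<mu>. complex_of_real (t ^ n))"
      by (rule integral_mult_right_zero)
    also have "(LINT t|\<mu>. complex_of_real (t ^ n)) = of_real (moment \<mu> n)"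
      unfolding moment_def by (rule integral_complex_of_real)
    finally show ?thesis by (simp add: mult_ac)
  qed
  moreover have "(LINT t|\<mu>. (\<Sum>n. g n t)) = (LINT t|\<mu>. f (of_real t * z) * (1 - of_real t * z) powr (- of_real \<gamma>))"
    by (rule Bochner_Integration.integral_cong) (auto simp: eq space_eq)
  ultimately have *: "(\<lambda>n. of_real (moment \<mu> n) * b n * z ^ n) sums
      (LINT t|\<mu>. f (of_real t * z) * (1 - of_real t * z) powr (- of_real \<gamma>))" by simp
  have "cesaro \<mu> \<gamma> f z = (\<Sum>n. of_real (moment \<mu> n) * b n * z ^ n)"
    by (simp add: cesaro_def b_def cesaro_coeff_def kernel_coeff_def)
  with * show "(\<lambda>n. of_real (moment \<mu> n) * cesaro_coeff \<gamma> f n * z ^ n) sums cesaro \<mu> \<gamma> f z"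
    and "cesaro \<mu> \<gamma> f z = (LINT t|\<mu>. f (of_real t * z) * (1 - of_real t * z) powr (- of_real \<gamma>))"
    by (simp_all add: sums_iff b_def)
qed

lemma cesaro_holomorphic:
  assumes f: "f holomorphic_on ball 0 1" and \<gamma>: "0 < \<gamma>"
  shows "cesaro \<mu> \<gamma> f holomorphic_on ball 0 1"
  by (rule power_series_holomorphic[where a = "\<lambda>n. of_real (moment \<mu> n) * cesaro_coeff \<gamma> f n"])
     (use cesaro_sums[OF assms] in auto)

end

section \<open>Pointwise upper and lower bounds for the operator\<close>

context unit_measure begin

text \<open>The boundary potential of the part of \<mu> beyond \<open>a\<close>: a = 0 gives the
  whole potential, and \<open>a\<close> tending to 1 gives the small remainder used for
  compactness.\<close>

definition tail_potential :: "real \<Rightarrow> real \<Rightarrow> real \<Rightarrow> ennreal" where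
  "tail_potential \<gamma> a \<theta> =
     (\<integral>\<^sup>+t. ennreal (1 / norm (1 - of_real t * cis \<theta>) powr \<gamma>) * indicator {a..} t \<partial>\<mu>)"

lemma tail_potential_measurable [measurable]: "tail_potential \<gamma> a \<in> borel_measurable borel"
  unfolding tail_potential_def by (rule borel_measurable_potential)

lemma tail_potential_0: "tail_potential \<gamma> 0 \<theta> = potential \<mu> \<gamma> (cis \<theta>)"
  by (simp add: tail_potential_def potential_alt)

lemma emeasure_space_tail: "emeasure \<mu> (space \<mu>) = ennreal (tail 0)"
  using emeasure_tail[of 0] by (simp add: space_eq)

text \<open>The integral over \<mu> is split at \<open>a\<close>. Below \<open>a\<close> the
  function is at most \<open>S\<close> and the kernel at most (1-a)^(-\<gamma>); above
  \<open>a\<close> the function is at most the radial maximal function and the kernel at most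
  2^\<gamma> times its value on the circle. With a = S = 0 only the second part remains.\<close>

lemma norm_cesaro_le:
  assumes f: "f holomorphic_on ball 0 1" and \<gamma>: "0 < \<gamma>" and \<rho>: "0 \<le> \<rho>" "\<rho> < 1"
    and a: "0 \<le> a" "a < 1" and S: "0 \<le> S" "\<And>z. cmod z < a \<Longrightarrow> cmod (f z) \<le> S"
  shows "ennreal (cmod (cesaro \<mu> \<gamma> f (of_real \<rho> * cis \<theta>)))
    \<le> ennreal (S / (1 - a) powr \<gamma> * tail 0)
      + ennreal (2 powr \<gamma>) * (radial_max (dilate \<rho> f) \<theta> * tail_potential \<gamma> a \<theta>)"
proof -
  define z where "z = complex_of_real \<rho> * cis \<theta>"
  have z: "cmod z < 1" using \<rho> by (simp add: z_def norm_mult)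
  define M where "M = radial_max (dilate \<rho> f) \<theta>"
  define k where "k t = ennreal (1 / norm (1 - of_real t * cis \<theta>) powr \<gamma>)" for t :: real
  have pt: "ennreal (cmod (f (of_real t * z) * (1 - of_real t * z) powr (- of_real \<gamma>)))
      \<le> ennreal (S / (1 - a) powr \<gamma>) + ennreal (2 powr \<gamma>) * M * (k t * indicator {a..} t)" if t: "0 \<le> t" "t < 1" for t
  proof -
    have n: "cmod ((1 - of_real t * z) powr (- of_real \<gamma>)) = 1 / cmod (1 - of_real t * z) powr \<gamma>"
      by (subst norm_powr_real_powr') (auto simp: powr_minus inverse_eq_divide)
    have tr: "t * \<rho> \<le> t" using t \<rho> by (simp add: mult_left_le)
    have low: "1 - t \<le> cmod (1 - of_real t * z)"
      using norm_triangle_ineq2[of 1 "of_real t * z"] t tr \<rho> by (simp add: norm_mult z_def)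
    then have low0: "0 < cmod (1 - of_real t * z)" using t by linarith
    show ?thesis
    proof (cases "a \<le> t")
      case True
      have d: "cmod (1 - of_real t * cis \<theta>) \<le> 2 * cmod (1 - of_real t * z)"
        using norm_one_minus_scaled(2)[of "cis \<theta>" "t * \<rho>" t] t \<rho> tr by (simp add: z_def mult.assoc)
      have "1 - t \<le> cmod (1 - of_real t * cis \<theta>)"
        using norm_one_minus_scaled(1)[of "cis \<theta>" t t] t by simp
      then have pos: "0 < cmod (1 - of_real t * cis \<theta>)" using t by linarith
      have "1 / cmod (1 - of_real t * z) powr \<gamma> \<le> 1 / (cmod (1 - of_real t * cis \<theta>) / 2) powr \<gamma>"
        using d pos low0 \<gamma> by (intro divide_left_mono powr_mono2 mult_pos_pos) auto
      also have "\<dots> = 2 powr \<gamma> * (1 / cmod (1 - of_real t * cis \<theta>) powr \<gamma>)"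
        by (simp add: powr_divide)
      finally have "ennreal (1 / cmod (1 - of_real t * z) powr \<gamma>) \<le> ennreal (2 powr \<gamma>) * k t"
        unfolding k_def by (simp add: ennreal_leI flip: ennreal_mult)
      moreover have "ennreal (cmod (f (of_real t * z))) \<le> M"
        unfolding M_def using radial_max_upper[of t "\<lambda>z. f (of_real \<rho> * z)" \<theta>] t by (simp add: z_def mult_ac)
      ultimately have "ennreal (cmod (f (of_real t * z))) * ennreal (1 / cmod (1 - of_real t * z) powr \<gamma>)
          \<le> M * (ennreal (2 powr \<gamma>) * k t)"
        by (intro mult_mono) auto
      also have "ennreal (cmod (f (of_real t * z))) * ennreal (1 / cmod (1 - of_real t * z) powr \<gamma>)
          = ennreal (cmod (f (of_real t * z) * (1 - of_real t * z) powr (- of_real \<gamma>)))"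
        unfolding norm_mult n by (rule ennreal_mult[symmetric]) simp_all
      also have "M * (ennreal (2 powr \<gamma>) * k t) = ennreal (2 powr \<gamma>) * M * (k t * indicator {a..} t)"
        using True by (simp add: mult_ac)
      finally show ?thesis by (rule order_trans) simp
    next
      case False
      have "cmod (of_real t * z) < a" using False tr t \<rho> by (simp add: norm_mult z_def)
      then have "cmod (f (of_real t * z)) \<le> S" by (rule S)
      moreover have "1 / cmod (1 - of_real t * z) powr \<gamma> \<le> 1 / (1 - a) powr \<gamma>"
        using low low0 False a t \<gamma> by (intro divide_left_mono powr_mono2 mult_pos_pos) auto
      ultimately have "cmod (f (of_real t * z)) * (1 / cmod (1 - of_real t * z) powr \<gamma>) \<le> S * (1 / (1 - a) powr \<gamma>)"
        using S by (intro mult_mono) auto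
      then have "ennreal (cmod (f (of_real t * z) * (1 - of_real t * z) powr (- of_real \<gamma>))) \<le> ennreal (S / (1 - a) powr \<gamma>)"
        by (simp add: norm_mult n ennreal_leI)
      then show ?thesis by (rule order_trans) simp
    qed
  qed
  have km: "(\<lambda>t. k t * indicator {a..} t) \<in> borel_measurable \<mu>"
    unfolding k_def by (intro measurable_borel) measurable
  have "ennreal (cmod (cesaro \<mu> \<gamma> f z))
      \<le> (\<integral>\<^sup>+t. ennreal (cmod (f (of_real t * z) * (1 - of_real t * z) powr (- of_real \<gamma>))) \<partial>\<mu>)"
    unfolding cesaro_integral[OF f \<gamma> z] by (rule integral_norm_bound_ennreal[OF cesaro_integrable[OF f \<gamma> z]])
  also have "\<dots> \<le> (\<integral>\<^sup>+t. ennreal (S / (1 - a) powr \<gamma>) + ennreal (2 powr \<gamma>) * M * (k t * indicator {a..} t) \<partial>\<mu>)"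
    by (intro nn_integral_mono pt) (auto simp: space_eq)
  also have "\<dots> = (\<integral>\<^sup>+t. ennreal (S / (1 - a) powr \<gamma>) \<partial>\<mu>) + (\<integral>\<^sup>+t. ennreal (2 powr \<gamma>) * M * (k t * indicator {a..} t) \<partial>\<mu>)"
    by (intro nn_integral_add borel_measurable_const borel_measurable_times_ennreal km)
  also have "(\<integral>\<^sup>+t. ennreal (S / (1 - a) powr \<gamma>) \<partial>\<mu>) = ennreal (S / (1 - a) powr \<gamma> * tail 0)"
    using S a by (simp add: emeasure_space_tail flip: ennreal_mult)
  also have "(\<integral>\<^sup>+t. ennreal (2 powr \<gamma>) * M * (k t * indicator {a..} t) \<partial>\<mu>) = ennreal (2 powr \<gamma>) * M * tail_potential \<gamma> a \<theta>"
    unfolding tail_potential_def k_def[symmetric] by (intro nn_integral_cmult km)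
  finally show ?thesis by (simp add: z_def M_def mult.assoc)
qed

text \<open>On the radius the integrand is nonnegative, so the integral may be cut down to t \<ge>
  x, where 1 - tx \<le> 1 - x^2 \<le> 2(1 - x).\<close>

lemma cesaro_radial_lower:
  assumes f: "f holomorphic_on ball 0 1" and \<gamma>: "0 < \<gamma>"
    and \<phi>: "\<And>x. 0 \<le> x \<Longrightarrow> x < 1 \<Longrightarrow> f (of_real x) = of_real (\<phi> x)" "\<And>x. 0 \<le> x \<Longrightarrow> x < 1 \<Longrightarrow> 0 \<le> \<phi> x"
    and x: "0 \<le> x" "x < 1" and c: "0 \<le> c" "\<And>t. x \<le> t \<Longrightarrow> t < 1 \<Longrightarrow> c \<le> \<phi> (t * x)"
  shows "c * (2 * (1 - x)) powr (- \<gamma>) * measure \<mu> {x..<1} \<le> cmod (cesaro \<mu> \<gamma> f (of_real x))"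
proof -
  define g where "g t = \<phi> (t * x) * (1 - t * x) powr (- \<gamma>)" for t
  have nx: "cmod (of_real x) < 1" using x by simp
  have tx: "0 \<le> t * x" "t * x < 1" if "0 \<le> t" "t < 1" for t
    using that x mult_left_le_one_le[of x t] by auto
  have eq: "f (of_real t * of_real x) * (1 - of_real t * of_real x) powr (- of_real \<gamma>) = of_real (g t)"
    if "0 \<le> t" "t < 1" for t
  proof -
    have "(1 - complex_of_real t * of_real x) powr (- of_real \<gamma>) = of_real (1 - t * x) powr (of_real (- \<gamma>))" by simp
    also have "\<dots> = of_real ((1 - t * x) powr (- \<gamma>))"
      using tx[OF that] by (intro powr_of_real) simp
    moreover have "f (of_real t * of_real x) = of_real (\<phi> (t * x))"
      using \<phi>(1)[OF tx[OF that]] by simp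
    ultimately show ?thesis by (simp add: g_def)
  qed
  have "integrable \<mu> (\<lambda>t. complex_of_real (g t))"
    using cesaro_integrable[OF f \<gamma> nx]
    by (subst (asm) Bochner_Integration.integrable_cong[OF refl, of _ _ "\<lambda>t. complex_of_real (g t)"]) (auto simp: eq space_eq)
  from integrable_Re[OF this] have gi: "integrable \<mu> g" by simp
  have "cesaro \<mu> \<gamma> f (of_real x) = (LINT t|\<mu>. complex_of_real (g t))"
    unfolding cesaro_integral[OF f \<gamma> nx] by (intro Bochner_Integration.integral_cong) (auto simp: eq space_eq)
  then have ce: "cesaro \<mu> \<gamma> f (of_real x) = of_real (integral\<^sup>L \<mu> g)" by simp
  have "c * (2 * (1 - x)) powr (- \<gamma>) * measure \<mu> {x..<1}
      = (LINT t|\<mu>. c * (2 * (1 - x)) powr (- \<gamma>) * indicator {x..<1} t)"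
    using x tail_sets[OF x(1)] by (simp add: space_eq Int_absorb2)
  also have "\<dots> \<le> integral\<^sup>L \<mu> g"
  proof (rule integral_mono[OF _ gi])
    show "integrable \<mu> (\<lambda>t. c * (2 * (1 - x)) powr (- \<gamma>) * indicator {x..<1} t)"
      using tail_sets[OF x(1)] by (intro integrable_mult_right) (auto simp: emeasure_eq_measure)
    fix t assume "t \<in> space \<mu>"
    then have t: "0 \<le> t" "t < 1" by (auto simp: space_eq)
    show "c * (2 * (1 - x)) powr (- \<gamma>) * indicator {x..<1} t \<le> g t"
    proof (cases "x \<le> t")
      case True
      have "x * x \<le> t * x" using True x by (intro mult_right_mono)
      moreover have "0 \<le> (1 - x) * (1 - x)" by simp
      ultimately have "1 - t * x \<le> 2 * (1 - x)" by (simp add: algebra_simps)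
      then have "(2 * (1 - x)) powr (- \<gamma>) \<le> (1 - t * x) powr (- \<gamma>)"
        using tx[OF t] \<gamma> by (intro powr_mono2') auto
      then show ?thesis unfolding g_def using True t c(1) c(2)[of t] by (auto intro!: mult_mono)
    next
      case False
      then show ?thesis using \<phi>(2)[OF tx[OF t]] by (simp add: g_def)
    qed
  qed
  also have "\<dots> \<le> cmod (cesaro \<mu> \<gamma> f (of_real x))" unfolding ce by simp
  finally show ?thesis .
qed

lemma cesaro_dyadic_lower:
  assumes f: "f holomorphic_on ball 0 1" and \<gamma>: "0 < \<gamma>"
    and \<phi>: "\<And>x. 0 \<le> x \<Longrightarrow> x < 1 \<Longrightarrow> f (of_real x) = of_real (\<phi> x)" "\<And>x. 0 \<le> x \<Longrightarrow> x < 1 \<Longrightarrow> 0 \<le> \<phi> x"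
    and c: "0 \<le> c" "\<And>t. 1 - 2 powr - real j \<le> t \<Longrightarrow> t < 1 \<Longrightarrow> c \<le> \<phi> (t * (1 - 2 powr - real j))"
  shows "c * 2 powr (- \<gamma>) * 2 powr (real j * \<gamma>) * tail j \<le> cmod (cesaro \<mu> \<gamma> f (of_real (1 - 2 powr - real j)))"
proof -
  define x where "x = 1 - 2 powr - real j"
  have x: "0 \<le> x" "x < 1" unfolding x_def using powr_mono[of "- real j" 0 2] by auto
  have "(2 * (1 - x)) powr (- \<gamma>) = 2 powr (- \<gamma>) * 2 powr (real j * \<gamma>)"
    by (simp add: x_def powr_mult powr_powr)
  moreover have "measure \<mu> {x..<1} = tail j"
    by (simp add: x_def tail_def powr_minus powr_realpow inverse_eq_divide)
  ultimately show ?thesis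
    using cesaro_radial_lower[OF f \<gamma> \<phi> x c(1)] c(2) by (simp add: x_def mult.assoc)
qed

lemma F_fun_holomorphic: "0 < \<gamma> \<Longrightarrow> F_fun \<mu> \<gamma> holomorphic_on ball 0 1"
  unfolding F_fun_def by (intro cesaro_holomorphic holomorphic_intros)

lemma hardy_int_F_le:
  assumes \<gamma>: "0 < \<gamma>" and r: "0 < r"
  shows "hardy_int r (F_fun \<mu> \<gamma>) \<le> ennreal (2 powr (\<gamma> * r)) * potential_int \<mu> \<gamma> r"
  unfolding hardy_int_def
proof (rule SUP_least)
  fix \<rho> :: real assume "\<rho> \<in> {0..<1}"
  then have \<rho>: "0 \<le> \<rho>" "\<rho> < 1" by auto
  have "ennreal (cmod (F_fun \<mu> \<gamma> (of_real \<rho> * cis \<theta>)) powr r) \<le> ennreal (2 powr (\<gamma> * r)) * ennpowr (potential \<mu> \<gamma> (cis \<theta>)) r" for \<theta>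
  proof -
    \<comment> \<open>The radial maximal function of the constant 1 is 1, and a = S = 0 leaves the
      full potential.\<close>
    have "ennreal (cmod (F_fun \<mu> \<gamma> (of_real \<rho> * cis \<theta>))) \<le> ennreal (2 powr \<gamma>) * potential \<mu> \<gamma> (cis \<theta>)"
      using norm_cesaro_le[of "\<lambda>_. 1" \<gamma> \<rho> 0 0 \<theta>] \<gamma> \<rho>
      by (simp add: F_fun_def radial_max_def tail_potential_0)
    then have "ennpowr (ennreal (cmod (F_fun \<mu> \<gamma> (of_real \<rho> * cis \<theta>)))) r \<le> ennpowr (ennreal (2 powr \<gamma>) * potential \<mu> \<gamma> (cis \<theta>)) r"
      using r by (intro ennpowr_mono) auto
    then show ?thesis by (simp add: ennpowr_mult powr_powr)
  qed
  then have "slice_int r (F_fun \<mu> \<gamma>) \<rho>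
      \<le> (\<integral>\<^sup>+\<theta>. ennreal (2 powr (\<gamma> * r)) * ennpowr (potential \<mu> \<gamma> (cis \<theta>)) r \<partial>arc)"
    by (rule nn_integral_mono)
  also have "\<dots> = ennreal (2 powr (\<gamma> * r)) * potential_int \<mu> \<gamma> r"
    by (rule nn_integral_cmult) measurable
  finally show "slice_int r (F_fun \<mu> \<gamma>) \<rho> \<le> \<dots>" .
qed

lemma dyadic_le_hardy_int_F:
  assumes \<gamma>: "0 < \<gamma>" and r: "0 < r"
  shows "dyadic_sum \<mu> (\<gamma> - 1/r) r
    \<le> ennreal (2 powr (\<gamma> * r) * (1327104 * pi)) * hardy_int r (F_fun \<mu> \<gamma>)"
proof -
  have "dyadic_sum \<mu> (\<gamma> - 1/r) r
    \<le> (\<Sum>j. ennreal (2 powr (\<gamma> * r)) * ennreal (2 powr - real j * cmod (F_fun \<mu> \<gamma> (of_real (1 - 2 powr - real j))) powr r))"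
  proof (intro suminf_le allI summableI)
    fix j
    have "1 * 2 powr (- \<gamma>) * 2 powr (real j * \<gamma>) * tail j \<le> cmod (F_fun \<mu> \<gamma> (of_real (1 - 2 powr - real j)))"
      unfolding F_fun_def by (rule cesaro_dyadic_lower[where \<phi> = "\<lambda>_. 1"]) (use \<gamma> in auto)
    then have "(2 powr (- \<gamma>) * 2 powr (real j * \<gamma>) * tail j) powr r \<le> cmod (F_fun \<mu> \<gamma> (of_real (1 - 2 powr - real j))) powr r"
      using r by (intro powr_mono2) auto
    then have "2 powr (\<gamma> * r) * (2 powr - real j * (2 powr (- \<gamma>) * 2 powr (real j * \<gamma>) * tail j) powr r)
        \<le> 2 powr (\<gamma> * r) * (2 powr - real j * cmod (F_fun \<mu> \<gamma> (of_real (1 - 2 powr - real j))) powr r)"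
      by (intro mult_left_mono) auto
    also have "2 powr (\<gamma> * r) * (2 powr - real j * (2 powr (- \<gamma>) * 2 powr (real j * \<gamma>) * tail j) powr r)
        = (2 powr (\<gamma> * r) * 2 powr - real j * 2 powr (- \<gamma> * r) * 2 powr (real j * \<gamma> * r)) * tail j powr r"
      by (simp only: powr_mult powr_powr mult_ac)
    also have "2 powr (\<gamma> * r) * 2 powr - real j * 2 powr (- \<gamma> * r) * 2 powr (real j * \<gamma> * r)
        = 2 powr (real j * (\<gamma> - 1/r) * r)"
      unfolding powr_add[symmetric] using r by (simp add: algebra_simps)
    also have "\<dots> * tail j powr r = dyadic_weight \<mu> (\<gamma> - 1/r) j powr r"
      by (simp add: dyadic_weight_eq powr_mult powr_powr)
    finally show "ennreal (dyadic_weight \<mu> (\<gamma> - 1/r) j powr r) \<le>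
        ennreal (2 powr (\<gamma> * r)) * ennreal (2 powr - real j * cmod (F_fun \<mu> \<gamma> (of_real (1 - 2 powr - real j))) powr r)"
      by (simp add: ennreal_leI flip: ennreal_mult)
  qed
  also have "\<dots> = ennreal (2 powr (\<gamma> * r)) * (\<Sum>j. ennreal (2 powr - real j * cmod (F_fun \<mu> \<gamma> (of_real (1 - 2 powr - real j))) powr r))"
    by (rule ennreal_suminf_cmult)
  also have "\<dots> \<le> ennreal (2 powr (\<gamma> * r)) * (ennreal (1327104 * pi) * hardy_int r (F_fun \<mu> \<gamma>))"
    by (intro mult_left_mono radial_dyadic_embedding F_fun_holomorphic \<gamma> r) simp
  also have "\<dots> = ennreal (2 powr (\<gamma> * r) * (1327104 * pi)) * hardy_int r (F_fun \<mu> \<gamma>)"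
    by (simp add: ennreal_mult mult.assoc)
  finally show ?thesis .
qed

end

subsection \<open>Test functions\<close>

text \<open>Each summand is a peak at the point 1, of height x_k and width about 2^-k, with decay of
  order \<open>N\<close> away from it. An integer power needs no branch of the logarithm.\<close>

definition test_fun :: "nat \<Rightarrow> (nat \<Rightarrow> real) \<Rightarrow> nat \<Rightarrow> complex \<Rightarrow> complex" where
  "test_fun N x K z = (\<Sum>k\<le>K. of_real (x k) * (of_real (2 powr - real k) / (1 - of_real (1 - 2 powr - real k) * z)) ^ N)"

lemma dyadic_radius: "0 \<le> 1 - 2 powr - real k" "1 - 2 powr - real k < 1"
  using powr_mono[of "- real k" 0 2] by auto

lemma test_fun_holomorphic: "test_fun N x K holomorphic_on ball 0 1"
proof -
  have "1 - of_real (1 - 2 powr - real k) * z \<noteq> 0" if "z \<in> ball 0 1" for k and z :: complex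
  proof
    assume "1 - of_real (1 - 2 powr - real k) * z = 0"
    then have "1 = cmod (of_real (1 - 2 powr - real k) * z)" by simp
    also have "\<dots> = (1 - 2 powr - real k) * cmod z"
      using dyadic_radius[of k] by (simp add: norm_mult del: of_real_diff)
    also have "\<dots> \<le> cmod z" using dyadic_radius[of k] by (intro mult_left_le_one_le) auto
    finally show False using that by simp
  qed
  then show ?thesis unfolding test_fun_def by (intro holomorphic_intros) auto
qed

lemma test_fun_real:
  "test_fun N x K (of_real t) = of_real (\<Sum>k\<le>K. x k * (2 powr - real k / (1 - (1 - 2 powr - real k) * t)) ^ N)"
  by (simp add: test_fun_def)

text \<open>On the i-th shell the k-th peak is at most 2^N x_k, with a further factor 2^(-N(k-i))
  when k > i. Relative to the weights 2^(-i/p) and 2^(-k/p) this decays like 2^(-|i-k|/p) on one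
  side and like 2^(-(N-1/p)|i-k|) on the other, hence the condition on \<open>N\<close>.\<close>

lemma test_fun_hardy_int:
  assumes p: "0 < p" and N: "1 / p < real N"
  obtains C :: real where "0 < C" "\<And>x K. (\<And>k. 0 \<le> x k) \<Longrightarrow>
    hardy_int p (test_fun N x K) \<le> ennreal (C * (\<Sum>k\<le>K. 2 powr - real k * x k powr p))"
proof -
  \<comment> \<open>The smaller of the two decay rates on either side of the diagonal i = k.\<close>
  define \<delta> where "\<delta> = min (1/p) (real N - 1/p)"
  have \<delta>: "0 < \<delta>" "\<delta> \<le> 1/p" "\<delta> \<le> real N - 1/p" using p N by (auto simp: \<delta>_def)
  obtain C0 :: real where C0: "0 < C0"
    "\<And>(x :: nat \<Rightarrow> real) y A. \<lbrakk>\<And>k. 0 \<le> x k; \<And>i. 0 \<le> y i; \<And>i. finite (A i);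
        \<And>i. y i \<le> (\<Sum>k\<in>A i. 2 powr (-\<delta> * \<bar>real i - real k\<bar>) * x k)\<rbrakk>
      \<Longrightarrow> (\<Sum>i. ennreal (y i powr p)) \<le> ennreal C0 * (\<Sum>k. ennreal (x k powr p))"
    by (rule geometric_convolution_bound[OF p \<delta>(1)]) blast
  show ?thesis
  proof (rule that[of "C0 * (2 ^ N) powr p"])
    show "0 < C0 * (2 ^ N) powr p" using C0(1) by simp
    fix x :: "nat \<Rightarrow> real" and K assume x: "\<And>k. 0 \<le> x k"
    define h where "h i k = 2 powr (- real N * max 0 (real k - real i))" for i k
    define H where "H i = 2 ^ N * (\<Sum>k\<le>K. x k * h i k)" for i
    have H0: "0 \<le> H i" for i unfolding H_def h_def using x by (intro mult_nonneg_nonneg sum_nonneg) auto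
    define y where "y i = 2 powr (- real i / p) * H i" for i
    define x' where "x' k = (if k \<le> K then 2 ^ N * (2 powr (- real k / p) * x k) else 0)" for k
    have sum_le: "(\<Sum>i. ennreal (1 / 2 ^ i) * ennreal (H i powr p)) \<le> ennreal (C0 * (2 ^ N) powr p * (\<Sum>k\<le>K. 2 powr - real k * x k powr p))"
    proof -
      have "(\<Sum>i. ennreal (1 / 2 ^ i) * ennreal (H i powr p)) = (\<Sum>i. ennreal (y i powr p))"
      proof (rule suminf_cong)
        fix i
        have "y i powr p = 2 powr (- real i) * H i powr p"
          using p H0 by (simp add: y_def powr_mult powr_powr)
        also have "2 powr (- real i) = 1 / 2 ^ i"
          by (simp add: powr_minus powr_realpow inverse_eq_divide)
        finally show "ennreal (1 / 2 ^ i) * ennreal (H i powr p) = ennreal (y i powr p)"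
          by (simp only: ennreal_mult powr_ge_zero zero_le_divide_1_iff zero_le_power zero_le_numeral)
      qed
      also have "\<dots> \<le> ennreal C0 * (\<Sum>k. ennreal (x' k powr p))"
      proof (rule C0(2)[where A = "\<lambda>i. {..K}"])
        fix i
        have "y i = (\<Sum>k\<le>K. 2 powr (- real i / p) * (2 ^ N * (x k * h i k)))"
          by (simp only: y_def H_def sum_distrib_left)
        also have "\<dots> \<le> (\<Sum>k\<le>K. 2 powr (-\<delta> * \<bar>real i - real k\<bar>) * x' k)"
        proof (rule sum_mono)
          fix k assume k: "k \<in> {..K}"
          have "- real i / p + real k / p + - real N * max 0 (real k - real i) \<le> -\<delta> * \<bar>real i - real k\<bar>"
          proof (cases "k \<le> i")
            case True
            have "\<delta> * (real i - real k) \<le> (1/p) * (real i - real k)"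
              using True \<delta> by (intro mult_right_mono) auto
            then show ?thesis using True by (simp add: algebra_simps)
          next
            case False
            have "\<delta> * (real k - real i) \<le> (real N - 1/p) * (real k - real i)"
              using False \<delta> by (intro mult_right_mono) auto
            then show ?thesis using False by (simp add: algebra_simps)
          qed
          then have "2 powr (- real i / p) * 2 powr (real k / p) * h i k \<le> 2 powr (-\<delta> * \<bar>real i - real k\<bar>)"
            unfolding h_def powr_add[symmetric] by (intro powr_mono) auto
          then have "(2 powr (- real i / p) * 2 powr (real k / p) * h i k) * x' k \<le> 2 powr (-\<delta> * \<bar>real i - real k\<bar>) * x' k"
            using x by (intro mult_right_mono) (auto simp: x'_def)
          moreover have "2 powr (- real i / p) * (2 ^ N * (x k * h i k)) = (2 powr (- real i / p) * 2 powr (real k / p) * h i k) * x' k"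
          proof -
            have "2 powr (real k / p) * 2 powr (- real k / p) = 2 powr (real k / p + - real k / p)"
              by (simp only: powr_add)
            then have e: "2 powr (real k / p) * 2 powr (- real k / p) = 1" by simp
            have "(2 powr (- real i / p) * 2 powr (real k / p) * h i k) * x' k
              = 2 powr (- real i / p) * (2 ^ N * (x k * h i k)) * (2 powr (real k / p) * 2 powr (- real k / p))"
              using k by (simp only: x'_def atMost_iff if_True mult_ac)
            then show ?thesis unfolding e mult_1_right by (rule sym)
          qed
          ultimately show "2 powr (- real i / p) * (2 ^ N * (x k * h i k)) \<le> 2 powr (-\<delta> * \<bar>real i - real k\<bar>) * x' k"
            by (simp only:)
        qed
        finally show "y i \<le> (\<Sum>k\<le>K. 2 powr (-\<delta> * \<bar>real i - real k\<bar>) * x' k)" .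
      qed (auto simp: x'_def y_def H0 x)
      also have "(\<Sum>k. ennreal (x' k powr p)) = (\<Sum>k\<le>K. ennreal (x' k powr p))"
        by (rule suminf_finite) (auto simp: x'_def)
      also have "\<dots> = ennreal (\<Sum>k\<le>K. x' k powr p)" by (rule sum_ennreal) simp
      also have "(\<Sum>k\<le>K. x' k powr p) = (\<Sum>k\<le>K. (2 ^ N) powr p * (2 powr - real k * x k powr p))"
        using p x by (intro sum.cong) (auto simp: x'_def powr_mult powr_powr)
      also have "\<dots> = (2 ^ N) powr p * (\<Sum>k\<le>K. 2 powr - real k * x k powr p)" by (rule sum_distrib_left[symmetric])
      also have "ennreal C0 * ennreal \<dots> = ennreal (C0 * (2 ^ N) powr p * (\<Sum>k\<le>K. 2 powr - real k * x k powr p))"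
        using C0(1) by (subst ennreal_mult[symmetric]) (auto intro!: sum_nonneg mult_nonneg_nonneg simp: mult.assoc)
      finally show ?thesis .
    qed
    show "hardy_int p (test_fun N x K) \<le> ennreal (C0 * (2 ^ N) powr p * (\<Sum>k\<le>K. 2 powr - real k * x k powr p))"
      unfolding hardy_int_def
    proof (rule SUP_least)
      fix \<rho> :: real assume "\<rho> \<in> {0..<1}"
      then have \<rho>: "0 \<le> \<rho>" "\<rho> \<le> 1" by auto
      have "slice_int p (test_fun N x K) \<rho>
          \<le> (\<Sum>i. ennreal (1 / 2 ^ i) * ennreal (H i powr p))"
      proof (rule shell_integral_bound)
        fix \<theta> :: real and i :: nat assume i: "1 / 2 ^ i < cmod (1 - cis \<theta>)"
        have "cmod (test_fun N x K (of_real \<rho> * cis \<theta>))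
            \<le> (\<Sum>k\<le>K. cmod (of_real (x k) * (of_real (2 powr - real k) / (1 - of_real (1 - 2 powr - real k) * (of_real \<rho> * cis \<theta>))) ^ N))"
          unfolding test_fun_def by (rule norm_sum)
        also have "\<dots> \<le> (\<Sum>k\<le>K. x k * (2 ^ N * h i k))"
        proof (rule sum_mono)
          fix k
          define s where "s = (1 - 2 powr - real k) * \<rho>"
          have s: "0 \<le> s" "s \<le> 1 - 2 powr - real k" "s \<le> 1"
            using \<rho> dyadic_radius[of k] by (auto simp: s_def intro: mult_left_le mult_le_one)
          define D where "D = cmod (1 - of_real s * cis \<theta>)"
          have D1: "2 powr - real k \<le> D" using norm_one_minus_scaled(1)[of "cis \<theta>" s 1] s(1,3) s(2) by (simp add: D_def)
          have "1 / 2 ^ i < 2 * D" using norm_one_minus_scaled(2)[of "cis \<theta>" s 1] s(1,3) i by (simp add: D_def)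
          then have D2: "2 powr - real i \<le> 2 * D"
            by (simp add: powr_minus powr_realpow inverse_eq_divide)
          have D0: "0 < D" using D1 by (rule less_le_trans[rotated]) simp
          have "2 powr - real k / D \<le> 2 * 2 powr (- max 0 (real k - real i))"
          proof (cases "k \<le> i")
            case True
            then show ?thesis using D1 D0 by (simp add: divide_simps)
          next
            case False
            then have "- max 0 (real k - real i) = - real k - - real i" by simp
            then have "2 * 2 powr (- max 0 (real k - real i)) = 2 * (2 powr - real k / 2 powr - real i)"
              by (simp only: powr_diff)
            also have "\<dots> \<ge> 2 powr - real k / D" using D2 D0 by (simp add: field_simps)
            finally show ?thesis .
          qed
          then have "(2 powr - real k / D) ^ N \<le> (2 * 2 powr (- max 0 (real k - real i))) ^ N"
            using D0 by (intro power_mono) auto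
          also have "\<dots> = 2 ^ N * h i k"
          proof -
            have "(2 powr (- max 0 (real k - real i))) ^ N = (2 powr (- max 0 (real k - real i))) powr real N"
              by (rule powr_realpow[symmetric]) simp
            then show ?thesis by (simp add: power_mult_distrib h_def powr_powr mult.commute)
          qed
          finally have le: "(2 powr - real k / D) ^ N \<le> 2 ^ N * h i k" .
          have "of_real (1 - 2 powr - real k) * (of_real \<rho> * cis \<theta>) = of_real s * cis \<theta>"
            by (simp add: s_def)
          then have "cmod (of_real (x k) * (of_real (2 powr - real k) / (1 - of_real (1 - 2 powr - real k) * (of_real \<rho> * cis \<theta>))) ^ N)
              = x k * (2 powr - real k / D) ^ N"
            using x by (simp only: norm_mult norm_power norm_divide norm_of_real D_def abs_of_nonneg powr_ge_zero)
          then show "cmod (of_real (x k) * (of_real (2 powr - real k) / (1 - of_real (1 - 2 powr - real k) * (of_real \<rho> * cis \<theta>))) ^ N)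
              \<le> x k * (2 ^ N * h i k)"
            using mult_left_mono[OF le x[of k]] by (simp only:)
        qed
        also have "\<dots> = H i" unfolding H_def sum_distrib_left by (simp only: mult_ac)
        finally show "ennreal (cmod (test_fun N x K (of_real \<rho> * cis \<theta>)) powr p) \<le> ennreal (H i powr p)"
          using p by (intro ennreal_leI powr_mono2) auto
      qed
      also note sum_le
      finally show "slice_int p (test_fun N x K) \<rho>
          \<le> ennreal (C0 * (2 ^ N) powr p * (\<Sum>k\<le>K. 2 powr - real k * x k powr p))" .
    qed
  qed
qed

text \<open>With \<delta> = 2^-k the argument t(1 - \<delta>) is at least (1 - \<delta>)^2, so the
  k-th denominator is at most 1 - (1 - \<delta>)^3 \<le> 3\<delta>. The other peaks are nonnegative
  on the radius and only add.\<close>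

lemma test_fun_radial_lower:
  assumes x: "\<And>k. 0 \<le> x k" and k: "k \<le> K" and t: "1 - 2 powr - real k \<le> t" "t < 1"
  shows "x k / 3 ^ N \<le> (\<Sum>j\<le>K. x j * (2 powr - real j / (1 - (1 - 2 powr - real j) * (t * (1 - 2 powr - real k)))) ^ N)"
proof -
  define \<delta> where "\<delta> j = 2 powr - real j" for j
  have \<delta>: "0 < \<delta> j" "\<delta> j \<le> 1" for j unfolding \<delta>_def using powr_mono[of "- real j" 0 2] by auto
  define s where "s = t * (1 - \<delta> k)"
  have t0: "0 \<le> t" using t \<delta>[of k] by (simp add: \<delta>_def)
  have s: "0 \<le> s" "s \<le> 1" using t0 t \<delta>[of k] by (auto simp: s_def intro: mult_le_one)
  have pos: "0 < 1 - (1 - \<delta> j) * s" for j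
  proof -
    have "(1 - \<delta> j) * s \<le> 1 - \<delta> j" using s \<delta>[of j] by (intro mult_left_le) auto
    then show ?thesis using \<delta>(1)[of j] by linarith
  qed
  have "(1 - \<delta> k) * (1 - \<delta> k) \<le> s"
    unfolding s_def using t \<delta>[of k] by (intro mult_right_mono) (auto simp: \<delta>_def)
  then have "(1 - \<delta> k) * ((1 - \<delta> k) * (1 - \<delta> k)) \<le> (1 - \<delta> k) * s"
    using \<delta>[of k] by (intro mult_left_mono) auto
  moreover have "1 - 3 * \<delta> k \<le> (1 - \<delta> k) * ((1 - \<delta> k) * (1 - \<delta> k))"
  proof -
    have "0 \<le> \<delta> k * \<delta> k * (3 - \<delta> k)" using \<delta>[of k] by (intro mult_nonneg_nonneg) auto
    then show ?thesis by (simp add: algebra_simps)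
  qed
  ultimately have "1 - (1 - \<delta> k) * s \<le> 3 * \<delta> k" by linarith
  then have "1 / 3 \<le> \<delta> k / (1 - (1 - \<delta> k) * s)" using pos[of k] by (simp add: field_simps)
  then have "(1 / 3) ^ N \<le> (\<delta> k / (1 - (1 - \<delta> k) * s)) ^ N" by (intro power_mono) auto
  then have "x k / 3 ^ N \<le> x k * (\<delta> k / (1 - (1 - \<delta> k) * s)) ^ N"
    using mult_left_mono[OF _ x[of k]] by (fastforce simp: power_divide)
  also have "\<dots> \<le> (\<Sum>j\<le>K. x j * (\<delta> j / (1 - (1 - \<delta> j) * s)) ^ N)"
    using k x pos \<delta> by (intro member_le_sum[where f = "\<lambda>j. x j * (\<delta> j / (1 - (1 - \<delta> j) * s)) ^ N"])
      (auto intro!: mult_nonneg_nonneg divide_nonneg_pos simp: less_imp_le)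
  finally show ?thesis by (simp add: \<delta>_def s_def)
qed

subsection \<open>Bounds for the operator norm\<close>

lemma hardy_norm_top_upper:
  "z \<in> ball 0 1 \<Longrightarrow> ennreal (cmod (f z)) \<le> hardy_norm \<infinity> f"
  unfolding hardy_norm_def by (simp, rule SUP_upper) simp

text \<open>\<open>p\<close> is extended real, so that p infinite, with 1/p = 0 and r = q, is
  included. No measure is fixed, so that constants obtained in this locale are uniform in
  \<mu>.\<close>

locale exponents =
  fixes p :: ennreal and q \<gamma> r :: real
  assumes q: "0 < q" and qp: "ennreal q < p" and \<gamma>: "0 < \<gamma>"
    and r_eq: "1 / r = 1 / q - enn2real (1 / p)"
begin

text \<open>In the finite case q/p' and q/r are the two exponents of Hoelder's inequality.\<close>

lemma exponent_cases [consumes 0, case_names infinite finite]: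
  obtains "p = \<infinity>" "r = q" | p' where "p = ennreal p'" "q < p'" "0 < p'" "0 < r" "q / p' + q / r = 1"
proof (cases p)
  case (real p')
  then have p': "q < p'" using qp q by (simp add: ennreal_less_iff)
  have "enn2real (1 / p) = 1 / p'"
    using real p' q by (simp add: divide_ennreal flip: ennreal_1)
  then have r': "1 / r = 1 / q - 1 / p'" using r_eq by simp
  have "0 < 1 / r" unfolding r' using p' q by (simp add: frac_less2)
  then have "0 < r" by simp
  moreover have "q / p' + q / r = 1"
  proof -
    have "q * (1 / p' + 1 / r) = q * (1 / q)" unfolding r' by simp
    then show ?thesis using q by (simp add: distrib_left)
  qed
  ultimately show ?thesis using that(2) real p' q by simp
next
  case top
  then have "r = q" using r_eq by simp
  then show ?thesis using that(1) top by simp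
qed

lemma r_pos: "0 < r"
  by (rule exponent_cases) (use q in auto)

text \<open>Norm balls are uniformly bounded on smaller discs, as Montel's theorem requires. A
  negative \<open>B\<close> means the norm bound 0, which is why |B| appears in the proof.\<close>

lemma hardy_norm_growth:
  assumes k: "k < 1"
  shows "\<exists>M. \<forall>f. f holomorphic_on ball 0 1 \<and> hardy_norm p f \<le> ennreal B \<longrightarrow> (\<forall>z. cmod z \<le> k \<longrightarrow> cmod (f z) \<le> M)"
proof (cases rule: exponent_cases)
  case infinite
  have "cmod (f z) \<le> \<bar>B\<bar>" if "hardy_norm p f \<le> ennreal B" "cmod z \<le> k" for f z
  proof -
    have "ennreal (cmod (f z)) \<le> ennreal B"
      using hardy_norm_top_upper[of z f] that k infinite by auto
    then show ?thesis by (auto simp: ennreal_le_iff2)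
  qed
  then show ?thesis by blast
next
  case (finite p')
  have "cmod (f z) \<le> (4 / (1 - k) * \<bar>B\<bar> powr p') powr (1/p')"
    if f: "f holomorphic_on ball 0 1" and B: "hardy_norm p f \<le> ennreal B" and z: "cmod z \<le> k" for f z
  proof -
    have z1: "cmod z < 1" using z k by simp
    have "hardy_int p' f = ennpowr (hardy_norm p f) p'"
      unfolding finite(1) by (rule hardy_int_eq[OF holomorphic_on_imp_continuous_on[OF f] finite(3)])
    also have "\<dots> \<le> ennpowr (ennreal \<bar>B\<bar>) p'"
      using finite(3) B by (intro ennpowr_mono) (auto intro: order_trans ennreal_leI)
    finally have h: "hardy_int p' f \<le> ennreal (\<bar>B\<bar> powr p')" by simp
    have "ennreal (cmod (f z) powr p') \<le> ennreal (4 / (1 - cmod z)) * hardy_int p' f"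
      by (rule hardy_int_growth[OF f finite(3) z1])
    also have "\<dots> \<le> ennreal (4 / (1 - k)) * ennreal (\<bar>B\<bar> powr p')"
      using z k by (intro mult_mono h ennreal_leI divide_left_mono) auto
    also have "\<dots> = ennreal (4 / (1 - k) * \<bar>B\<bar> powr p')"
      using k by (subst ennreal_mult[symmetric]) auto
    finally have "cmod (f z) powr p' \<le> 4 / (1 - k) * \<bar>B\<bar> powr p'"
      using k by (simp add: ennreal_le_iff)
    then have "(cmod (f z) powr p') powr (1/p') \<le> (4 / (1 - k) * \<bar>B\<bar> powr p') powr (1/p')"
      using finite(3) by (intro powr_mono2) auto
    then show ?thesis using finite(3) by (simp add: powr_powr)
  qed
  then show ?thesis by blast
qed

text \<open>For finite p this is Hoelder's inequality for the p-th power of the maximal function and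
  the r-th power of \<open>W\<close>, followed by the maximal theorem. For p infinite the maximal
  function is at most the norm.\<close>

lemma radial_max_Holder:
  obtains K :: real where "0 < K" "\<And>f \<rho> W. \<lbrakk>f holomorphic_on ball 0 1; 0 \<le> \<rho>; \<rho> < 1; W \<in> borel_measurable borel\<rbrakk> \<Longrightarrow>
    (\<integral>\<^sup>+\<theta>. ennpowr (radial_max (dilate \<rho> f) \<theta> * W \<theta>) q \<partial>arc)
      \<le> ennreal K * ennpowr (hardy_norm p f) q * ennpowr (\<integral>\<^sup>+\<theta>. ennpowr (W \<theta>) r \<partial>arc) (q / r)"
proof (cases rule: exponent_cases)
  case infinite
  show ?thesis
  proof (rule that[of 1])
    fix f :: "complex \<Rightarrow> complex" and \<rho> :: real and W :: "real \<Rightarrow> ennreal"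
    assume f: "f holomorphic_on ball 0 1" and \<rho>: "0 \<le> \<rho>" "\<rho> < 1" and [measurable]: "W \<in> borel_measurable borel"
    have "radial_max (dilate \<rho> f) \<theta> \<le> hardy_norm p f" for \<theta>
      unfolding radial_max_def
    proof (rule SUP_least)
      fix t :: real assume "t \<in> {0..<1}"
      then have "\<rho> * t < 1" using \<rho> mult_left_le_one_le[of t \<rho>] by auto
      then have "of_real \<rho> * (of_real t * cis \<theta>) \<in> ball 0 1"
        using \<rho> \<open>t \<in> _\<close> by (simp add: norm_mult)
      then show "ennreal (cmod (f (of_real \<rho> * (of_real t * cis \<theta>)))) \<le> hardy_norm p f"
        unfolding infinite by (rule hardy_norm_top_upper)
    qed
    then have "(\<integral>\<^sup>+\<theta>. ennpowr (radial_max (dilate \<rho> f) \<theta> * W \<theta>) q \<partial>arc)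
        \<le> (\<integral>\<^sup>+\<theta>. ennpowr (hardy_norm p f * W \<theta>) q \<partial>arc)"
      using q by (intro nn_integral_mono ennpowr_mono mult_right_mono) auto
    also have "\<dots> = ennpowr (hardy_norm p f) q * (\<integral>\<^sup>+\<theta>. ennpowr (W \<theta>) q \<partial>arc)"
      unfolding ennpowr_mult by (rule nn_integral_cmult) measurable
    finally show "(\<integral>\<^sup>+\<theta>. ennpowr (radial_max (dilate \<rho> f) \<theta> * W \<theta>) q \<partial>arc)
      \<le> ennreal 1 * ennpowr (hardy_norm p f) q * ennpowr (\<integral>\<^sup>+\<theta>. ennpowr (W \<theta>) r \<partial>arc) (q / r)"
      using infinite q by simp
  qed simp
next
  case (finite p')
  show ?thesis
  proof (rule that[of "256 powr (q / p')"])
    fix f :: "complex \<Rightarrow> complex" and \<rho> :: real and W :: "real \<Rightarrow> ennreal"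
    assume f: "f holomorphic_on ball 0 1" and \<rho>: "0 \<le> \<rho>" "\<rho> < 1" and [measurable]: "W \<in> borel_measurable borel"
    define M where "M = radial_max (dilate \<rho> f)"
    obtain R where R: "1 < R" "dilate \<rho> f holomorphic_on ball 0 R"
      by (rule dilation_holomorphic[OF f \<rho>])
    have [measurable]: "M \<in> borel_measurable borel"
      unfolding M_def
      by (intro borel_measurable_radial_max holomorphic_on_imp_continuous_on holomorphic_on_subset[OF R(2)]) (use R(1) in auto)
    have "(\<integral>\<^sup>+\<theta>. ennpowr (M \<theta> * W \<theta>) q \<partial>arc)
        = (\<integral>\<^sup>+\<theta>. ennpowr (ennpowr (M \<theta>) p') (q / p') * ennpowr (ennpowr (W \<theta>) r) (q / r) \<partial>arc)"
      using finite by (simp add: ennpowr_mult ennpowr_ennpowr)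
    also have "\<dots> \<le> ennpowr (\<integral>\<^sup>+\<theta>. ennpowr (M \<theta>) p' \<partial>arc) (q / p') * ennpowr (\<integral>\<^sup>+\<theta>. ennpowr (W \<theta>) r \<partial>arc) (q / r)"
      using finite q by (intro nn_integral_Holder) auto
    also have "\<dots> \<le> ennpowr (256 * hardy_int p' f) (q / p') * ennpowr (\<integral>\<^sup>+\<theta>. ennpowr (W \<theta>) r \<partial>arc) (q / r)"
      unfolding M_def using finite q by (intro mult_right_mono ennpowr_mono radial_max_hardy f \<rho>) auto
    also have "ennpowr (256 * hardy_int p' f) (q / p') = ennreal (256 powr (q / p')) * ennpowr (hardy_norm p f) q"
    proof -
      have "hardy_int p' f = ennpowr (hardy_norm p f) p'"
        unfolding finite(1) by (rule hardy_int_eq[OF holomorphic_on_imp_continuous_on[OF f] finite(3)])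
      moreover have "ennpowr 256 (q / p') = ennreal (256 powr (q / p'))"
        using ennpowr_ennreal[of 256 "q / p'"] by simp
      ultimately show ?thesis using finite by (simp add: ennpowr_mult ennpowr_ennpowr)
    qed
    finally show "(\<integral>\<^sup>+\<theta>. ennpowr (radial_max (dilate \<rho> f) \<theta> * W \<theta>) q \<partial>arc)
      \<le> ennreal (256 powr (q / p')) * ennpowr (hardy_norm p f) q * ennpowr (\<integral>\<^sup>+\<theta>. ennpowr (W \<theta>) r \<partial>arc) (q / r)"
      by (simp only: M_def)
  qed simp
qed

text \<open>One estimate for two purposes: a = S = 0 gives boundedness, and \<open>a\<close> near 1
  with \<open>S\<close> small gives compactness. The first term depends on f in a smaller disc only,
  the second on its norm and the remaining potential.\<close>

lemma cesaro_hardy_int_le: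
  obtains K :: real where "0 < K" "\<And>\<mu> f a S. \<lbrakk>unit_measure \<mu>; f holomorphic_on ball 0 1; 0 \<le> a; a < 1; 0 \<le> S;
      \<And>z. cmod z < a \<Longrightarrow> cmod (f z) \<le> S\<rbrakk> \<Longrightarrow>
    hardy_int q (cesaro \<mu> \<gamma> f) \<le> ennreal K * (ennreal ((S / (1 - a) powr \<gamma> * measure \<mu> (space \<mu>)) powr q)
      + ennpowr (hardy_norm p f) q * ennpowr (\<integral>\<^sup>+\<theta>. ennpowr (unit_measure.tail_potential \<mu> \<gamma> a \<theta>) r \<partial>arc) (q / r))"
proof -
  obtain K0 :: real where K0: "0 < K0" "\<And>f \<rho> W. \<lbrakk>f holomorphic_on ball 0 1; 0 \<le> \<rho>; \<rho> < 1; W \<in> borel_measurable borel\<rbrakk> \<Longrightarrow>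
    (\<integral>\<^sup>+\<theta>. ennpowr (radial_max (dilate \<rho> f) \<theta> * W \<theta>) q \<partial>arc)
      \<le> ennreal K0 * ennpowr (hardy_norm p f) q * ennpowr (\<integral>\<^sup>+\<theta>. ennpowr (W \<theta>) r \<partial>arc) (q / r)"
    by (rule radial_max_Holder) blast
  define G where "G = 2 powr (\<gamma> * q)"
  have G: "0 < G" by (simp add: G_def)
  define K where "K = 2 powr q * (1 + G * K0)"
  show ?thesis
  proof (rule that[of K])
    show "0 < K" unfolding K_def using G K0(1) by (intro mult_pos_pos add_pos_pos) auto
    fix \<mu> :: "real measure" and f :: "complex \<Rightarrow> complex" and a S :: real
    assume "unit_measure \<mu>" and f: "f holomorphic_on ball 0 1" and a: "0 \<le> a" "a < 1"
      and S: "0 \<le> S" "\<And>z. cmod z < a \<Longrightarrow> cmod (f z) \<le> S"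
    then interpret unit_measure \<mu> by simp
    define s where "s = S / (1 - a) powr \<gamma> * measure \<mu> (space \<mu>)"
    have s0: "0 \<le> s" unfolding s_def using S by auto
    have tail0: "tail 0 = measure \<mu> (space \<mu>)" by (simp add: tail_def space_eq)
    define J where "J = ennpowr (hardy_norm p f) q * ennpowr (\<integral>\<^sup>+\<theta>. ennpowr (tail_potential \<gamma> a \<theta>) r \<partial>arc) (q / r)"
    show "hardy_int q (cesaro \<mu> \<gamma> f) \<le> ennreal K * (ennreal (s powr q) + J)"
      unfolding hardy_int_def
    proof (rule SUP_least)
      fix \<rho> :: real assume "\<rho> \<in> {0..<1}"
      then have \<rho>: "0 \<le> \<rho>" "\<rho> < 1" by auto
      define M where "M = radial_max (dilate \<rho> f)"
      obtain R where R: "1 < R" "dilate \<rho> f holomorphic_on ball 0 R"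
        by (rule dilation_holomorphic[OF f \<rho>])
      have [measurable]: "M \<in> borel_measurable borel"
        unfolding M_def
        by (intro borel_measurable_radial_max holomorphic_on_imp_continuous_on holomorphic_on_subset[OF R(2)]) (use R(1) in auto)
      define T where "T \<theta> = ennpowr (M \<theta> * tail_potential \<gamma> a \<theta>) q" for \<theta>
      have [measurable]: "T \<in> borel_measurable borel" unfolding T_def by measurable
      have "ennreal (cmod (cesaro \<mu> \<gamma> f (of_real \<rho> * cis \<theta>)) powr q)
          \<le> ennreal (2 powr q) * (ennreal (s powr q) + ennreal G * T \<theta>)" for \<theta>
      proof -
        have "ennreal (cmod (cesaro \<mu> \<gamma> f (of_real \<rho> * cis \<theta>)))
            \<le> ennreal s + ennreal (2 powr \<gamma>) * (M \<theta> * tail_potential \<gamma> a \<theta>)"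
          unfolding s_def M_def tail0[symmetric] by (rule norm_cesaro_le[OF f \<gamma> \<rho> a S])
        then have "ennpowr (ennreal (cmod (cesaro \<mu> \<gamma> f (of_real \<rho> * cis \<theta>)))) q
            \<le> ennpowr (ennreal s + ennreal (2 powr \<gamma>) * (M \<theta> * tail_potential \<gamma> a \<theta>)) q"
          using q by (intro ennpowr_mono) auto
        also have "\<dots> \<le> ennreal (2 powr q) * (ennpowr (ennreal s) q + ennpowr (ennreal (2 powr \<gamma>) * (M \<theta> * tail_potential \<gamma> a \<theta>)) q)"
          by (rule ennpowr_add_le[OF q])
        also have "ennpowr (ennreal (2 powr \<gamma>) * (M \<theta> * tail_potential \<gamma> a \<theta>)) q = ennreal G * T \<theta>"
          unfolding T_def by (subst ennpowr_mult) (simp add: G_def powr_powr)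
        finally show ?thesis using s0 by simp
      qed
      then have "slice_int q (cesaro \<mu> \<gamma> f) \<rho>
          \<le> (\<integral>\<^sup>+\<theta>. ennreal (2 powr q) * (ennreal (s powr q) + ennreal G * T \<theta>) \<partial>arc)"
        by (rule nn_integral_mono)
      also have "\<dots> = ennreal (2 powr q) * (ennreal (s powr q) + ennreal G * (\<integral>\<^sup>+\<theta>. T \<theta> \<partial>arc))"
        by (simp add: nn_integral_cmult nn_integral_add)
      also have "(\<integral>\<^sup>+\<theta>. T \<theta> \<partial>arc) \<le> ennreal K0 * J"
        unfolding T_def M_def J_def using K0(2)[OF f \<rho>, of "tail_potential \<gamma> a"] by (simp add: mult.assoc)
      also have "ennreal (2 powr q) * (ennreal (s powr q) + ennreal G * (ennreal K0 * J))
          = ennreal (2 powr q) * (ennreal (s powr q) + ennreal (G * K0) * J)"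
        using G K0(1) by (simp add: ennreal_mult mult.assoc)
      also have "\<dots> \<le> ennreal (2 powr q) * (ennreal (1 + G * K0) * ennreal (s powr q) + ennreal (1 + G * K0) * J)"
      proof (intro mult_left_mono add_mono mult_right_mono)
        have "1 * ennreal (s powr q) \<le> ennreal (1 + G * K0) * ennreal (s powr q)"
          using G K0(1) by (intro mult_right_mono) (auto simp flip: ennreal_1 intro!: ennreal_leI)
        then show "ennreal (s powr q) \<le> ennreal (1 + G * K0) * ennreal (s powr q)" by simp
        show "ennreal (G * K0) \<le> ennreal (1 + G * K0)" by (rule ennreal_leI) simp
      qed auto
      also have "\<dots> = ennreal K * (ennreal (s powr q) + J)"
        unfolding K_def distrib_left[symmetric] using G K0(1) by (simp add: ennreal_mult mult.assoc)
      finally show "slice_int q (cesaro \<mu> \<gamma> f) \<rho> \<le> \<dots>"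
        by (simp add: mult_left_mono add_left_mono)
    qed
  qed
qed

lemma cesaro_hardy_norm_le:
  obtains K :: real where "0 < K" "\<And>\<mu> f. \<lbrakk>unit_measure \<mu>; f holomorphic_on ball 0 1\<rbrakk> \<Longrightarrow>
    hardy_norm (ennreal q) (cesaro \<mu> \<gamma> f)
      \<le> ennreal K * ennpowr (potential_int \<mu> \<gamma> r) (1 / r) * hardy_norm p f"
proof -
  obtain K :: real where K: "0 < K" "\<And>\<mu> f a S. \<lbrakk>unit_measure \<mu>; f holomorphic_on ball 0 1; 0 \<le> a; a < 1; 0 \<le> S;
      \<And>z. cmod z < a \<Longrightarrow> cmod (f z) \<le> S\<rbrakk> \<Longrightarrow>
    hardy_int q (cesaro \<mu> \<gamma> f) \<le> ennreal K * (ennreal ((S / (1 - a) powr \<gamma> * measure \<mu> (space \<mu>)) powr q)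
      + ennpowr (hardy_norm p f) q * ennpowr (\<integral>\<^sup>+\<theta>. ennpowr (unit_measure.tail_potential \<mu> \<gamma> a \<theta>) r \<partial>arc) (q / r))"
    by (rule cesaro_hardy_int_le) blast
  show ?thesis
  proof (rule that[of "K powr (1/q)"])
    show "0 < K powr (1/q)" using K(1) by simp
    fix \<mu> :: "real measure" and f :: "complex \<Rightarrow> complex"
    assume \<mu>: "unit_measure \<mu>" and f: "f holomorphic_on ball 0 1"
    interpret unit_measure \<mu> by (rule \<mu>)
    define P where "P = potential_int \<mu> \<gamma> r"
    have "hardy_int q (cesaro \<mu> \<gamma> f) \<le> ennreal K * (ennpowr (hardy_norm p f) q * ennpowr P (q / r))"
      using K(2)[OF \<mu> f, of 0 0] by (simp add: tail_potential_0 P_def)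
    then have "ennpowr (hardy_int q (cesaro \<mu> \<gamma> f)) (1/q)
        \<le> ennpowr (ennreal K * (ennpowr (hardy_norm p f) q * ennpowr P (q / r))) (1/q)"
      using q by (intro ennpowr_mono) auto
    also have "\<dots> = ennreal (K powr (1/q)) * (hardy_norm p f * ennpowr P (1/r))"
      using q K(1) by (simp add: ennpowr_mult ennpowr_ennpowr)
    finally show "hardy_norm (ennreal q) (cesaro \<mu> \<gamma> f) \<le> ennreal (K powr (1/q)) * ennpowr P (1 / r) * hardy_norm p f"
      by (simp add: hardy_norm_eq[OF holomorphic_on_imp_continuous_on[OF cesaro_holomorphic[OF f \<gamma>]] q] mult_ac)
  qed
qed

text \<open>The peak heights \<open>x k\<close> make both \<open>2\<^sup>-\<^sup>k (x k)\<^sup>p\<close> and \<open>2\<^sup>-\<^sup>k (x k 2\<^sup>k\<^sup>\<gamma> m\<^sub>k)\<^sup>q\<close> multiples of \<open>d\<^sub>k\<^sup>r\<close>.\<close>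

lemma dyadic_le_unit_ball_bound:
  obtains C :: real where "0 < C" "\<And>\<mu> B. \<lbrakk>unit_measure \<mu>;
      \<And>f. f \<in> hardy p \<Longrightarrow> hardy_norm p f \<le> 1 \<Longrightarrow> hardy_norm (ennreal q) (cesaro \<mu> \<gamma> f) \<le> B\<rbrakk> \<Longrightarrow>
    dyadic_sum \<mu> (\<gamma> - 1/r) r \<le> ennreal C * ennpowr B r"
proof (cases rule: exponent_cases)
  case infinite
  show ?thesis
  proof (rule that[of "2 powr (\<gamma> * r) * (1327104 * pi)"])
    fix \<mu> B
    assume \<mu>: "unit_measure \<mu>"
      and B: "\<And>f. f \<in> hardy p \<Longrightarrow> hardy_norm p f \<le> 1 \<Longrightarrow> hardy_norm (ennreal q) (cesaro \<mu> \<gamma> f) \<le> B"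
    interpret unit_measure \<mu> by (rule \<mu>)
    \<comment> \<open>For p infinite the constant function 1 suffices as a test, since then r = q
      and its image is F.\<close>
    have one: "hardy_norm p (\<lambda>_. 1) = 1" by (simp add: hardy_norm_def infinite)
    have "hardy_norm (ennreal q) (F_fun \<mu> \<gamma>) \<le> B"
      unfolding F_fun_def by (rule B) (auto simp: hardy_def one)
    then have "ennpowr (hardy_norm (ennreal q) (F_fun \<mu> \<gamma>)) q \<le> ennpowr B q"
      using q by (intro ennpowr_mono) auto
    then have "hardy_int r (F_fun \<mu> \<gamma>) \<le> ennpowr B r"
      using hardy_int_eq[OF holomorphic_on_imp_continuous_on[OF F_fun_holomorphic[OF \<gamma>]] q] by (simp add: infinite)
    then have "ennreal (2 powr (\<gamma> * r) * (1327104 * pi)) * hardy_int r (F_fun \<mu> \<gamma>)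
        \<le> ennreal (2 powr (\<gamma> * r) * (1327104 * pi)) * ennpowr B r"
      by (intro mult_left_mono) auto
    with dyadic_le_hardy_int_F[OF \<gamma> r_pos]
    show "dyadic_sum \<mu> (\<gamma> - 1/r) r \<le> ennreal (2 powr (\<gamma> * r) * (1327104 * pi)) * ennpowr B r"
      by (rule order_trans)
  qed simp
next
  case (finite p')
  obtain N :: nat where N: "1 / p' < real N" using reals_Archimedean2 by blast
  obtain C1 :: real where C1: "0 < C1" "\<And>x K. (\<And>k. 0 \<le> x k) \<Longrightarrow>
    hardy_int p' (test_fun N x K) \<le> ennreal (C1 * (\<Sum>k\<le>K. 2 powr - real k * x k powr p'))"
    by (rule test_fun_hardy_int[OF finite(3) N]) blast
  \<comment> \<open>2^(-\<gamma>) 3^(-N) is lost in the pointwise lower bound on the radius, and the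
    power of \<open>C1\<close> comes from normalising the test function.\<close>
  define \<kappa> where "\<kappa> = (2 powr (- \<gamma>) / 3 ^ N) powr q * C1 powr (- (q / p'))"
  have \<kappa>: "0 < \<kappa>" using C1(1) by (simp add: \<kappa>_def)
  define E where "E = 1327104 * pi"
  have E: "0 < E" by (simp add: E_def)
  show ?thesis
  proof (rule that[of "(E / \<kappa>) powr (r / q)"])
    show "0 < (E / \<kappa>) powr (r / q)" using E \<kappa> by simp
    fix \<mu> B
    assume \<mu>: "unit_measure \<mu>"
      and B: "\<And>f. f \<in> hardy p \<Longrightarrow> hardy_norm p f \<le> 1 \<Longrightarrow> hardy_norm (ennreal q) (cesaro \<mu> \<gamma> f) \<le> B"
    interpret unit_measure \<mu> by (rule \<mu>)
    define d where "d = dyadic_weight \<mu> (\<gamma> - 1/r)"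
    have d0: "0 \<le> d k" for k by (simp add: d_def)
    show "dyadic_sum \<mu> (\<gamma> - 1/r) r \<le> ennreal ((E / \<kappa>) powr (r / q)) * ennpowr B r"
      unfolding d_def[symmetric]
    proof (rule suminf_le_const)
      fix K :: nat
      \<comment> \<open>A partial sum is finite, which permits dividing by a power of it below; the
        resulting bound is uniform in \<open>K\<close>.\<close>
      define S where "S = (\<Sum>k\<le>K. d k powr r)"
      have S0: "0 \<le> S" unfolding S_def by (intro sum_nonneg) auto
      have "ennreal S \<le> ennreal ((E / \<kappa>) powr (r / q)) * ennpowr B r"
      proof (cases "S = 0")
        case False
        then have S: "0 < S" using S0 by simp
        \<comment> \<open>Chosen such that C1 c^p' S = 1, which puts the test function into the unit
          ball.\<close>
        define c where "c = (C1 * S) powr (- (1 / p'))"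
        have c: "0 < c" using C1(1) S by (simp add: c_def)
        define x where "x k = c * d k powr (r / p') * 2 powr (real k / p')" for k
        have x0: "0 \<le> x k" for k using c by (simp add: x_def)
        define f where "f = test_fun N x K"
        have f: "f holomorphic_on ball 0 1" unfolding f_def by (rule test_fun_holomorphic)
        have "2 powr - real k * x k powr p' = c powr p' * d k powr r" for k
        proof -
          have "x k powr p' = c powr p' * d k powr r * 2 powr real k"
            using finite(3) by (simp add: x_def powr_mult powr_powr)
          moreover have "2 powr real k * 2 powr - real k = 2 powr (real k + - real k)" by (simp only: powr_add)
          then have "2 powr real k * 2 powr - real k = 1" by simp
          ultimately show ?thesis by (simp add: mult_ac)
        qed
        then have "C1 * (\<Sum>k\<le>K. 2 powr - real k * x k powr p') = C1 * (c powr p' * S)"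
          by (simp add: S_def sum_distrib_left)
        also have "\<dots> = 1"
        proof -
          have "c powr p' = (C1 * S) powr (-1)" using finite(3) by (simp add: c_def powr_powr)
          also have "\<dots> = 1 / (C1 * S)" using C1(1) S by (simp add: powr_minus_divide)
          finally show ?thesis using C1(1) S by simp
        qed
        finally have "hardy_int p' f \<le> ennreal 1"
          unfolding f_def using C1(2)[of x K] x0 by simp
        then have "ennpowr (hardy_int p' f) (1/p') \<le> ennpowr 1 (1/p')"
          using finite(3) by (intro ennpowr_mono) auto
        then have nf: "hardy_norm p f \<le> 1"
          unfolding finite(1) hardy_norm_eq[OF holomorphic_on_imp_continuous_on[OF f] finite(3)] by simp
        moreover have "f \<in> hardy p" using f nf by (auto simp: hardy_def intro: le_less_trans)
        ultimately have "hardy_norm (ennreal q) (cesaro \<mu> \<gamma> f) \<le> B" by (intro B)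
        then have "ennpowr (hardy_norm (ennreal q) (cesaro \<mu> \<gamma> f)) q \<le> ennpowr B q"
          using q by (intro ennpowr_mono) auto
        then have hB: "hardy_int q (cesaro \<mu> \<gamma> f) \<le> ennpowr B q"
          using hardy_int_eq[OF holomorphic_on_imp_continuous_on[OF cesaro_holomorphic[OF f \<gamma>]] q] by simp
        have term_le: "\<kappa> * S powr (- (q / p')) * d k powr r
            \<le> 2 powr - real k * cmod (cesaro \<mu> \<gamma> f (of_real (1 - 2 powr - real k))) powr q" if "k \<le> K" for k
        proof -
          have "(x k / 3 ^ N) * 2 powr (- \<gamma>) * 2 powr (real k * \<gamma>) * tail k
              \<le> cmod (cesaro \<mu> \<gamma> f (of_real (1 - 2 powr - real k)))"
          proof (rule cesaro_dyadic_lower[OF f \<gamma>])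
            fix t :: real
            show "f (of_real t) = of_real (\<Sum>k\<le>K. x k * (2 powr - real k / (1 - (1 - 2 powr - real k) * t)) ^ N)"
              unfolding f_def by (rule test_fun_real)
            assume t: "0 \<le> t" "t < 1"
            have "(1 - 2 powr - real k) * t \<le> 1" for k
              using dyadic_radius[of k] t by (intro mult_le_one) auto
            then show "0 \<le> (\<Sum>k\<le>K. x k * (2 powr - real k / (1 - (1 - 2 powr - real k) * t)) ^ N)"
              by (intro sum_nonneg mult_nonneg_nonneg x0 zero_le_power divide_nonneg_nonneg) auto
          next
            fix t assume "1 - 2 powr - real k \<le> t" "t < 1"
            then show "x k / 3 ^ N \<le> (\<Sum>j\<le>K. x j * (2 powr - real j / (1 - (1 - 2 powr - real j) * (t * (1 - 2 powr - real k)))) ^ N)"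
              by (intro test_fun_radial_lower x0 that)
          qed (simp add: x0)
          then have "((x k / 3 ^ N) * 2 powr (- \<gamma>) * 2 powr (real k * \<gamma>) * tail k) powr q
              \<le> cmod (cesaro \<mu> \<gamma> f (of_real (1 - 2 powr - real k))) powr q"
            using q x0 by (intro powr_mono2) auto
          then have "2 powr - real k * ((x k / 3 ^ N) * 2 powr (- \<gamma>) * 2 powr (real k * \<gamma>) * tail k) powr q
              \<le> 2 powr - real k * cmod (cesaro \<mu> \<gamma> f (of_real (1 - 2 powr - real k))) powr q"
            by (intro mult_left_mono) auto
          moreover have "2 powr - real k * ((x k / 3 ^ N) * 2 powr (- \<gamma>) * 2 powr (real k * \<gamma>) * tail k) powr q
              = \<kappa> * S powr (- (q / p')) * d k powr r"
          proof -
            have "real k * \<gamma> = real k * (\<gamma> - 1/r) + real k / r" by (simp add: algebra_simps)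
            then have e: "2 powr (real k * \<gamma>) * tail k = 2 powr (real k / r) * d k"
              by (simp add: d_def dyadic_weight_eq powr_add)
            have "(x k / 3 ^ N) * 2 powr (- \<gamma>) * 2 powr (real k * \<gamma>) * tail k
                = (2 powr (- \<gamma>) / 3 ^ N) * x k * (2 powr (real k * \<gamma>) * tail k)" by simp
            also have "\<dots> = (2 powr (- \<gamma>) / 3 ^ N) * (c * (d k powr (r / p') * d k) * (2 powr (real k / p') * 2 powr (real k / r)))"
              unfolding e x_def by (simp only: mult_ac)
            also have "\<dots> powr q = (2 powr (- \<gamma>) / 3 ^ N) powr q *
                (c powr q * ((d k powr (r / p')) powr q * d k powr q) * ((2 powr (real k / p')) powr q * (2 powr (real k / r)) powr q))"
              by (simp only: powr_mult)
            also have "(d k powr (r / p')) powr q * d k powr q = d k powr r"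
            proof -
              have "r / p' * q + q = r * (q / p' + q / r)" using finite(4) by (simp add: distrib_left)
              then have "r / p' * q + q = r" using finite(5) by simp
              then show ?thesis by (simp add: powr_powr flip: powr_add)
            qed
            also have "(2 powr (real k / p')) powr q * (2 powr (real k / r)) powr q = 2 powr real k"
            proof -
              have "real k / p' * q + real k / r * q = real k * (q / p' + q / r)" by (simp add: distrib_left)
              then have "real k / p' * q + real k / r * q = real k" using finite(5) by simp
              then show ?thesis by (simp add: powr_powr flip: powr_add)
            qed
            also have "c powr q = C1 powr (- (q / p')) * S powr (- (q / p'))"
              using C1(1) S by (simp add: c_def powr_powr powr_mult)
            finally have e2: "((x k / 3 ^ N) * 2 powr (- \<gamma>) * 2 powr (real k * \<gamma>) * tail k) powr q
               = \<kappa> * S powr (- (q / p')) * d k powr r * 2 powr real k"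
              by (simp only: \<kappa>_def mult_ac)
            have "2 powr real k * 2 powr - real k = 2 powr (real k + - real k)" by (simp only: powr_add)
            then have "2 powr - real k * 2 powr real k = 1" by (simp add: mult.commute)
            then show ?thesis unfolding e2 by (simp add: mult_ac)
          qed
          ultimately show ?thesis by (simp only:)
        qed
        \<comment> \<open>Summing \<open>term_le\<close> gives a multiple of S^(1 - q/p'), which is
          S^(q/r); the power r/q at the end returns S itself.\<close>
        have "q / r = 1 - q / p'" using finite(5) by simp
        then have Sqr: "S powr (q / r) = S * S powr (- (q / p'))"
          using S by (simp add: powr_diff powr_minus divide_inverse)
        have "(\<Sum>k\<le>K. T * d k powr r) = T * S" for T
          by (simp add: S_def sum_distrib_left)
        then have "(\<Sum>k\<le>K. \<kappa> * S powr (- (q / p')) * d k powr r) = \<kappa> * S powr (- (q / p')) * S" .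
        also have "\<dots> = \<kappa> * S powr (q / r)" unfolding Sqr by simp
        finally have "ennreal (\<kappa> * S powr (q / r)) = ennreal (\<Sum>k\<le>K. \<kappa> * S powr (- (q / p')) * d k powr r)"
          by (simp only:)
        also have "\<dots> = (\<Sum>k\<le>K. ennreal (\<kappa> * S powr (- (q / p')) * d k powr r))"
          using \<kappa> by (intro sum_ennreal[symmetric]) auto
        also have "\<dots> \<le> (\<Sum>k\<le>K. ennreal (2 powr - real k * cmod (cesaro \<mu> \<gamma> f (of_real (1 - 2 powr - real k))) powr q))"
          by (intro sum_mono ennreal_leI term_le) auto
        also have "\<dots> \<le> (\<Sum>k. ennreal (2 powr - real k * cmod (cesaro \<mu> \<gamma> f (of_real (1 - 2 powr - real k))) powr q))"
          by (intro sum_le_suminf) auto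
        also have "\<dots> \<le> ennreal E * hardy_int q (cesaro \<mu> \<gamma> f)"
          unfolding E_def by (intro radial_dyadic_embedding cesaro_holomorphic f \<gamma> q)
        also have "\<dots> \<le> ennreal E * ennpowr B q" by (intro mult_left_mono hB) auto
        finally have "ennreal (1 / \<kappa>) * ennreal (\<kappa> * S powr (q / r)) \<le> ennreal (1 / \<kappa>) * (ennreal E * ennpowr B q)"
          by (intro mult_left_mono) auto
        also have "ennreal (1 / \<kappa>) * ennreal (\<kappa> * S powr (q / r)) = ennreal (S powr (q / r))"
          using \<kappa> by (simp flip: ennreal_mult)
        also have "ennreal (1 / \<kappa>) * (ennreal E * ennpowr B q) = ennreal (E / \<kappa>) * ennpowr B q"
          using \<kappa> E unfolding mult.assoc[symmetric] by (subst ennreal_mult[symmetric]) auto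
        finally have "ennpowr (ennreal (S powr (q / r))) (r / q) \<le> ennpowr (ennreal (E / \<kappa>) * ennpowr B q) (r / q)"
          using q finite(4) by (intro ennpowr_mono) auto
        then show ?thesis
          using q finite(4) S \<kappa> E by (simp add: ennpowr_mult ennpowr_ennpowr powr_powr)
      qed simp
      moreover have "(\<Sum>j<K. ennreal (d j powr r)) \<le> ennreal S"
      proof -
        have "(\<Sum>j<K. ennreal (d j powr r)) \<le> (\<Sum>j\<le>K. ennreal (d j powr r))"
          by (intro sum_mono2) auto
        also have "\<dots> = ennreal S" unfolding S_def by (rule sum_ennreal) simp
        finally show ?thesis .
      qed
      ultimately show "(\<Sum>j<K. ennreal (d j powr r)) \<le> ennreal ((E / \<kappa>) powr (r / q)) * ennpowr B r"
        by (rule order_trans[rotated])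
    qed simp
  qed
qed

end

subsection \<open>Compactness\<close>

lemma hardy_int_add:
  assumes f: "continuous_on (ball 0 1) f" and g: "continuous_on (ball 0 1) g" and p: "0 < p"
  shows "hardy_int p (\<lambda>z. f z + g z) \<le> ennreal (2 powr p) * (hardy_int p f + hardy_int p g)"
  unfolding hardy_int_def[of p "\<lambda>z. f z + g z"]
proof (rule SUP_least)
  fix \<rho> :: real assume "\<rho> \<in> {0..<1}"
  then have \<rho>: "0 \<le> \<rho>" "\<rho> < 1" by auto
  note [measurable] = borel_measurable_circle_slice[OF f \<rho>] borel_measurable_circle_slice[OF g \<rho>]
  define z where "z \<theta> = of_real \<rho> * cis \<theta>" for \<theta>
  have "ennreal (cmod (f (z \<theta>) + g (z \<theta>)) powr p)
      \<le> ennreal (2 powr p) * (ennreal (cmod (f (z \<theta>)) powr p) + ennreal (cmod (g (z \<theta>)) powr p))" for \<theta>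
  proof -
    have "ennpowr (ennreal (cmod (f (z \<theta>) + g (z \<theta>)))) p
        \<le> ennpowr (ennreal (cmod (f (z \<theta>))) + ennreal (cmod (g (z \<theta>)))) p"
      using p by (intro ennpowr_mono) (auto simp flip: ennreal_plus intro!: ennreal_leI norm_triangle_ineq)
    also have "\<dots> \<le> ennreal (2 powr p) * (ennpowr (ennreal (cmod (f (z \<theta>)))) p + ennpowr (ennreal (cmod (g (z \<theta>)))) p)"
      by (rule ennpowr_add_le[OF p])
    finally show ?thesis by simp
  qed
  then have "(\<integral>\<^sup>+\<theta>. ennreal (cmod (f (z \<theta>) + g (z \<theta>)) powr p) \<partial>arc)
      \<le> (\<integral>\<^sup>+\<theta>. ennreal (2 powr p) * (ennreal (cmod (f (z \<theta>)) powr p) + ennreal (cmod (g (z \<theta>)) powr p)) \<partial>arc)"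
    by (rule nn_integral_mono)
  also have "\<dots> = ennreal (2 powr p) * ((\<integral>\<^sup>+\<theta>. ennreal (cmod (f (z \<theta>)) powr p) \<partial>arc) + (\<integral>\<^sup>+\<theta>. ennreal (cmod (g (z \<theta>)) powr p) \<partial>arc))"
    unfolding z_def by (subst nn_integral_cmult, measurable) (subst nn_integral_add, measurable)
  also have "\<dots> \<le> ennreal (2 powr p) * (hardy_int p f + hardy_int p g)"
    unfolding z_def by (intro mult_left_mono add_mono slice_le_hardy_int \<rho>) auto
  finally show "(\<integral>\<^sup>+\<theta>. ennreal (cmod (f (of_real \<rho> * cis \<theta>) + g (of_real \<rho> * cis \<theta>)) powr p) \<partial>arc) \<le> \<dots>"
    by (simp only: z_def)
qed

lemma hardy_int_uminus: "hardy_int p (\<lambda>z. - f z) = hardy_int p f"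
  by (simp add: hardy_int_def)

lemma hardy_int_cong:
  assumes "\<And>z. z \<in> ball 0 1 \<Longrightarrow> f z = g z"
  shows "hardy_int p f = hardy_int p g"
  unfolding hardy_int_def
proof (rule SUP_cong[OF refl])
  fix \<rho> :: real assume "\<rho> \<in> {0..<1}"
  then have "f (of_real \<rho> * cis \<theta>) = g (of_real \<rho> * cis \<theta>)" for \<theta> by (intro assms) (simp add: norm_mult)
  then show "slice_int p f \<rho>
      = slice_int p g \<rho>" by simp
qed

lemma hardy_int_less_top_iff:
  assumes "f holomorphic_on ball 0 1" "0 < q"
  shows "hardy_int q f < top \<longleftrightarrow> f \<in> hardy (ennreal q)"
  using assms by (simp add: hardy_def hardy_norm_eq[OF holomorphic_on_imp_continuous_on])

text \<open>Otherwise the unit ball contains F_n whose images have norm above n. Along the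
  subsequence given by compactness the images are eventually within distance 1 of a fixed g of
  finite norm, hence bounded by the quasi-triangle inequality, although s(n) \<ge> n.\<close>

lemma compact_hardy_bounded_unit_ball:
  assumes q: "0 < q" and T: "compact_hardy p (ennreal q) T"
  obtains B :: real where "\<And>f. f \<in> hardy p \<Longrightarrow> hardy_norm p f \<le> 1 \<Longrightarrow> hardy_norm (ennreal q) (T f) \<le> ennreal B"
proof (rule ccontr)
  assume neg: "\<not> thesis"
  have "\<exists>f. f \<in> hardy p \<and> hardy_norm p f \<le> 1 \<and> ennreal (real n) < hardy_norm (ennreal q) (T f)" for n
  proof (rule ccontr)
    assume "\<not> ?thesis"
    then have "hardy_norm (ennreal q) (T f) \<le> ennreal (real n)" if "f \<in> hardy p" "hardy_norm p f \<le> 1" for f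
      using that by (auto simp: not_less)
    with that neg show False by blast
  qed
  then obtain F where F: "\<And>n. F n \<in> hardy p" "\<And>n. hardy_norm p (F n) \<le> 1"
    "\<And>n. ennreal (real n) < hardy_norm (ennreal q) (T (F n))" by metis
  have "\<exists>B::real. \<forall>n. hardy_norm p (F n) \<le> ennreal B"
    using F(2) by (intro exI[of _ 1]) simp
  then obtain g s where g: "g \<in> hardy (ennreal q)" and s: "strict_mono (s :: nat \<Rightarrow> nat)"
    and lim: "(\<lambda>n. hardy_norm (ennreal q) (\<lambda>z. T (F (s n)) z - g z)) \<longlonglongrightarrow> 0"
    using T F(1) unfolding compact_hardy_def by blast
  have TF: "T (F n) \<in> hardy (ennreal q)" for n using T F(1) by (auto simp: compact_hardy_def)
  have hTF: "T (F n) holomorphic_on ball 0 1" for n using TF[of n] by (simp add: hardy_def)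
  have hg: "g holomorphic_on ball 0 1" using g by (simp add: hardy_def)
  define L where "L = ennreal (2 powr q) * (1 + hardy_int q g)"
  have "L < top" unfolding L_def using hardy_int_less_top_iff[OF hg q] g by (simp add: ennreal_mult_less_top)
  then obtain l where l: "ennpowr L (1/q) = ennreal l" "0 \<le> l"
    by (metis ennpowr_less_top_iff ennreal_cases less_irrefl)
  have "\<forall>\<^sub>F n in sequentially. hardy_norm (ennreal q) (\<lambda>z. T (F (s n)) z - g z) < 1"
    using lim by (rule order_tendstoD) simp
  moreover have "\<forall>\<^sub>F n in sequentially. nat \<lceil>l\<rceil> \<le> n" by (rule eventually_ge_at_top)
  ultimately have "\<forall>\<^sub>F n in sequentially. False"
  proof eventually_elim
    case (elim n)
    define u where "u = (\<lambda>z. T (F (s n)) z - g z)"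
    have hu: "u holomorphic_on ball 0 1" unfolding u_def by (intro holomorphic_intros hTF hg)
    have "hardy_int q u = ennpowr (hardy_norm (ennreal q) u) q"
      by (rule hardy_int_eq[OF holomorphic_on_imp_continuous_on[OF hu] q])
    also have "\<dots> \<le> ennpowr 1 q" using elim q by (intro ennpowr_mono) (auto simp: u_def)
    finally have u1: "hardy_int q u \<le> 1" by simp
    have "hardy_int q (T (F (s n))) = hardy_int q (\<lambda>z. u z + g z)" by (simp add: u_def)
    also have "\<dots> \<le> ennreal (2 powr q) * (hardy_int q u + hardy_int q g)"
      by (intro hardy_int_add holomorphic_on_imp_continuous_on hu hg q)
    also have "\<dots> \<le> L" unfolding L_def by (intro mult_left_mono add_mono u1) auto
    finally have "ennpowr (hardy_int q (T (F (s n)))) (1/q) \<le> ennpowr L (1/q)"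
      using q by (intro ennpowr_mono) auto
    then have "hardy_norm (ennreal q) (T (F (s n))) \<le> ennreal l"
      by (simp add: l hardy_norm_eq[OF holomorphic_on_imp_continuous_on[OF hTF] q])
    moreover have "l \<le> real (s n)"
    proof -
      have "l \<le> real n" using elim(2) by (simp add: nat_le_iff ceiling_le_iff)
      also have "n \<le> s n" using s by (rule strict_mono_imp_increasing)
      finally show ?thesis by simp
    qed
    ultimately have "hardy_norm (ennreal q) (T (F (s n))) \<le> ennreal (real (s n))"
      by (meson ennreal_leI order_trans)
    then show False using F(3)[of "s n"] by simp
  qed
  then show False by simp
qed

context unit_measure begin

lemma cesaro_diff:
  assumes f: "f holomorphic_on ball 0 1" and g: "g holomorphic_on ball 0 1" and \<gamma>: "0 < \<gamma>" and z: "cmod z < 1"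
  shows "cesaro \<mu> \<gamma> (\<lambda>z. f z - g z) z = cesaro \<mu> \<gamma> f z - cesaro \<mu> \<gamma> g z"
proof -
  have fg: "(\<lambda>z. f z - g z) holomorphic_on ball 0 1" by (intro holomorphic_intros f g)
  show ?thesis
    unfolding cesaro_integral[OF f \<gamma> z] cesaro_integral[OF g \<gamma> z] cesaro_integral[OF fg \<gamma> z]
    by (subst Bochner_Integration.integral_diff[symmetric, OF cesaro_integrable[OF f \<gamma> z] cesaro_integrable[OF g \<gamma> z]])
       (simp add: left_diff_distrib)
qed

text \<open>Dominated convergence twice: in \<open>t\<close> at almost every \<theta>, where the
  potential is finite and the cutoff eventually excludes each t < 1; then in \<theta>, with the r-th
  power of the full potential as majorant.\<close>

lemma tail_potential_tendsto_0:
  assumes r: "0 < r" and fin: "potential_int \<mu> \<gamma> r < top"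
    and a: "a \<longlonglongrightarrow> 1" "\<And>n. 0 \<le> a n"
  shows "(\<lambda>n. \<integral>\<^sup>+\<theta>. ennpowr (tail_potential \<gamma> (a n) \<theta>) r \<partial>arc) \<longlonglongrightarrow> 0"
proof -
  have le: "tail_potential \<gamma> (a n) \<theta> \<le> potential \<mu> \<gamma> (cis \<theta>)" for n \<theta>
    unfolding tail_potential_def potential_def by (intro nn_integral_mono) (auto simp: indicator_def)
  have "AE \<theta> in arc. ennpowr (potential \<mu> \<gamma> (cis \<theta>)) r \<noteq> \<infinity>"
    using fin by (intro nn_integral_PInf_AE) (auto simp: less_top)
  then have "AE \<theta> in arc. (\<lambda>n. ennpowr (tail_potential \<gamma> (a n) \<theta>) r) \<longlonglongrightarrow> 0"
  proof eventually_elim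
    case (elim \<theta>)
    then have pf: "potential \<mu> \<gamma> (cis \<theta>) < \<infinity>" by (simp add: less_top)
    have m: "(\<lambda>t. ennreal (1 / norm (1 - of_real t * cis \<theta>) powr \<gamma>)) \<in> borel_measurable \<mu>"
      by (intro measurable_borel) measurable
    have mi: "(\<lambda>t. ennreal (1 / norm (1 - of_real t * cis \<theta>) powr \<gamma>) * indicator {a n..} t) \<in> borel_measurable \<mu>" for n
      by (intro measurable_borel) measurable
    have "(\<lambda>n. \<integral>\<^sup>+t. ennreal (1 / norm (1 - of_real t * cis \<theta>) powr \<gamma>) * indicator {a n..} t \<partial>\<mu>)
        \<longlonglongrightarrow> (\<integral>\<^sup>+t. 0 \<partial>\<mu>)"
    proof (rule nn_integral_dominated_convergence[OF mi _ m])
      show "AE t in \<mu>. (\<lambda>n. ennreal (1 / norm (1 - of_real t * cis \<theta>) powr \<gamma>) * indicator {a n..} t) \<longlonglongrightarrow> 0"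
      proof (rule AE_I2)
        fix t assume "t \<in> space \<mu>"
        then have "t < 1" by (simp add: space_eq)
        then have "\<forall>\<^sub>F n in sequentially. t < a n" by (rule order_tendstoD[OF a(1)])
        then have "\<forall>\<^sub>F n in sequentially. ennreal (1 / norm (1 - of_real t * cis \<theta>) powr \<gamma>) * indicator {a n..} t = 0"
          by eventually_elim simp
        then show "(\<lambda>n. ennreal (1 / norm (1 - of_real t * cis \<theta>) powr \<gamma>) * indicator {a n..} t) \<longlonglongrightarrow> 0"
          by (rule tendsto_eventually)
      qed
      show "(\<integral>\<^sup>+t. ennreal (1 / norm (1 - of_real t * cis \<theta>) powr \<gamma>) \<partial>\<mu>) < \<infinity>"
        using pf by (simp add: potential_def)
    qed (auto simp: indicator_def)
    then have "(\<lambda>n. tail_potential \<gamma> (a n) \<theta>) \<longlonglongrightarrow> 0" by (simp add: tail_potential_def)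
    then show ?case by (rule tendsto_ennpowr_0[OF r])
  qed
  then have "(\<lambda>n. \<integral>\<^sup>+\<theta>. ennpowr (tail_potential \<gamma> (a n) \<theta>) r \<partial>arc) \<longlonglongrightarrow> (\<integral>\<^sup>+\<theta>. 0 \<partial>arc)"
    by (intro nn_integral_dominated_convergence[where w = "\<lambda>\<theta>. ennpowr (potential \<mu> \<gamma> (cis \<theta>)) r"])
       (use fin r in \<open>auto intro!: ennpowr_mono le\<close>)
  then show ?thesis by simp
qed

end

context exponents begin

text \<open>Fatou's lemma on each circle for finite p; the limit from Montel's theorem keeps the
  norm bound of the sequence.\<close>

lemma hardy_norm_pointwise_limit:
  assumes f: "\<And>n. f n holomorphic_on ball 0 1" "\<And>n. hardy_norm p (f n) \<le> ennreal B"
    and g: "g holomorphic_on ball 0 1" and lim: "\<And>z. z \<in> ball 0 1 \<Longrightarrow> (\<lambda>n. f n z) \<longlonglongrightarrow> g z"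
  shows "hardy_norm p g \<le> ennreal B"
proof (cases rule: exponent_cases)
  case infinite
  have "ennreal (cmod (g z)) \<le> ennreal B" if "z \<in> ball 0 1" for z
  proof (rule LIMSEQ_le_const2)
    show "(\<lambda>n. ennreal (cmod (f n z))) \<longlonglongrightarrow> ennreal (cmod (g z))"
      by (intro tendsto_ennrealI tendsto_norm lim that)
    have "ennreal (cmod (f n z)) \<le> ennreal B" for n
      using hardy_norm_top_upper[OF that, of "f n"] f(2)[of n] infinite by (auto intro: order_trans)
    then show "\<exists>N. \<forall>n\<ge>N. ennreal (cmod (f n z)) \<le> ennreal B" by blast
  qed
  then show ?thesis unfolding infinite hardy_norm_def by (simp add: SUP_le_iff)
next
  case (finite p')
  have "hardy_int p' g \<le> ennpowr (ennreal B) p'"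
    unfolding hardy_int_def
  proof (rule SUP_least)
    fix \<rho> :: real assume "\<rho> \<in> {0..<1}"
    then have \<rho>: "0 \<le> \<rho>" "\<rho> < 1" by auto
    have [measurable]: "(\<lambda>\<theta>. f n (of_real \<rho> * cis \<theta>)) \<in> borel_measurable borel" for n
      by (intro borel_measurable_circle_slice \<rho> holomorphic_on_imp_continuous_on f)
    have "(\<lambda>n. ennreal (cmod (f n (of_real \<rho> * cis \<theta>)) powr p')) \<longlonglongrightarrow> ennreal (cmod (g (of_real \<rho> * cis \<theta>)) powr p')" for \<theta>
      using finite \<rho> by (intro tendsto_ennrealI tendsto_powr' tendsto_norm lim) (auto simp: norm_mult)
    then have "ennreal (cmod (g (of_real \<rho> * cis \<theta>)) powr p') = liminf (\<lambda>n. ennreal (cmod (f n (of_real \<rho> * cis \<theta>)) powr p'))" for \<theta>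
      by (metis lim_imp_Liminf trivial_limit_sequentially)
    then have "slice_int p' g \<rho>
        \<le> liminf (\<lambda>n. slice_int p' (f n) \<rho>)"
      by (simp add: nn_integral_liminf)
    also have "\<dots> \<le> liminf (\<lambda>n. ennpowr (ennreal B) p')"
    proof (intro Liminf_mono always_eventually allI)
      fix n
      have "slice_int p' (f n) \<rho> \<le> hardy_int p' (f n)"
        by (rule slice_le_hardy_int[OF \<rho>])
      also have "\<dots> = ennpowr (hardy_norm p (f n)) p'"
        unfolding finite(1) by (rule hardy_int_eq[OF holomorphic_on_imp_continuous_on[OF f(1)] finite(3)])
      also have "\<dots> \<le> ennpowr (ennreal B) p'" using finite f(2) by (intro ennpowr_mono) auto
      finally show "slice_int p' (f n) \<rho> \<le> ennpowr (ennreal B) p'" .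
    qed
    also have "\<dots> = ennpowr (ennreal B) p'" by (simp add: Liminf_const)
    finally show "slice_int p' g \<rho> \<le> ennpowr (ennreal B) p'" .
  qed
  then show ?thesis
    unfolding finite(1) hardy_norm_eq[OF holomorphic_on_imp_continuous_on[OF g] finite(3)]
    using finite(3) by (subst ennpowr_le_swap) auto
qed

text \<open>The new bound depends on \<open>B\<close> alone; for finite p it comes from the
  quasi-triangle inequality for p-th powers.\<close>

lemma hardy_norm_diff_bounded:
  "\<exists>B'::real. \<forall>f g. f holomorphic_on ball 0 1 \<and> g holomorphic_on ball 0 1 \<and>
     hardy_norm p f \<le> ennreal B \<and> hardy_norm p g \<le> ennreal B \<longrightarrow> hardy_norm p (\<lambda>z. f z - g z) \<le> ennreal B'"
proof (cases rule: exponent_cases)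
  case infinite
  have "hardy_norm p (\<lambda>z. f z - g z) \<le> ennreal (\<bar>B\<bar> + \<bar>B\<bar>)"
    if fg: "hardy_norm p f \<le> ennreal B" "hardy_norm p g \<le> ennreal B" for f g
  proof -
    have "ennreal (cmod (f z - g z)) \<le> ennreal (\<bar>B\<bar> + \<bar>B\<bar>)" if "z \<in> ball 0 1" for z
    proof -
      have "ennreal (cmod (f z)) \<le> ennreal B" "ennreal (cmod (g z)) \<le> ennreal B"
        using hardy_norm_top_upper[OF that] fg infinite order_trans by blast+
      then have "cmod (f z) \<le> \<bar>B\<bar>" "cmod (g z) \<le> \<bar>B\<bar>" by (auto simp: ennreal_le_iff2)
      then show ?thesis using norm_triangle_ineq4[of "f z" "g z"] by (intro ennreal_leI) linarith
    qed
    then show ?thesis unfolding infinite hardy_norm_def by (simp add: SUP_le_iff)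
  qed
  then show ?thesis by blast
next
  case (finite p')
  have "hardy_norm p (\<lambda>z. f z - g z) \<le> ennreal ((2 powr p' * (\<bar>B\<bar> powr p' + \<bar>B\<bar> powr p')) powr (1/p'))"
    if f: "f holomorphic_on ball 0 1" and g: "g holomorphic_on ball 0 1"
      and fg: "hardy_norm p f \<le> ennreal B" "hardy_norm p g \<le> ennreal B" for f g
  proof -
    have le: "hardy_int p' h \<le> ennreal (\<bar>B\<bar> powr p')"
      if h: "h holomorphic_on ball 0 1" "hardy_norm p h \<le> ennreal B" for h
    proof -
      have "hardy_int p' h = ennpowr (hardy_norm p h) p'"
        unfolding finite(1) by (rule hardy_int_eq[OF holomorphic_on_imp_continuous_on[OF h(1)] finite(3)])
      also have "\<dots> \<le> ennpowr (ennreal \<bar>B\<bar>) p'"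
        using finite(3) h(2) by (intro ennpowr_mono) (auto intro: order_trans ennreal_leI)
      finally show ?thesis by simp
    qed
    have d: "(\<lambda>z. f z - g z) holomorphic_on ball 0 1" by (intro holomorphic_intros f g)
    have "hardy_int p' (\<lambda>z. f z - g z) = hardy_int p' (\<lambda>z. f z + - g z)" by simp
    also have "\<dots> \<le> ennreal (2 powr p') * (hardy_int p' f + hardy_int p' (\<lambda>z. - g z))"
      by (intro hardy_int_add holomorphic_on_imp_continuous_on holomorphic_intros f g finite)
    also have "\<dots> \<le> ennreal (2 powr p') * (ennreal (\<bar>B\<bar> powr p') + ennreal (\<bar>B\<bar> powr p'))"
      unfolding hardy_int_uminus by (intro mult_left_mono add_mono le f g fg) auto
    also have "\<dots> = ennreal (2 powr p' * (\<bar>B\<bar> powr p' + \<bar>B\<bar> powr p'))"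
      by (subst ennreal_plus[symmetric], simp, simp, subst ennreal_mult[symmetric]) auto
    finally have "ennpowr (hardy_int p' (\<lambda>z. f z - g z)) (1/p') \<le> ennpowr (ennreal (2 powr p' * (\<bar>B\<bar> powr p' + \<bar>B\<bar> powr p'))) (1/p')"
      using finite(3) by (intro ennpowr_mono) auto
    then show ?thesis
      unfolding finite(1) hardy_norm_eq[OF holomorphic_on_imp_continuous_on[OF d] finite(3)] by simp
  qed
  then show ?thesis by blast
qed

text \<open>The order of choices matters: the cutoff is placed so near 1 that the tail potential
  term is small on the whole norm ball, and only then \<open>n\<close> is taken large, when locally
  uniform convergence makes \<open>h n\<close> small on the fixed smaller disc.\<close>

lemma cesaro_null_sequence:
  assumes \<mu>: "unit_measure \<mu>" and fin: "potential_int \<mu> \<gamma> r < top"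
    and h: "\<And>n. h n holomorphic_on ball 0 1" "\<And>n. hardy_norm p (h n) \<le> ennreal B"
    and unif: "\<And>K. compact K \<Longrightarrow> K \<subseteq> ball 0 1 \<Longrightarrow> uniform_limit K h (\<lambda>_. 0) sequentially"
  shows "(\<lambda>n. hardy_norm (ennreal q) (cesaro \<mu> \<gamma> (h n))) \<longlonglongrightarrow> 0"
proof -
  interpret unit_measure \<mu> by (rule \<mu>)
  obtain K :: real where K: "0 < K" "\<And>\<mu> f a S. \<lbrakk>unit_measure \<mu>; f holomorphic_on ball 0 1; 0 \<le> a; a < 1; 0 \<le> S;
      \<And>z. cmod z < a \<Longrightarrow> cmod (f z) \<le> S\<rbrakk> \<Longrightarrow>
    hardy_int q (cesaro \<mu> \<gamma> f) \<le> ennreal K * (ennreal ((S / (1 - a) powr \<gamma> * measure \<mu> (space \<mu>)) powr q)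
      + ennpowr (hardy_norm p f) q * ennpowr (\<integral>\<^sup>+\<theta>. ennpowr (unit_measure.tail_potential \<mu> \<gamma> a \<theta>) r \<partial>arc) (q / r))"
    by (rule cesaro_hardy_int_le) blast
  define J where "J a = (\<integral>\<^sup>+\<theta>. ennpowr (tail_potential \<gamma> a \<theta>) r \<partial>arc)" for a
  define a where "a n = 1 - 1 / (real n + 1)" for n
  have a: "0 \<le> a n" "a n < 1" for n by (auto simp: a_def field_simps)
  have "a \<longlonglongrightarrow> 1" unfolding a_def by real_asymp
  then have "(\<lambda>n. J (a n)) \<longlonglongrightarrow> 0"
    unfolding J_def using a by (intro tail_potential_tendsto_0[OF r_pos fin])
  then have "(\<lambda>n. ennpowr (J (a n)) (q / r)) \<longlonglongrightarrow> 0"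
    using q r_pos by (intro tendsto_ennpowr_0) auto
  then have "(\<lambda>n. ennreal K * ennpowr (ennreal B) q * ennpowr (J (a n)) (q / r)) \<longlonglongrightarrow> ennreal K * ennpowr (ennreal B) q * 0"
    by (intro ennreal_tendsto_cmult) (auto simp: ennreal_mult_less_top)
  then have limJ: "(\<lambda>n. ennreal K * ennpowr (ennreal B) q * ennpowr (J (a n)) (q / r)) \<longlonglongrightarrow> 0" by simp
  have "(\<lambda>n. hardy_int q (cesaro \<mu> \<gamma> (h n))) \<longlonglongrightarrow> 0"
  proof (rule order_tendstoI)
    fix e :: ennreal assume "0 < e"
    then obtain e1 where e1: "0 < e1" "e1 < e" using dense by blast
    \<comment> \<open>\<open>e\<close> may be infinite, so a finite positive number below it is
      halved.\<close>
    then obtain e2 where e2: "0 < e2" "ennreal e2 + ennreal e2 < e"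
    proof -
      obtain x where x: "e1 = ennreal x" "0 \<le> x" using e1(2) by (cases e1) auto
      then have "0 < x / 2" "ennreal (x/2) + ennreal (x/2) < e" using e1 by (auto simp flip: ennreal_plus)
      then show ?thesis using that by blast
    qed
    have "\<forall>\<^sub>F n in sequentially. ennreal K * ennpowr (ennreal B) q * ennpowr (J (a n)) (q / r) < ennreal e2"
      using order_tendstoD(2)[OF limJ] e2(1) by simp
    then obtain k where k: "ennreal K * ennpowr (ennreal B) q * ennpowr (J (a k)) (q / r) < ennreal e2"
      by (auto simp: eventually_sequentially)
    \<comment> \<open>With \<open>a k\<close> fixed, the contribution of the smaller disc vanishes
      as \<open>S\<close> tends to 0 from the right.\<close>
    have "((\<lambda>S. K * (S / (1 - a k) powr \<gamma> * measure \<mu> (space \<mu>)) powr q) \<longlongrightarrow> K * (0 / (1 - a k) powr \<gamma> * measure \<mu> (space \<mu>)) powr q) (at_right 0)"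
      using q a(2)[of k] by (intro tendsto_intros) (auto simp: eventually_at_right_less intro!: eventually_at_rightI[of 0 1])
    then have "((\<lambda>S. K * (S / (1 - a k) powr \<gamma> * measure \<mu> (space \<mu>)) powr q) \<longlongrightarrow> 0) (at_right 0)"
      using q by simp
    then have "\<forall>\<^sub>F S in at_right 0. K * (S / (1 - a k) powr \<gamma> * measure \<mu> (space \<mu>)) powr q < e2"
      by (rule order_tendstoD) (rule e2)
    then obtain b where b: "0 < b" "\<And>S. 0 < S \<Longrightarrow> S < b \<Longrightarrow> K * (S / (1 - a k) powr \<gamma> * measure \<mu> (space \<mu>)) powr q < e2"
      by (auto simp: eventually_at_right_field)
    define S where "S = b / 2"
    have S: "0 < S" "K * (S / (1 - a k) powr \<gamma> * measure \<mu> (space \<mu>)) powr q < e2"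
      using b(1) b(2)[of S] by (auto simp: S_def)
    have "uniform_limit (cball 0 (a k)) h (\<lambda>_. 0) sequentially"
      using a(2)[of k] by (intro unif) auto
    then have "\<forall>\<^sub>F n in sequentially. \<forall>z\<in>cball 0 (a k). dist (h n z) 0 < S"
      using S(1) by (rule uniform_limitD)
    then show "\<forall>\<^sub>F n in sequentially. hardy_int q (cesaro \<mu> \<gamma> (h n)) < e"
    proof eventually_elim
      case (elim n)
      have "cmod (h n z) \<le> S" if "cmod z < a k" for z
        using bspec[OF elim, of z] that by simp
      then have "hardy_int q (cesaro \<mu> \<gamma> (h n)) \<le> ennreal K * (ennreal ((S / (1 - a k) powr \<gamma> * measure \<mu> (space \<mu>)) powr q)
          + ennpowr (hardy_norm p (h n)) q * ennpowr (J (a k)) (q / r))"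
        unfolding J_def using S(1) by (intro K(2)[OF \<mu> h(1) a]) auto
      also have "\<dots> \<le> ennreal K * (ennreal ((S / (1 - a k) powr \<gamma> * measure \<mu> (space \<mu>)) powr q)
          + ennpowr (ennreal B) q * ennpowr (J (a k)) (q / r))"
        using q by (intro mult_left_mono add_mono mult_right_mono ennpowr_mono h) auto
      also have "\<dots> = ennreal (K * (S / (1 - a k) powr \<gamma> * measure \<mu> (space \<mu>)) powr q)
          + ennreal K * ennpowr (ennreal B) q * ennpowr (J (a k)) (q / r)"
        using K(1) by (simp add: distrib_left ennreal_mult mult.assoc)
      also have "\<dots> \<le> ennreal e2 + ennreal e2"
        using S(2) k by (intro add_mono ennreal_leI) auto
      also have "\<dots> < e" by (rule e2)
      finally show ?case .
    qed
  qed simp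
  then have "(\<lambda>n. ennpowr (hardy_int q (cesaro \<mu> \<gamma> (h n))) (1/q)) \<longlonglongrightarrow> 0"
    using q by (intro tendsto_ennpowr_0) auto
  then show ?thesis
    by (simp add: hardy_norm_eq[OF holomorphic_on_imp_continuous_on[OF cesaro_holomorphic[OF h(1) \<gamma>]] q])
qed

lemma cesaro_compact:
  assumes \<mu>: "unit_measure \<mu>" and fin: "potential_int \<mu> \<gamma> r < top"
    and maps: "\<And>f. f \<in> hardy p \<Longrightarrow> cesaro \<mu> \<gamma> f \<in> hardy (ennreal q)"
  shows "compact_hardy p (ennreal q) (cesaro \<mu> \<gamma>)"
  unfolding compact_hardy_def
proof (intro conjI ballI maps allI impI)
  interpret unit_measure \<mu> by (rule \<mu>)
  fix f :: "nat \<Rightarrow> complex \<Rightarrow> complex"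
  assume "(\<forall>n. f n \<in> hardy p) \<and> (\<exists>B::real. \<forall>n. hardy_norm p (f n) \<le> ennreal B)"
  then obtain B :: real where f: "\<And>n. f n \<in> hardy p" and B: "\<And>n. hardy_norm p (f n) \<le> ennreal B" by blast
  have hf: "f n holomorphic_on ball 0 1" for n using f[of n] by (simp add: hardy_def)
  define \<H> where "\<H> = {h. h holomorphic_on ball 0 1 \<and> hardy_norm p h \<le> ennreal B}"
  obtain g s where g: "g holomorphic_on ball 0 1" and s: "strict_mono (s :: nat \<Rightarrow> nat)"
    and lim: "\<And>z. z \<in> ball 0 1 \<Longrightarrow> (\<lambda>n. f (s n) z) \<longlonglongrightarrow> g z"
    and unif: "\<And>K. compact K \<Longrightarrow> K \<subseteq> ball 0 1 \<Longrightarrow> uniform_limit K (f \<circ> s) g sequentially"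
  proof (rule Montel[of "ball 0 1" \<H> f])
    fix K :: "complex set" assume K: "compact K" "K \<subseteq> ball 0 1"
    obtain k where k: "k < 1" "\<And>z. z \<in> K \<Longrightarrow> cmod z \<le> k"
    proof (cases "K = {}")
      case False
      then obtain z0 where "z0 \<in> K" "\<And>z. z \<in> K \<Longrightarrow> cmod z \<le> cmod z0"
        using continuous_attains_sup[OF K(1) False continuous_on_norm[OF continuous_on_id]] by auto
      then show ?thesis using K(2) by (intro that[of "cmod z0"]) auto
    qed (use that[of 0] in auto)
    obtain M where "\<forall>f. f holomorphic_on ball 0 1 \<and> hardy_norm p f \<le> ennreal B \<longrightarrow> (\<forall>z. cmod z \<le> k \<longrightarrow> cmod (f z) \<le> M)"
      using hardy_norm_growth[OF k(1)] by blast
    then show "\<exists>M. \<forall>h\<in>\<H>. \<forall>z\<in>K. cmod (h z) \<le> M"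
      using k(2) by (intro exI[of _ M]) (auto simp: \<H>_def)
  qed (use hf B in \<open>auto simp: \<H>_def\<close>)
  have nB: "hardy_norm p g \<le> ennreal B"
    by (rule hardy_norm_pointwise_limit[OF hf B g lim])
  then have gh: "g \<in> hardy p" using g by (auto simp: hardy_def intro: le_less_trans)
  obtain B' :: real where B': "\<And>n. hardy_norm p (\<lambda>z. f (s n) z - g z) \<le> ennreal B'"
    using hardy_norm_diff_bounded[of B] hf g B nB by blast
  have d: "(\<lambda>z. f (s n) z - g z) holomorphic_on ball 0 1" for n by (intro holomorphic_intros hf g)
  have "(\<lambda>n. hardy_norm (ennreal q) (cesaro \<mu> \<gamma> (\<lambda>z. f (s n) z - g z))) \<longlonglongrightarrow> 0"
  proof (rule cesaro_null_sequence[OF \<mu> fin d B'])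
    fix K :: "complex set" assume K: "compact K" "K \<subseteq> ball 0 1"
    have "uniform_limit K (\<lambda>n z. (f \<circ> s) n z - g z) (\<lambda>z. g z - g z) sequentially"
      by (intro uniform_limit_minus unif K uniform_limit_const)
    then show "uniform_limit K (\<lambda>n z. f (s n) z - g z) (\<lambda>_. 0) sequentially" by simp
  qed
  \<comment> \<open>Additivity of the operator is available on the disc, and the Hardy norm depends
    on no other values.\<close>
  moreover have "hardy_norm (ennreal q) (cesaro \<mu> \<gamma> (\<lambda>z. f (s n) z - g z))
      = hardy_norm (ennreal q) (\<lambda>z. cesaro \<mu> \<gamma> (f (s n)) z - cesaro \<mu> \<gamma> g z)" for n
  proof -
    have c1: "continuous_on (ball 0 1) (cesaro \<mu> \<gamma> (\<lambda>z. f (s n) z - g z))"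
      by (intro holomorphic_on_imp_continuous_on cesaro_holomorphic d \<gamma>)
    have c2: "continuous_on (ball 0 1) (\<lambda>z. cesaro \<mu> \<gamma> (f (s n)) z - cesaro \<mu> \<gamma> g z)"
      by (intro holomorphic_on_imp_continuous_on holomorphic_intros cesaro_holomorphic hf g \<gamma>)
    show ?thesis
      unfolding hardy_norm_eq[OF c1 q] hardy_norm_eq[OF c2 q]
      by (subst hardy_int_cong) (auto simp: cesaro_diff hf g \<gamma>)
  qed
  ultimately have "(\<lambda>n. hardy_norm (ennreal q) (\<lambda>z. cesaro \<mu> \<gamma> (f (s n)) z - cesaro \<mu> \<gamma> g z)) \<longlonglongrightarrow> 0" by simp
  then show "\<exists>g\<in>hardy (ennreal q). \<exists>s :: nat \<Rightarrow> nat. strict_mono s \<and>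
      (\<lambda>n. hardy_norm (ennreal q) (\<lambda>z. cesaro \<mu> \<gamma> (f (s n)) z - g z)) \<longlonglongrightarrow> 0"
    using maps[OF gh] s by blast
qed

end

subsection \<open>Moments and the tail integral\<close>

text \<open>Block j consists of the \<open>n\<close> with 2^j \<le> n + 1 < 2^(j+1): the shift by
  one matches the weight n + 1 and puts n = 0 into block 0.\<close>

lemma suminf_dyadic_blocks:
  fixes f :: "nat \<Rightarrow> ennreal"
  shows "(\<Sum>n. f n) = (\<Sum>j. \<Sum>n=2^j-1..<2^Suc j-1. f n)"
proof -
  have part: "(\<Sum>j<J. \<Sum>n=2^j-1..<2^Suc j-1. f n) = (\<Sum>n<2^J-1. f n)" for J
  proof (induction J)
    case (Suc J)
    have "(\<Sum>n=0..<2^J-1. f n) + (\<Sum>n=2^J-1..<2^Suc J-1. f n) = (\<Sum>n=0..<2^Suc J-1. f n)"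
      by (rule sum.atLeastLessThan_concat) (auto intro: diff_le_mono)
    then have "(\<Sum>n<2^Suc J-1. f n) = (\<Sum>n<2^J-1. f n) + (\<Sum>n=2^J-1..<2^Suc J-1. f n)"
      by (simp only: lessThan_atLeast0)
    then show ?case by (simp only: sum.lessThan_Suc Suc)
  qed simp
  show ?thesis
  proof (rule antisym)
    show "(\<Sum>n. f n) \<le> (\<Sum>j. \<Sum>n=2^j-1..<2^Suc j-1. f n)"
    proof (rule suminf_le_const)
      fix n :: nat
      have "n < 2 ^ n" by (rule less_exp)
      then have "{..<n} \<subseteq> {..<2^n-1}" unfolding lessThan_subset_iff by linarith
      then have "(\<Sum>k<n. f k) \<le> (\<Sum>k<2^n-1. f k)"
        by (intro sum_mono2) auto
      also have "\<dots> = (\<Sum>j<n. \<Sum>n=2^j-1..<2^Suc j-1. f n)" by (rule part[symmetric])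
      also have "\<dots> \<le> (\<Sum>j. \<Sum>n=2^j-1..<2^Suc j-1. f n)" by (intro sum_le_suminf) auto
      finally show "(\<Sum>k<n. f k) \<le> (\<Sum>j. \<Sum>n=2^j-1..<2^Suc j-1. f n)" .
    qed simp
    show "(\<Sum>j. \<Sum>n=2^j-1..<2^Suc j-1. f n) \<le> (\<Sum>n. f n)"
    proof (rule suminf_le_const)
      fix J
      show "(\<Sum>j<J. \<Sum>n=2^j-1..<2^Suc j-1. f n) \<le> (\<Sum>n. f n)"
        unfolding part by (intro sum_le_suminf) auto
    qed simp
  qed
qed

text \<open>The exponent \<open>b\<close> may have either sign, hence the absolute value in the
  constants.\<close>

lemma powr_dyadic_bounds:
  fixes x :: real
  assumes "2 powr j \<le> x" "x \<le> 2 * 2 powr j"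
  shows "2 powr (- \<bar>b\<bar>) * 2 powr (j * b) \<le> x powr b" "x powr b \<le> 2 powr \<bar>b\<bar> * 2 powr (j * b)"
proof -
  define y where "y = x / 2 powr j"
  have y: "1 \<le> y" "y \<le> 2" using assms by (auto simp: y_def divide_simps)
  have x: "x powr b = y powr b * 2 powr (j * b)"
    by (simp add: y_def powr_divide powr_powr)
  have "y powr (- \<bar>b\<bar>) \<le> y powr b" "y powr b \<le> y powr \<bar>b\<bar>"
    using y by (auto intro!: powr_mono)
  moreover have "2 powr (- \<bar>b\<bar>) \<le> y powr (- \<bar>b\<bar>)" using y by (intro powr_mono2') auto
  moreover have "y powr \<bar>b\<bar> \<le> 2 powr \<bar>b\<bar>" using y by (intro powr_mono2) auto
  ultimately have "2 powr (- \<bar>b\<bar>) \<le> y powr b" "y powr b \<le> 2 powr \<bar>b\<bar>" by linarith+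
  then show "2 powr (- \<bar>b\<bar>) * 2 powr (j * b) \<le> x powr b" "x powr b \<le> 2 powr \<bar>b\<bar> * 2 powr (j * b)"
    unfolding x by (auto intro!: mult_right_mono)
qed

section \<open>Moments over dyadic blocks\<close>

context unit_measure begin

text \<open>For j > 0 Bernoulli's inequality gives (1 - 2^-j)^(2^(j-1)) \<ge> 1/2, and the fourth
  power reaches the exponent 2^(j+1) > n; hence 16. For j = 0 only n = 0 occurs.\<close>

lemma moment_dyadic_lower:
  assumes "n < 2 ^ Suc j - 1"
  shows "tail j / 16 \<le> moment \<mu> n"
proof -
  have t16: "1 / 16 \<le> t ^ n" if t: "1 - 1 / 2 ^ j \<le> t" "t < 1" for t :: real
  proof (cases j)
    case 0
    then show ?thesis using assms by simp
  next
    case (Suc i)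
    have "1 / 2 = 1 + real (2 ^ i) * (- (1 / 2 ^ j))" using Suc by simp
    also have "\<dots> \<le> (1 + - (1 / 2 ^ j)) ^ (2 ^ i)" by (rule Bernoulli_inequality) simp
    also have "\<dots> \<le> t ^ (2 ^ i)" using t by (intro power_mono) auto
    finally have "(1 / 2) ^ 4 \<le> (t ^ (2 ^ i)) ^ 4" by (intro power_mono) auto
    also have "\<dots> = t ^ (2 ^ Suc j)" by (simp add: Suc mult.commute flip: power_mult)
    also have "\<dots> \<le> t ^ n"
    proof (intro power_decreasing)
      have "1 / 2 ^ j \<le> (1::real)" by simp
      then show "0 \<le> t" using t by linarith
    qed (use t assms in auto)
    finally show ?thesis by (simp add: power_divide)
  qed
  have "tail j / 16 = (LINT t|\<mu>. 1/16 * indicator {1 - 1 / 2 ^ j..<1} t)"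
    using tail_sets'[of j] by (simp add: tail_def space_eq Int_absorb2)
  also have "\<dots> \<le> (LINT t|\<mu>. t ^ n)"
  proof (rule integral_mono)
    show "integrable \<mu> (\<lambda>t. 1/16 * indicator {1 - 1 / 2 ^ j..<1} t :: real)"
      by (intro integrable_mult_right) (auto simp: emeasure_eq_measure)
    show "integrable \<mu> (\<lambda>t. t ^ n)"
      by (rule integrable_bounded[where B = 1]) (auto intro!: measurable_borel simp: power_le_one)
    fix t assume "t \<in> space \<mu>"
    then show "1/16 * indicator {1 - 1 / 2 ^ j..<1} t \<le> t ^ n"
      using t16[of t] by (auto simp: space_eq indicator_def)
  qed
  finally show ?thesis by (simp add: moment_def)
qed

text \<open>On the i-th dyadic interval with i < j one has t \<le> exp(-2^-(i+1)), so t^n decays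
  doubly exponentially in j - i. The lower bound for \<open>n\<close>, one short of 2^j, costs
  exp(1/2) \<le> 2, whence the factor 2; it also makes the coefficient at i = j at least 1.\<close>

lemma moment_dyadic_upper:
  assumes n: "2 ^ j - 1 \<le> n"
  shows "moment \<mu> n \<le> (\<Sum>i\<le>j. 2 * exp (- (2 powr (real j - real i) / 2)) * tail i)"
proof -
  define u where "u i = 2 * exp (- (2 powr (real j - real i) / 2))" for i
  have u0: "0 \<le> u i" for i by (simp add: u_def)
  have exp_half: "exp (1/2 :: real) \<le> 2"
  proof -
    have "(exp (1/2 :: real))\<^sup>2 = exp 1" by (simp flip: exp_double)
    also have "\<dots> \<le> 2\<^sup>2" using exp_le by simp
    finally show ?thesis by (rule power2_le_imp_le) simp
  qed
  have pt: "t ^ n \<le> (\<Sum>i\<le>j. u i * indicator {1 - 1 / 2 ^ i..<1} t)" if t: "0 \<le> t" "t < 1" for t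
  proof -
    have "\<exists>i\<le>j. 1 - 1 / 2 ^ i \<le> t \<and> t ^ n \<le> u i"
    proof (cases "1 - 1 / 2 ^ j \<le> t")
      case True
      have "1 \<le> 2 * exp (- (1 / 2) :: real)" using exp_half by (simp add: exp_minus field_simps)
      then have "t ^ n \<le> u j" using t power_le_one[of t n] by (simp add: u_def)
      then show ?thesis using True by blast
    next
      case False
      obtain i where i: "1 - 1 / 2 ^ i \<le> t" "t < 1 - 1 / 2 ^ Suc i" by (rule dyadic_interval[OF t])
      have "1 / (2 ^ j :: real) < 1 / 2 ^ i" using i(1) False by linarith
      then have "(2::real) ^ i < 2 ^ j" by (simp add: field_simps)
      then have ij: "i < j" by simp
      have "t \<le> exp (- (1 / 2 ^ Suc i))" using i(2) exp_ge_add_one_self[of "- (1 / 2 ^ Suc i)"] by linarith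
      then have "t ^ n \<le> exp (- (1 / 2 ^ Suc i)) ^ n" using t by (intro power_mono)
      also have "\<dots> = exp (- (real n / 2 ^ Suc i))" by (simp flip: exp_of_nat_mult)
      also have "\<dots> \<le> exp (1/2 - 2 powr (real j - real i) / 2)"
      proof -
        have "real (2 ^ j - 1) \<le> real n" using n by (rule of_nat_mono)
        then have "2 ^ j - 1 \<le> real n" by (simp add: of_nat_diff)
        then have "(2 ^ j - 1) / 2 ^ Suc i \<le> real n / 2 ^ Suc i" by (rule divide_right_mono) simp
        moreover have "1 / 2 ^ Suc i \<le> (1/2 :: real)" by simp
        moreover have "2 powr (real j - real i) / 2 = (2 ^ j - 1) / 2 ^ Suc i + 1 / 2 ^ Suc i"
          by (simp add: diff_divide_distrib powr_diff powr_realpow)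
        ultimately have "2 powr (real j - real i) / 2 \<le> real n / 2 ^ Suc i + 1 / 2"
          by (simp only: add_mono)
        then show ?thesis unfolding exp_le_cancel_iff by linarith
      qed
      also have "\<dots> = exp (1/2) * exp (- (2 powr (real j - real i) / 2))"
        by (simp flip: exp_add)
      also have "\<dots> \<le> u i" unfolding u_def using exp_half by (intro mult_right_mono) auto
      finally show ?thesis using i(1) ij by (intro exI[of _ i]) auto
    qed
    then obtain i where i: "i \<le> j" "1 - 1 / 2 ^ i \<le> t" "t ^ n \<le> u i" by blast
    then have "t ^ n \<le> u i * indicator {1 - 1 / 2 ^ i..<1} t" using t by simp
    also have "\<dots> \<le> (\<Sum>i\<le>j. u i * indicator {1 - 1 / 2 ^ i..<1} t)"
      using i u0 by (intro member_le_sum[where f = "\<lambda>i. u i * indicator {1 - 1 / 2 ^ i..<1} t"]) auto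
    finally show ?thesis .
  qed
  have int: "integrable \<mu> (\<lambda>t. u i * indicator {1 - 1 / 2 ^ i..<1} t)" for i
    by (intro integrable_mult_right) (auto simp: emeasure_eq_measure)
  have "moment \<mu> n \<le> (LINT t|\<mu>. (\<Sum>i\<le>j. u i * indicator {1 - 1 / 2 ^ i..<1} t))"
    unfolding moment_def
  proof (rule integral_mono)
    show "integrable \<mu> (\<lambda>t. t ^ n)"
      by (rule integrable_bounded[where B = 1]) (auto intro!: measurable_borel simp: power_le_one)
    show "integrable \<mu> (\<lambda>t. \<Sum>i\<le>j. u i * indicator {1 - 1 / 2 ^ i..<1} t)"
      by (rule Bochner_Integration.integrable_sum) (rule int)
    fix t assume "t \<in> space \<mu>"
    then show "t ^ n \<le> (\<Sum>i\<le>j. u i * indicator {1 - 1 / 2 ^ i..<1} t)"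
      by (intro pt) (simp_all add: space_eq)
  qed
  also have "\<dots> = (\<Sum>i\<le>j. LINT t|\<mu>. u i * indicator {1 - 1 / 2 ^ i..<1} t)"
    by (rule Bochner_Integration.integral_sum) (rule int)
  also have "\<dots> = (\<Sum>i\<le>j. u i * tail i)"
    using tail_sets' by (intro sum.cong) (simp_all add: tail_def space_eq Int_absorb2)
  finally show ?thesis by (simp add: u_def)
qed

lemma moment_nonneg: "0 \<le> moment \<mu> n"
  unfolding moment_def by (rule Bochner_Integration.integral_nonneg) (simp add: space_eq)

text \<open>A block has 2^j members, each at least a constant times 2^(j(r\<gamma>-2)) m_j^r,
  together 2^(j(r\<gamma>-1)) m_j^r = d_j^r. This accounts for the exponent r\<gamma> - 2.\<close>

lemma moment_sum_ge_dyadic: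
  assumes r: "0 < r"
  shows "dyadic_sum \<mu> (\<gamma> - 1/r) r
    \<le> ennreal (2 powr \<bar>r * \<gamma> - 2\<bar> * 16 powr r) * moment_sum \<mu> \<gamma> r"
proof -
  define b where "b = r * \<gamma> - 2"
  define w where "w n = real (n + 1) powr b * moment \<mu> n powr r" for n
  define C where "C = 2 powr \<bar>b\<bar> * 16 powr r"
  have w0: "0 \<le> w n" for n by (simp add: w_def)
  have "ennreal (dyadic_weight \<mu> (\<gamma> - 1/r) j powr r) \<le> ennreal C * (\<Sum>n=2^j-1..<2^Suc j-1. ennreal (w n))" for j
  proof -
    have "2 powr (- \<bar>b\<bar>) * 2 powr (real j * b) * (tail j / 16) powr r \<le> w n" if "n \<in> {2^j-1..<2^Suc j-1}" for n
    proof -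
      have "real (2 ^ j) \<le> real (n + 1)" "real (n + 1) \<le> real (2 * 2 ^ j)"
        using that by (auto simp only: of_nat_le_iff atLeastLessThan_iff power_Suc)
      then have "2 powr (- \<bar>b\<bar>) * 2 powr (real j * b) \<le> real (n + 1) powr b"
        by (intro powr_dyadic_bounds) (auto simp: powr_realpow)
      moreover have "(tail j / 16) powr r \<le> moment \<mu> n powr r"
        using moment_dyadic_lower[of n j] that r by (intro powr_mono2) auto
      ultimately show ?thesis unfolding w_def by (intro mult_mono) auto
    qed
    then have "(\<Sum>n=2^j-1..<2^Suc j-1::nat. 2 powr (- \<bar>b\<bar>) * 2 powr (real j * b) * (tail j / 16) powr r) \<le> (\<Sum>n=2^j-1..<2^Suc j-1. w n)"
      by (rule sum_mono)
    moreover have "(2 ^ Suc j - 1) - (2 ^ j - 1) = (2 ^ j :: nat)"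
      by simp
    ultimately have "2 ^ j * (2 powr (- \<bar>b\<bar>) * 2 powr (real j * b) * (tail j / 16) powr r) \<le> (\<Sum>n=2^j-1..<2^Suc j-1. w n)"
      by simp
    then have "C * (2 ^ j * (2 powr (- \<bar>b\<bar>) * 2 powr (real j * b) * (tail j / 16) powr r)) \<le> C * (\<Sum>n=2^j-1..<2^Suc j-1. w n)"
      by (intro mult_left_mono) (auto simp: C_def)
    moreover have "C * (2 ^ j * (2 powr (- \<bar>b\<bar>) * 2 powr (real j * b) * (tail j / 16) powr r)) = dyadic_weight \<mu> (\<gamma> - 1/r) j powr r"
    proof -
      have e: "2 ^ j * 2 powr (real j * b) = 2 powr (real j * (\<gamma> - 1/r) * r)"
      proof -
        have "real j + real j * b = real j * (\<gamma> - 1/r) * r" using r by (simp add: b_def algebra_simps)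
        then show ?thesis by (simp add: powr_realpow[symmetric] powr_add[symmetric])
      qed
      have "C * (2 ^ j * (2 powr (- \<bar>b\<bar>) * 2 powr (real j * b) * (tail j / 16) powr r))
          = (2 powr \<bar>b\<bar> * 2 powr (- \<bar>b\<bar>)) * (16 powr r * (tail j / 16) powr r) * (2 ^ j * 2 powr (real j * b))"
        by (simp only: C_def mult_ac)
      also have "2 powr \<bar>b\<bar> * 2 powr (- \<bar>b\<bar>) = 1" by (simp add: powr_add[symmetric])
      also have "16 powr r * (tail j / 16) powr r = tail j powr r" by (simp add: powr_divide)
      finally show ?thesis unfolding e by (simp add: dyadic_weight_eq powr_mult powr_powr mult.commute)
    qed
    ultimately have "dyadic_weight \<mu> (\<gamma> - 1/r) j powr r \<le> C * (\<Sum>n=2^j-1..<2^Suc j-1. w n)" by (simp only:)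
    then have "ennreal (dyadic_weight \<mu> (\<gamma> - 1/r) j powr r) \<le> ennreal (C * (\<Sum>n=2^j-1..<2^Suc j-1. w n))"
      by (rule ennreal_leI)
    also have "\<dots> = ennreal C * ennreal (\<Sum>n=2^j-1..<2^Suc j-1. w n)"
      by (intro ennreal_mult sum_nonneg w0) (simp add: C_def)
    also have "ennreal (\<Sum>n=2^j-1..<2^Suc j-1. w n) = (\<Sum>n=2^j-1..<2^Suc j-1. ennreal (w n))"
      by (intro sum_ennreal[symmetric] w0)
    finally show ?thesis .
  qed
  then have "dyadic_sum \<mu> (\<gamma> - 1/r) r \<le> (\<Sum>j. ennreal C * (\<Sum>n=2^j-1..<2^Suc j-1. ennreal (w n)))"
    by (intro suminf_le allI summableI)
  also have "\<dots> = ennreal C * (\<Sum>j. \<Sum>n=2^j-1..<2^Suc j-1. ennreal (w n))" by (rule ennreal_suminf_cmult)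
  also have "(\<Sum>j. \<Sum>n=2^j-1..<2^Suc j-1. ennreal (w n)) = (\<Sum>n. ennreal (w n))" by (rule suminf_dyadic_blocks[symmetric])
  finally show ?thesis by (simp only: C_def w_def b_def)
qed

end

text \<open>Doubly exponential decay beats the growth 2^(k\<sigma>) whatever \<sigma> is:
  2^(k\<sigma>) exp(-2^k/2) \<le> M 2^-k. The weighted block bounds are thus dominated by a
  geometric convolution of the d_i with rate 1.\<close>

lemma moment_sum_le_dyadic:
  assumes r: "0 < r"
  obtains C :: real where "0 < C" "\<And>\<mu>. unit_measure \<mu> \<Longrightarrow>
    moment_sum \<mu> \<gamma> r
      \<le> ennreal C * dyadic_sum \<mu> (\<gamma> - 1/r) r"
proof -
  define \<sigma> where "\<sigma> = \<gamma> - 1/r"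
  define b where "b = r * \<gamma> - 2"
  obtain C0 :: real where C0: "0 < C0"
    "\<And>(x :: nat \<Rightarrow> real) y A. \<lbrakk>\<And>k. 0 \<le> x k; \<And>i. 0 \<le> y i; \<And>i. finite (A i);
        \<And>i. y i \<le> (\<Sum>k\<in>A i. 2 powr (-1 * \<bar>real i - real k\<bar>) * x k)\<rbrakk>
      \<Longrightarrow> (\<Sum>i. ennreal (y i powr r)) \<le> ennreal C0 * (\<Sum>k. ennreal (x k powr r))"
    by (rule geometric_convolution_bound[OF r zero_less_one]) blast
  \<comment> \<open>The extra 1 in \<sigma> + 1 pays for the factor 2^-k; boundedness of this null
    sequence along x = 2^k yields \<open>M\<close>.\<close>
  have "((\<lambda>x::real. x powr (\<sigma> + 1) * exp (- (x / 2))) \<longlongrightarrow> 0) at_top" by real_asymp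
  moreover have "filterlim (\<lambda>k::nat. 2 powr real k) at_top sequentially" by real_asymp
  ultimately have "(\<lambda>k::nat. (2 powr real k) powr (\<sigma> + 1) * exp (- (2 powr real k / 2))) \<longlonglongrightarrow> 0"
    by (rule filterlim_compose)
  then have "Bseq (\<lambda>k::nat. (2 powr real k) powr (\<sigma> + 1) * exp (- (2 powr real k / 2)))"
    by (intro convergent_imp_Bseq convergentI)
  then obtain M where M: "0 < M" "\<forall>k::nat. norm ((2 powr real k) powr (\<sigma> + 1) * exp (- (2 powr real k / 2))) \<le> M"
    by (rule BseqE)
  show ?thesis
  proof (rule that[of "2 powr \<bar>b\<bar> * (C0 * (2 * M) powr r)"])
    show "0 < 2 powr \<bar>b\<bar> * (C0 * (2 * M) powr r)" using C0(1) M(1) by simp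
    fix \<mu> assume "unit_measure \<mu>"
    then interpret unit_measure \<mu> .
    define d where "d = dyadic_weight \<mu> \<sigma>"
    define w where "w n = real (n + 1) powr b * moment \<mu> n powr r" for n
    have w0: "0 \<le> w n" for n by (simp add: w_def)
    define H where "H j = (\<Sum>i\<le>j. 2 * exp (- (2 powr (real j - real i) / 2)) * tail i)" for j
    have H0: "0 \<le> H j" for j unfolding H_def by (intro sum_nonneg) auto
    define y where "y j = 2 powr (real j * \<sigma>) * H j" for j
    have block: "(\<Sum>n=2^j-1..<2^Suc j-1. ennreal (w n)) \<le> ennreal (2 powr \<bar>b\<bar>) * ennreal (y j powr r)" for j
    proof -
      have "w n \<le> 2 powr \<bar>b\<bar> * 2 powr (real j * b) * H j powr r" if "n \<in> {2^j-1..<2^Suc j-1}" for n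
      proof -
        have "real (2 ^ j) \<le> real (n + 1)" "real (n + 1) \<le> real (2 * 2 ^ j)"
          using that by (auto simp only: of_nat_le_iff atLeastLessThan_iff power_Suc)
        then have "real (n + 1) powr b \<le> 2 powr \<bar>b\<bar> * 2 powr (real j * b)"
          by (intro powr_dyadic_bounds) (auto simp: powr_realpow)
        moreover have "moment \<mu> n powr r \<le> H j powr r"
          unfolding H_def using moment_dyadic_upper[of j n] that r moment_nonneg by (intro powr_mono2) auto
        ultimately show ?thesis unfolding w_def by (intro mult_mono) auto
      qed
      then have "(\<Sum>n=2^j-1..<2^Suc j-1. w n) \<le> (\<Sum>n=2^j-1..<2^Suc j-1::nat. 2 powr \<bar>b\<bar> * 2 powr (real j * b) * H j powr r)"
        by (rule sum_mono)
      also have "\<dots> = real (card {2^j-1..<2^Suc j-1::nat}) * (2 powr \<bar>b\<bar> * 2 powr (real j * b) * H j powr r)"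
        by (rule sum_constant)
      also have "card {2^j-1..<2^Suc j-1::nat} = 2 ^ j" by simp
      also have "real (2 ^ j) * (2 powr \<bar>b\<bar> * 2 powr (real j * b) * H j powr r)
          = 2 powr \<bar>b\<bar> * ((2 ^ j * 2 powr (real j * b)) * H j powr r)"
        by (simp only: mult_ac of_nat_power of_nat_numeral)
      also have "2 ^ j * 2 powr (real j * b) = 2 powr (real j * \<sigma> * r)"
      proof -
        have "real j + real j * b = real j * \<sigma> * r" using r by (simp add: b_def \<sigma>_def algebra_simps)
        then show ?thesis by (simp add: powr_realpow[symmetric] powr_add[symmetric])
      qed
      also have "2 powr (real j * \<sigma> * r) * H j powr r = y j powr r"
        using H0 by (simp add: y_def powr_mult powr_powr)
      finally have "ennreal (\<Sum>n=2^j-1..<2^Suc j-1. w n) \<le> ennreal (2 powr \<bar>b\<bar> * y j powr r)"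
        by (rule ennreal_leI)
      also have "ennreal (\<Sum>n=2^j-1..<2^Suc j-1. w n) = (\<Sum>n=2^j-1..<2^Suc j-1. ennreal (w n))"
        by (intro sum_ennreal[symmetric] w0)
      also have "ennreal (2 powr \<bar>b\<bar> * y j powr r) = ennreal (2 powr \<bar>b\<bar>) * ennreal (y j powr r)"
        by (intro ennreal_mult) auto
      finally show ?thesis .
    qed
    have "(\<Sum>n. ennreal (w n)) = (\<Sum>j. \<Sum>n=2^j-1..<2^Suc j-1. ennreal (w n))" by (rule suminf_dyadic_blocks)
    also have "\<dots> \<le> (\<Sum>j. ennreal (2 powr \<bar>b\<bar>) * ennreal (y j powr r))"
      by (intro suminf_le allI summableI block)
    also have "\<dots> = ennreal (2 powr \<bar>b\<bar>) * (\<Sum>j. ennreal (y j powr r))" by (rule ennreal_suminf_cmult)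
    also have "(\<Sum>j. ennreal (y j powr r)) \<le> ennreal C0 * (\<Sum>k. ennreal ((2 * M * d k) powr r))"
    proof (rule C0(2)[where A = "\<lambda>i. {..i}"])
      fix j
      have "y j = (\<Sum>i\<le>j. 2 powr (real j * \<sigma>) * (2 * exp (- (2 powr (real j - real i) / 2)) * tail i))"
        by (simp only: y_def H_def sum_distrib_left)
      also have "\<dots> \<le> (\<Sum>i\<le>j. 2 powr (-1 * \<bar>real j - real i\<bar>) * (2 * M * d i))"
      proof (rule sum_mono)
        fix i assume "i \<in> {..j}"
        then have ij: "i \<le> j" by simp
        define k where "k = j - i"
        have k: "real j - real i = real k" using ij by (simp add: k_def of_nat_diff)
        have "(2 powr real k) powr (\<sigma> + 1) * exp (- (2 powr real k / 2)) \<le> M"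
          using M(2)[rule_format, of k] by simp
        then have "2 powr (- real k) * ((2 powr real k) powr (\<sigma> + 1) * exp (- (2 powr real k / 2))) \<le> 2 powr (- real k) * M"
          by (intro mult_left_mono) auto
        moreover have "2 powr (- real k) * ((2 powr real k) powr (\<sigma> + 1) * exp (- (2 powr real k / 2)))
            = 2 powr (real k * \<sigma>) * exp (- (2 powr real k / 2))"
        proof -
          have "- real k + real k * (\<sigma> + 1) = real k * \<sigma>" by (simp add: algebra_simps)
          then have "2 powr (- real k) * (2 powr real k) powr (\<sigma> + 1) = 2 powr (real k * \<sigma>)"
            by (simp add: powr_powr powr_add[symmetric])
          then show ?thesis by (simp only: mult.assoc[symmetric])
        qed
        ultimately have "2 powr (real k * \<sigma>) * exp (- (2 powr real k / 2)) \<le> 2 powr (- real k) * M" by (simp only:)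
        then have "(2 powr (real k * \<sigma>) * exp (- (2 powr real k / 2))) * (2 * d i) \<le> (2 powr (- real k) * M) * (2 * d i)"
          by (intro mult_right_mono) (auto simp: d_def)
        moreover have "2 powr (real j * \<sigma>) * (2 * exp (- (2 powr (real j - real i) / 2)) * tail i)
            = (2 powr (real k * \<sigma>) * exp (- (2 powr real k / 2))) * (2 * d i)"
        proof -
          have "real j * \<sigma> = real k * \<sigma> + real i * \<sigma>" using k by (simp add: algebra_simps)
          then have "2 powr (real j * \<sigma>) = 2 powr (real k * \<sigma>) * 2 powr (real i * \<sigma>)" by (simp only: powr_add)
          then show ?thesis unfolding k d_def dyadic_weight_eq by (simp only: mult_ac)
        qed
        moreover have "2 powr (-1 * \<bar>real j - real i\<bar>) * (2 * M * d i) = (2 powr (- real k) * M) * (2 * d i)"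
          unfolding k by simp
        ultimately show "2 powr (real j * \<sigma>) * (2 * exp (- (2 powr (real j - real i) / 2)) * tail i)
            \<le> 2 powr (-1 * \<bar>real j - real i\<bar>) * (2 * M * d i)" by (simp only:)
      qed
      finally show "y j \<le> (\<Sum>i\<le>j. 2 powr (-1 * \<bar>real j - real i\<bar>) * (2 * M * d i))" .
    qed (use M(1) in \<open>auto simp: d_def y_def H0\<close>)
    also have "(\<Sum>k. ennreal ((2 * M * d k) powr r)) = (\<Sum>k. ennreal ((2 * M) powr r) * ennreal (d k powr r))"
    proof (rule suminf_cong)
      fix k
      have "(2 * M * d k) powr r = (2 * M) powr r * d k powr r" by (rule powr_mult)
      then show "ennreal ((2 * M * d k) powr r) = ennreal ((2 * M) powr r) * ennreal (d k powr r)"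
        by (simp only: ennreal_mult powr_ge_zero)
    qed
    also have "\<dots> = ennreal ((2 * M) powr r) * (\<Sum>k. ennreal (d k powr r))" by (rule ennreal_suminf_cmult)
    finally have "(\<Sum>n. ennreal (w n)) \<le> ennreal (2 powr \<bar>b\<bar>) * (ennreal C0 * (ennreal ((2 * M) powr r) * (\<Sum>k. ennreal (d k powr r))))"
      by (simp only: mult_left_mono zero_le simp_thms)
    also have "\<dots> = ennreal (2 powr \<bar>b\<bar> * (C0 * (2 * M) powr r)) * (\<Sum>k. ennreal (d k powr r))"
      using C0(1) by (simp only: ennreal_mult mult.assoc powr_ge_zero less_imp_le mult_nonneg_nonneg)
    finally show "moment_sum \<mu> \<gamma> r
      \<le> ennreal (2 powr \<bar>b\<bar> * (C0 * (2 * M) powr r)) * dyadic_sum \<mu> (\<gamma> - 1/r) r"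
      by (simp only: w_def b_def d_def \<sigma>_def)
  qed
qed

section \<open>The tail integral as a dyadic sum\<close>

context unit_measure begin

lemma dyadic_weight_0: "dyadic_weight \<mu> \<sigma> 0 = tail 0"
  by (simp add: dyadic_weight_eq)

lemma measure_tail_between:
  assumes "1 - 1 / 2 ^ j \<le> t" "t < 1 - 1 / 2 ^ Suc j"
  shows "tail (Suc j) \<le> measure \<mu> {t..<1}" "measure \<mu> {t..<1} \<le> tail j"
proof -
  have "1 / 2 ^ j \<le> (1::real)" by simp
  then have t: "0 \<le> t" using assms by linarith
  show "tail (Suc j) \<le> measure \<mu> {t..<1}" "measure \<mu> {t..<1} \<le> tail j"
    unfolding tail_def using assms by (auto intro!: finite_measure_mono tail_sets t tail_sets')
qed

text \<open>On the j-th dyadic interval 1/(1-t) lies between 2^j and 2^(j+1), and the tail between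
  m_(j+1) and m_j. The lower bound therefore carries the index j + 1, and the shift costs
  2^(-\<sigma>r).\<close>

lemma tail_integrand_bounds:
  assumes t: "1 - 1 / 2 ^ j \<le> t" "t < 1 - 1 / 2 ^ Suc j" and r: "0 < r"
  shows "(measure \<mu> {t..<1} / (1 - t) powr \<sigma>) powr r / (1 - t)
           \<le> 2 powr (\<bar>\<sigma>\<bar> * r) * dyadic_weight \<mu> \<sigma> j powr r * (2 * 2 ^ j)"
    and "2 powr (- \<bar>\<sigma>\<bar> * r - \<sigma> * r) * dyadic_weight \<mu> \<sigma> (Suc j) powr r * 2 ^ j
           \<le> (measure \<mu> {t..<1} / (1 - t) powr \<sigma>) powr r / (1 - t)"
proof -
  define x where "x = 1 / (1 - t)"
  define m where "m = measure \<mu> {t..<1}"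
  have "0 < 1 / (2 ^ Suc j :: real)" by simp
  then have t1: "0 < 1 - t" using t(2) by linarith
  have x: "2 powr real j \<le> x" "x \<le> 2 * 2 powr real j"
    using t t1 by (auto simp: x_def powr_realpow field_simps)
  have eq: "(m / (1 - t) powr \<sigma>) powr r / (1 - t) = (m * x powr \<sigma>) powr r * x"
    using t1 by (simp add: x_def powr_divide)
  have x0: "0 < x" using t1 by (simp add: x_def)
  have m: "tail (Suc j) \<le> m" "m \<le> tail j" "0 \<le> m"
    unfolding m_def using measure_tail_between[OF t] by auto
  have "m * x powr \<sigma> \<le> tail j * (2 powr \<bar>\<sigma>\<bar> * 2 powr (real j * \<sigma>))"
    using m powr_dyadic_bounds(2)[OF x] by (intro mult_mono) auto
  also have "\<dots> = 2 powr \<bar>\<sigma>\<bar> * dyadic_weight \<mu> \<sigma> j" by (simp add: dyadic_weight_eq)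
  finally have "(m * x powr \<sigma>) powr r \<le> (2 powr \<bar>\<sigma>\<bar> * dyadic_weight \<mu> \<sigma> j) powr r"
    using m r by (intro powr_mono2) auto
  also have "\<dots> = 2 powr (\<bar>\<sigma>\<bar> * r) * dyadic_weight \<mu> \<sigma> j powr r" by (simp add: powr_mult powr_powr)
  finally have "(m * x powr \<sigma>) powr r * x \<le> 2 powr (\<bar>\<sigma>\<bar> * r) * dyadic_weight \<mu> \<sigma> j powr r * (2 * 2 ^ j)"
    using x x0 by (intro mult_mono) (auto simp: powr_realpow)
  then show "(measure \<mu> {t..<1} / (1 - t) powr \<sigma>) powr r / (1 - t)
           \<le> 2 powr (\<bar>\<sigma>\<bar> * r) * dyadic_weight \<mu> \<sigma> j powr r * (2 * 2 ^ j)"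
    unfolding eq[unfolded m_def] m_def .
  have "2 powr (- \<bar>\<sigma>\<bar>) * 2 powr (- \<sigma>) * dyadic_weight \<mu> \<sigma> (Suc j) = tail (Suc j) * (2 powr (- \<bar>\<sigma>\<bar>) * 2 powr (real j * \<sigma>))"
  proof -
    have "- \<sigma> + real (Suc j) * \<sigma> = real j * \<sigma>" by (simp add: algebra_simps)
    then have e: "2 powr (real j * \<sigma>) = 2 powr (- \<sigma>) * 2 powr (real (Suc j) * \<sigma>)" by (simp only: powr_add[symmetric])
    show ?thesis unfolding dyadic_weight_eq e by (simp only: mult_ac)
  qed
  also have "\<dots> \<le> m * x powr \<sigma>"
    using m powr_dyadic_bounds(1)[OF x] by (intro mult_mono) auto
  finally have "(2 powr (- \<bar>\<sigma>\<bar>) * 2 powr (- \<sigma>) * dyadic_weight \<mu> \<sigma> (Suc j)) powr r \<le> (m * x powr \<sigma>) powr r"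
    using r by (intro powr_mono2) auto
  moreover have "(2 powr (- \<bar>\<sigma>\<bar>) * 2 powr (- \<sigma>) * dyadic_weight \<mu> \<sigma> (Suc j)) powr r
      = 2 powr (- \<bar>\<sigma>\<bar> * r - \<sigma> * r) * dyadic_weight \<mu> \<sigma> (Suc j) powr r"
  proof -
    have "- \<bar>\<sigma>\<bar> * r - \<sigma> * r = - \<bar>\<sigma>\<bar> * r + - \<sigma> * r" by simp
    then have "2 powr (- \<bar>\<sigma>\<bar> * r - \<sigma> * r) = 2 powr (- \<bar>\<sigma>\<bar> * r) * 2 powr (- \<sigma> * r)" by (simp only: powr_add)
    then show ?thesis by (simp only: powr_mult powr_powr)
  qed
  ultimately have "2 powr (- \<bar>\<sigma>\<bar> * r - \<sigma> * r) * dyadic_weight \<mu> \<sigma> (Suc j) powr r * 2 ^ j \<le> (m * x powr \<sigma>) powr r * x"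
    using x x0 by (intro mult_mono) (auto simp: powr_realpow)
  then show "2 powr (- \<bar>\<sigma>\<bar> * r - \<sigma> * r) * dyadic_weight \<mu> \<sigma> (Suc j) powr r * 2 ^ j
           \<le> (measure \<mu> {t..<1} / (1 - t) powr \<sigma>) powr r / (1 - t)"
    unfolding eq[unfolded m_def] m_def .
qed

lemma emeasure_dyadic_interval:
  "emeasure lborel {1 - 1 / 2 ^ j..<1 - 1 / 2 ^ Suc j :: real} = ennreal (1 / 2 ^ Suc j)"
proof -
  have "1 - 1 / 2 ^ j \<le> (1 - 1 / 2 ^ Suc j :: real)" by (simp add: field_simps)
  then have "emeasure lborel {1 - 1 / 2 ^ j..<1 - 1 / 2 ^ Suc j :: real} = ennreal ((1 - 1 / 2 ^ Suc j) - (1 - 1 / 2 ^ j))"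
    by (rule emeasure_lborel_Ico)
  also have "(1 - 1 / 2 ^ Suc j) - (1 - 1 / 2 ^ j) = (1 / 2 ^ Suc j :: real)" by simp
  finally show ?thesis .
qed

lemma nn_integral_dyadic_steps:
  assumes "\<And>j. 0 \<le> c j"
  shows "(\<integral>\<^sup>+t. (\<Sum>j. ennreal (c j) * indicator {1 - 1 / 2 ^ j..<1 - 1 / 2 ^ Suc j} (t::real)) \<partial>lborel)
    = (\<Sum>j. ennreal (c j / 2 ^ Suc j))"
proof -
  have "(\<integral>\<^sup>+t. (\<Sum>j. ennreal (c j) * indicator {1 - 1 / 2 ^ j..<1 - 1 / 2 ^ Suc j} (t::real)) \<partial>lborel)
      = (\<Sum>j. \<integral>\<^sup>+t. ennreal (c j) * indicator {1 - 1 / 2 ^ j..<1 - 1 / 2 ^ Suc j} (t::real) \<partial>lborel)"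
    by (rule nn_integral_suminf) measurable
  also have "\<dots> = (\<Sum>j. ennreal (c j / 2 ^ Suc j))"
  proof (rule suminf_cong)
    fix j
    have "(\<integral>\<^sup>+t. ennreal (c j) * indicator {1 - 1 / 2 ^ j..<1 - 1 / 2 ^ Suc j} (t::real) \<partial>lborel)
        = ennreal (c j) * ennreal (1 / 2 ^ Suc j)"
      unfolding emeasure_dyadic_interval[symmetric] by (rule nn_integral_cmult_indicator) simp
    also have "\<dots> = ennreal (c j / 2 ^ Suc j)"
      using assms by (subst ennreal_mult[symmetric]) auto
    finally show "(\<integral>\<^sup>+t. ennreal (c j) * indicator {1 - 1 / 2 ^ j..<1 - 1 / 2 ^ Suc j} (t::real) \<partial>lborel)
        = ennreal (c j / 2 ^ Suc j)" .
  qed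
  finally show ?thesis .
qed

lemma tail_integral_le_dyadic:
  assumes r: "0 < r"
  shows "tail_integral \<mu> \<sigma> r \<le> ennreal (2 powr (\<bar>\<sigma>\<bar> * r)) * dyadic_sum \<mu> \<sigma> r"
proof -
  define c where "c j = 2 powr (\<bar>\<sigma>\<bar> * r) * dyadic_weight \<mu> \<sigma> j powr r * (2 * 2 ^ j)" for j
  have c0: "0 \<le> c j" for j by (simp add: c_def)
  have "tail_integral \<mu> \<sigma> r \<le> (\<integral>\<^sup>+t. (\<Sum>j. ennreal (c j) * indicator {1 - 1 / 2 ^ j..<1 - 1 / 2 ^ Suc j} (t::real)) \<partial>lborel)"
    unfolding tail_integral_def
  proof (rule nn_integral_mono)
    fix t :: real
    show "ennreal ((measure \<mu> {t..<1} / (1 - t) powr \<sigma>) powr r / (1 - t)) * indicator {0..<1} t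
        \<le> (\<Sum>j. ennreal (c j) * indicator {1 - 1 / 2 ^ j..<1 - 1 / 2 ^ Suc j} t)"
    proof (cases "t \<in> {0..<1}")
      case True
      then obtain j where j: "1 - 1 / 2 ^ j \<le> t" "t < 1 - 1 / 2 ^ Suc j" by (auto elim: dyadic_interval)
      have "ennreal ((measure \<mu> {t..<1} / (1 - t) powr \<sigma>) powr r / (1 - t)) * indicator {0..<1} t \<le> ennreal (c j)"
        using tail_integrand_bounds(1)[OF j r, of \<sigma>] True by (simp add: c_def ennreal_leI)
      also have "\<dots> = (\<Sum>j\<in>{j}. ennreal (c j) * indicator {1 - 1 / 2 ^ j..<1 - 1 / 2 ^ Suc j} t)"
        using j by (simp add: indicator_def)
      also have "\<dots> \<le> (\<Sum>j. ennreal (c j) * indicator {1 - 1 / 2 ^ j..<1 - 1 / 2 ^ Suc j} t)"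
        by (intro sum_le_suminf) auto
      finally show ?thesis .
    qed simp
  qed
  also have "\<dots> = (\<Sum>j. ennreal (c j / 2 ^ Suc j))" by (rule nn_integral_dyadic_steps[OF c0])
  also have "\<dots> = (\<Sum>j. ennreal (2 powr (\<bar>\<sigma>\<bar> * r)) * ennreal (dyadic_weight \<mu> \<sigma> j powr r))"
    by (intro suminf_cong) (simp add: c_def flip: ennreal_mult)
  also have "\<dots> = ennreal (2 powr (\<bar>\<sigma>\<bar> * r)) * dyadic_sum \<mu> \<sigma> r" by (rule ennreal_suminf_cmult)
  finally show ?thesis .
qed

text \<open>The lower bounds on the integrand reach d_j only for j \<ge> 1, so the mass d_0 =
  \<mu>([0,1)) enters separately; for a point mass at 0 the integral vanishes.\<close>

lemma dyadic_le_tail_integral: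
  assumes r: "0 < r"
  shows "dyadic_sum \<mu> \<sigma> r
    \<le> ennpowr (emeasure \<mu> {0..<1}) r + ennreal (2 powr (\<bar>\<sigma>\<bar> * r + \<sigma> * r + 1)) * tail_integral \<mu> \<sigma> r"
proof -
  define c where "c j = 2 powr (- \<bar>\<sigma>\<bar> * r - \<sigma> * r) * dyadic_weight \<mu> \<sigma> (Suc j) powr r * 2 ^ j" for j
  have c0: "0 \<le> c j" for j by (simp add: c_def)
  define A where "A = 2 powr (\<bar>\<sigma>\<bar> * r + \<sigma> * r + 1)"
  have "(\<integral>\<^sup>+t. (\<Sum>j. ennreal (c j) * indicator {1 - 1 / 2 ^ j..<1 - 1 / 2 ^ Suc j} (t::real)) \<partial>lborel) \<le> tail_integral \<mu> \<sigma> r"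
    unfolding tail_integral_def
  proof (rule nn_integral_mono)
    fix t :: real
    show "(\<Sum>j. ennreal (c j) * indicator {1 - 1 / 2 ^ j..<1 - 1 / 2 ^ Suc j} t)
        \<le> ennreal ((measure \<mu> {t..<1} / (1 - t) powr \<sigma>) powr r / (1 - t)) * indicator {0..<1} t"
    proof (cases "\<exists>j. t \<in> {1 - 1 / 2 ^ j..<1 - 1 / 2 ^ Suc j}")
      case True
      then obtain j :: nat where j: "1 - 1 / 2 ^ j \<le> t" "t < 1 - 1 / 2 ^ Suc j" by auto
      have "t \<notin> {1 - 1 / 2 ^ k..<1 - 1 / 2 ^ Suc k}" if "k \<noteq> j" for k
      proof (cases "k < j")
        case True
        then have "(2::real) ^ Suc k \<le> 2 ^ j" by (intro power_increasing) auto
        then have "1 / 2 ^ j \<le> (1 / 2 ^ Suc k :: real)" by (intro divide_left_mono) auto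
        then show ?thesis using j by auto
      next
        case False
        then have "(2::real) ^ Suc j \<le> 2 ^ k" using that by (intro power_increasing) auto
        then have "1 / 2 ^ k \<le> (1 / 2 ^ Suc j :: real)" by (intro divide_left_mono) auto
        then show ?thesis using j by auto
      qed
      then have "(\<Sum>j. ennreal (c j) * indicator {1 - 1 / 2 ^ j..<1 - 1 / 2 ^ Suc j} t)
          = (\<Sum>j\<in>{j}. ennreal (c j) * indicator {1 - 1 / 2 ^ j..<1 - 1 / 2 ^ Suc j} t)"
        by (intro suminf_finite) auto
      also have "\<dots> = ennreal (c j)" using j by (simp add: indicator_def)
      also have "\<dots> \<le> ennreal ((measure \<mu> {t..<1} / (1 - t) powr \<sigma>) powr r / (1 - t))"
        unfolding c_def by (intro ennreal_leI tail_integrand_bounds(2)[OF j r])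
      also have "\<dots> = \<dots> * indicator {0..<1} t"
      proof -
        have "1 / 2 ^ j \<le> (1::real)" by simp
        then have "0 \<le> t" using j(1) by linarith
        moreover have "0 < 1 / (2 ^ Suc j :: real)" by simp
        then have "t < 1" using j(2) by linarith
        ultimately show ?thesis by simp
      qed
      finally show ?thesis .
    next
      case False
      then show ?thesis by simp
    qed
  qed
  then have TI: "(\<Sum>j. ennreal (c j / 2 ^ Suc j)) \<le> tail_integral \<mu> \<sigma> r"
    unfolding nn_integral_dyadic_steps[OF c0] .
  have "dyadic_sum \<mu> \<sigma> r
      = (\<Sum>j. ennreal (dyadic_weight \<mu> \<sigma> (j + 1) powr r)) + (\<Sum>j<1. ennreal (dyadic_weight \<mu> \<sigma> j powr r))"
    by (rule suminf_offset) simp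
  also have "(\<Sum>j<1. ennreal (dyadic_weight \<mu> \<sigma> j powr r)) = ennpowr (emeasure \<mu> {0..<1}) r"
    using emeasure_tail[of 0] by (simp add: dyadic_weight_0)
  also have "(\<Sum>j. ennreal (dyadic_weight \<mu> \<sigma> (j + 1) powr r)) = (\<Sum>j. ennreal A * ennreal (c j / 2 ^ Suc j))"
  proof (rule suminf_cong)
    fix j
    have "A * 2 powr (- \<bar>\<sigma>\<bar> * r - \<sigma> * r) = 2 powr ((\<bar>\<sigma>\<bar> * r + \<sigma> * r + 1) + (- \<bar>\<sigma>\<bar> * r - \<sigma> * r))"
      unfolding A_def by (rule powr_add[symmetric])
    also have "(\<bar>\<sigma>\<bar> * r + \<sigma> * r + 1) + (- \<bar>\<sigma>\<bar> * r - \<sigma> * r) = 1" by (simp add: algebra_simps)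
    finally have A: "A * 2 powr (- \<bar>\<sigma>\<bar> * r - \<sigma> * r) = 2" by simp
    have "A * (c j / 2 ^ Suc j) = (A * 2 powr (- \<bar>\<sigma>\<bar> * r - \<sigma> * r)) * dyadic_weight \<mu> \<sigma> (Suc j) powr r * (2 ^ j / 2 ^ Suc j)"
      unfolding c_def divide_inverse by (simp only: mult_ac)
    also have "\<dots> = dyadic_weight \<mu> \<sigma> (Suc j) powr r" unfolding A by simp
    finally show "ennreal (dyadic_weight \<mu> \<sigma> (j + 1) powr r) = ennreal A * ennreal (c j / 2 ^ Suc j)"
      using c0 by (subst ennreal_mult[symmetric]) (auto simp: A_def)
  qed
  also have "\<dots> = ennreal A * (\<Sum>j. ennreal (c j / 2 ^ Suc j))" by (rule ennreal_suminf_cmult)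
  also have "\<dots> + ennpowr (emeasure \<mu> {0..<1}) r \<le> ennreal A * tail_integral \<mu> \<sigma> r + ennpowr (emeasure \<mu> {0..<1}) r"
    by (intro add_right_mono mult_left_mono TI) auto
  finally show ?thesis by (simp add: A_def add.commute)
qed

lemma mass_le_dyadic: "ennpowr (emeasure \<mu> {0..<1}) r \<le> dyadic_sum \<mu> \<sigma> r"
proof -
  have "ennpowr (emeasure \<mu> {0..<1}) r = (\<Sum>j\<in>{0}. ennreal (dyadic_weight \<mu> \<sigma> j powr r))"
    using emeasure_tail[of 0] by (simp add: dyadic_weight_0)
  also have "\<dots> \<le> dyadic_sum \<mu> \<sigma> r"
    by (intro sum_le_suminf) auto
  finally show ?thesis .
qed

end

subsection \<open>Equivalence of the norms\<close>

lemma ennpowr_root_le: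
  assumes "X \<le> ennreal c * Y" "0 \<le> c" "0 < r"
  shows "ennpowr X (1/r) \<le> ennreal (c powr (1/r)) * ennpowr Y (1/r)"
proof -
  have "ennpowr X (1/r) \<le> ennpowr (ennreal c * Y) (1/r)" using assms by (intro ennpowr_mono) auto
  then show ?thesis using assms by (simp add: ennpowr_mult)
qed

lemma ennreal_le_trans_mult:
  assumes "X \<le> ennreal a * Y" "Y \<le> ennreal b * Z" "0 \<le> a" "0 \<le> b"
  shows "X \<le> ennreal (a * b) * Z"
proof -
  have "ennreal a * Y \<le> ennreal a * (ennreal b * Z)" by (rule mult_left_mono[OF assms(2)]) simp
  with assms(1) have "X \<le> ennreal a * (ennreal b * Z)" by (rule order_trans)
  also have "\<dots> = ennreal (a * b) * Z" using assms(3,4) by (simp only: ennreal_mult mult.assoc)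
  finally show ?thesis .
qed

lemma ennreal_cancel_left: "0 < c \<Longrightarrow> ennreal (1 / c) * (ennreal c * X) = X" "0 < c \<Longrightarrow> ennreal c * (ennreal (1 / c) * X) = X"
proof -
  assume c: "0 < c"
  have "ennreal (1 / c) * ennreal c = ennreal (1 / c * c)" using c by (intro ennreal_mult[symmetric]) auto
  then have "ennreal (1 / c) * ennreal c = 1" using c by simp
  then show "ennreal (1 / c) * (ennreal c * X) = X" "ennreal c * (ennreal (1 / c) * X) = X"
    by (metis mult.assoc mult.commute mult_1)+
qed

lemma comparableI:
  assumes "0 < C" "X \<le> ennreal C * Y" "Y \<le> ennreal C * X"
  shows "comparable C X Y"
proof -
  have "ennreal (1 / C) * Y \<le> ennreal (1 / C) * (ennreal C * X)" using assms(3) by (rule mult_left_mono) simp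
  also have "\<dots> = X" by (rule ennreal_cancel_left[OF assms(1)])
  finally show ?thesis using assms(2) by (simp add: comparable_def)
qed

lemma suminf_ennreal_finite_iff:
  fixes f :: "nat \<Rightarrow> real"
  assumes "\<And>n. 0 \<le> f n"
  shows "(\<Sum>n. ennreal (f n)) < top \<longleftrightarrow> summable f"
proof
  assume "(\<Sum>n. ennreal (f n)) < top"
  then show "summable f" by (intro summable_suminf_not_top assms) simp
next
  assume "summable f"
  then have "(\<Sum>n. ennreal (f n)) \<noteq> top" by (rule ennreal_suminf_neq_top) (rule assms)
  then show "(\<Sum>n. ennreal (f n)) < top" by (simp only: less_top)
qed

lemma finite_of_le_mult: "X \<le> ennreal a * Y \<Longrightarrow> Y < top \<Longrightarrow> X < top"
  by (rule le_less_trans[of _ "ennreal a * Y"]) (auto simp: ennreal_mult_less_top)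

context exponents begin

lemma opnorm_le_potential:
  obtains a :: real where "0 < a" "\<And>\<mu>. unit_measure \<mu> \<Longrightarrow>
    hardy_opnorm p (ennreal q) (cesaro \<mu> \<gamma>)
      \<le> ennreal a * ennpowr (potential_int \<mu> \<gamma> r) (1/r)"
proof -
  obtain K :: real where K: "0 < K" "\<And>\<mu> f. \<lbrakk>unit_measure \<mu>; f holomorphic_on ball 0 1\<rbrakk> \<Longrightarrow>
    hardy_norm (ennreal q) (cesaro \<mu> \<gamma> f)
      \<le> ennreal K * ennpowr (potential_int \<mu> \<gamma> r) (1 / r) * hardy_norm p f"
    by (rule cesaro_hardy_norm_le) blast
  show ?thesis
  proof (rule that[OF K(1)])
    fix \<mu> assume \<mu>: "unit_measure \<mu>"
    show "hardy_opnorm p (ennreal q) (cesaro \<mu> \<gamma>)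
      \<le> ennreal K * ennpowr (potential_int \<mu> \<gamma> r) (1/r)"
      unfolding hardy_opnorm_def
    proof (rule Inf_lower, rule CollectI, rule ballI)
      fix f assume "f \<in> hardy p"
      then have "f holomorphic_on ball 0 1" by (simp add: hardy_def)
      then show "hardy_norm (ennreal q) (cesaro \<mu> \<gamma> f)
          \<le> ennreal K * ennpowr (potential_int \<mu> \<gamma> r) (1/r) * hardy_norm p f"
        by (rule K(2)[OF \<mu>])
    qed
  qed
qed

text \<open>The bound is proved for each admissible constant, finite or not, and then passes to the
  infimum.\<close>

lemma dyadic_le_opnorm:
  obtains b :: real where "0 < b" "\<And>\<mu>. unit_measure \<mu> \<Longrightarrow>
    ennpowr (dyadic_sum \<mu> (\<gamma> - 1/r) r) (1/r)
      \<le> ennreal b * hardy_opnorm p (ennreal q) (cesaro \<mu> \<gamma>)"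
proof -
  obtain C :: real where C: "0 < C" "\<And>\<mu> B. \<lbrakk>unit_measure \<mu>;
      \<And>f. f \<in> hardy p \<Longrightarrow> hardy_norm p f \<le> 1 \<Longrightarrow> hardy_norm (ennreal q) (cesaro \<mu> \<gamma> f) \<le> B\<rbrakk> \<Longrightarrow>
    dyadic_sum \<mu> (\<gamma> - 1/r) r \<le> ennreal C * ennpowr B r"
    by (rule dyadic_le_unit_ball_bound) blast
  define b where "b = C powr (1/r)"
  have b: "0 < b" using C(1) by (simp add: b_def)
  show ?thesis
  proof (rule that[OF b])
    fix \<mu> assume \<mu>: "unit_measure \<mu>"
    define \<delta> where "\<delta> = ennpowr (dyadic_sum \<mu> (\<gamma> - 1/r) r) (1/r)"
    have "ennreal (1 / b) * \<delta> \<le> hardy_opnorm p (ennreal q) (cesaro \<mu> \<gamma>)"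
      unfolding hardy_opnorm_def
    proof (rule Inf_greatest, safe)
      fix B assume B: "\<forall>f\<in>hardy p. hardy_norm (ennreal q) (cesaro \<mu> \<gamma> f) \<le> B * hardy_norm p f"
      have "dyadic_sum \<mu> (\<gamma> - 1/r) r \<le> ennreal C * ennpowr B r"
      proof (rule C(2)[OF \<mu>])
        fix f assume f: "f \<in> hardy p" "hardy_norm p f \<le> 1"
        have "hardy_norm (ennreal q) (cesaro \<mu> \<gamma> f) \<le> B * hardy_norm p f" using B f by blast
        also have "\<dots> \<le> B * 1" by (intro mult_left_mono f) simp
        finally show "hardy_norm (ennreal q) (cesaro \<mu> \<gamma> f) \<le> B" by simp
      qed
      then have "\<delta> \<le> ennreal b * ennpowr (ennpowr B r) (1/r)"
        unfolding \<delta>_def b_def using C(1) r_pos by (intro ennpowr_root_le) auto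
      then have "\<delta> \<le> ennreal b * B" using r_pos by simp
      then have "ennreal (1 / b) * \<delta> \<le> ennreal (1 / b) * (ennreal b * B)" by (rule mult_left_mono) simp
      also have "\<dots> = B" by (rule ennreal_cancel_left[OF b])
      finally show "ennreal (1 / b) * \<delta> \<le> B" .
    qed
    then have "ennreal b * (ennreal (1 / b) * \<delta>) \<le> ennreal b * hardy_opnorm p (ennreal q) (cesaro \<mu> \<gamma>)"
      by (rule mult_left_mono) simp
    then show "\<delta> \<le> ennreal b * hardy_opnorm p (ennreal q) (cesaro \<mu> \<gamma>)"
      unfolding ennreal_cancel_left[OF b] .
  qed
qed

text \<open>Up to constants P \<le> D, F \<le> P and D \<le> F form a cycle, while the moments and
  the tail integral are compared with D directly. Powers are compared here; the roots are left to
  the final theorem.\<close>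

lemma quantities_comparable_to_dyadic:
  obtains A :: real where "0 < A" "\<And>\<mu> D F P M T. \<lbrakk>unit_measure \<mu>;
      D = dyadic_sum \<mu> (\<gamma> - 1/r) r;
      F = hardy_int r (F_fun \<mu> \<gamma>);
      P = potential_int \<mu> \<gamma> r;
      M = moment_sum \<mu> \<gamma> r;
      T = ennpowr (emeasure \<mu> {0..<1}) r + tail_integral \<mu> (\<gamma> - 1/r) r\<rbrakk> \<Longrightarrow>
    F \<le> ennreal A * D \<and> D \<le> ennreal A * F \<and> P \<le> ennreal A * D \<and> D \<le> ennreal A * P \<and>
    M \<le> ennreal A * D \<and> D \<le> ennreal A * M \<and> T \<le> ennreal A * D \<and> D \<le> ennreal A * T"
proof -
  note r = r_pos
  define \<sigma> where "\<sigma> = \<gamma> - 1/r"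
  obtain C1 :: real where C1: "0 < C1" "\<And>\<mu>. unit_measure \<mu> \<Longrightarrow>
    potential_int \<mu> \<gamma> r \<le> ennreal C1 * dyadic_sum \<mu> (\<gamma> - 1/r) r"
    by (rule potential_le_dyadic[OF r \<gamma>]) blast
  obtain C4 :: real where C4: "0 < C4" "\<And>\<mu>. unit_measure \<mu> \<Longrightarrow>
    moment_sum \<mu> \<gamma> r
      \<le> ennreal C4 * dyadic_sum \<mu> (\<gamma> - 1/r) r"
    by (rule moment_sum_le_dyadic[OF r]) blast
  define C2 where "C2 = 2 powr (\<gamma> * r)"
  define C3 where "C3 = 2 powr (\<gamma> * r) * (1327104 * pi)"
  define C5 where "C5 = 2 powr \<bar>r * \<gamma> - 2\<bar> * 16 powr r"
  define C6 where "C6 = 2 powr (\<bar>\<sigma>\<bar> * r)"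
  define C7 where "C7 = 2 powr (\<bar>\<sigma>\<bar> * r + \<sigma> * r + 1)"
  have pos: "0 < C2" "0 < C3" "0 < C5" "0 < C6" "0 < C7"
    by (simp_all add: C2_def C3_def C5_def C6_def C7_def)
  define A where "A = C1 + C2 * C1 + C3 + C3 * C2 + C4 + C5 + (1 + C6) + (1 + C7)"
  have A0: "0 \<le> C2 * C1" "0 \<le> C3 * C2" using pos C1(1) by simp_all
  have le: "C1 \<le> A" "C2 * C1 \<le> A" "C3 \<le> A" "C3 * C2 \<le> A" "C4 \<le> A" "C5 \<le> A" "1 + C6 \<le> A" "1 + C7 \<le> A"
    unfolding A_def using pos C1(1) C4(1) A0 by linarith+
  have up: "X \<le> ennreal A * Y" if "X \<le> ennreal a * Y" "a \<le> A" for X Y a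
    using that(1) mult_right_mono[OF ennreal_leI[OF that(2)], of Y] by (rule order_trans) simp
  show ?thesis
  proof (rule that[of A])
    show "0 < A" using le(1) C1(1) by linarith
    fix \<mu> D F P M T
    assume \<mu>: "unit_measure \<mu>" and D: "D = dyadic_sum \<mu> (\<gamma> - 1/r) r"
      and F: "F = hardy_int r (F_fun \<mu> \<gamma>)"
      and P: "P = potential_int \<mu> \<gamma> r"
      and M: "M = moment_sum \<mu> \<gamma> r"
      and T: "T = ennpowr (emeasure \<mu> {0..<1}) r + tail_integral \<mu> (\<gamma> - 1/r) r"
    interpret unit_measure \<mu> by (rule \<mu>)
    have PD: "P \<le> ennreal C1 * D" unfolding P D by (rule C1(2)[OF \<mu>])
    have FP: "F \<le> ennreal C2 * P" unfolding F P C2_def by (rule hardy_int_F_le[OF \<gamma> r])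
    have DF: "D \<le> ennreal C3 * F" unfolding D F C3_def by (rule dyadic_le_hardy_int_F[OF \<gamma> r])
    have MD: "M \<le> ennreal C4 * D" unfolding M D by (rule C4(2)[OF \<mu>])
    have DM: "D \<le> ennreal C5 * M" unfolding M D C5_def by (rule moment_sum_ge_dyadic[OF r])
    have "T \<le> D + ennreal C6 * D"
      unfolding T D C6_def \<sigma>_def by (intro add_mono mass_le_dyadic tail_integral_le_dyadic r)
    also have "\<dots> = ennreal (1 + C6) * D"
      using pos by (simp add: distrib_right)
    finally have TD: "T \<le> ennreal (1 + C6) * D" .
    have "D \<le> ennpowr (emeasure \<mu> {0..<1}) r + ennreal C7 * tail_integral \<mu> (\<gamma> - 1/r) r"
      unfolding D C7_def \<sigma>_def by (rule dyadic_le_tail_integral[OF r])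
    also have "\<dots> \<le> T + ennreal C7 * T"
      unfolding T by (intro add_mono mult_left_mono) auto
    also have "\<dots> = ennreal (1 + C7) * T"
      using pos by (simp add: distrib_right)
    finally have DT: "D \<le> ennreal (1 + C7) * T" .
    have FD: "F \<le> ennreal (C2 * C1) * D"
      using FP PD pos(1) C1(1) by (intro ennreal_le_trans_mult) auto
    have DP: "D \<le> ennreal (C3 * C2) * P"
      using DF FP pos(1,2) by (intro ennreal_le_trans_mult) auto
    show "F \<le> ennreal A * D \<and> D \<le> ennreal A * F \<and> P \<le> ennreal A * D \<and> D \<le> ennreal A * P \<and>
      M \<le> ennreal A * D \<and> D \<le> ennreal A * M \<and> T \<le> ennreal A * D \<and> D \<le> ennreal A * T"
      using up[OF FD le(2)] up[OF DF le(3)] up[OF PD le(1)] up[OF DP le(4)] up[OF MD le(5)] up[OF DM le(6)]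
        up[OF TD le(7)] up[OF DT le(8)] by blast
  qed
qed

text \<open>Boundedness and compactness each bound the images of the unit ball, and hence the dyadic
  sum. Conversely a finite sum makes the potential integral finite, from which both properties
  follow.\<close>

lemma bounded_compact_iff_dyadic:
  assumes \<mu>: "unit_measure \<mu>"
  defines "D \<equiv> dyadic_sum \<mu> (\<gamma> - 1/r) r"
  shows "bounded_hardy p (ennreal q) (cesaro \<mu> \<gamma>) \<longleftrightarrow> D < top"
    and "compact_hardy p (ennreal q) (cesaro \<mu> \<gamma>) \<longleftrightarrow> D < top"
proof -
  interpret unit_measure \<mu> by (rule \<mu>)
  obtain C :: real where C: "0 < C" "\<And>\<mu> B. \<lbrakk>unit_measure \<mu>;
      \<And>f. f \<in> hardy p \<Longrightarrow> hardy_norm p f \<le> 1 \<Longrightarrow> hardy_norm (ennreal q) (cesaro \<mu> \<gamma> f) \<le> B\<rbrakk> \<Longrightarrow>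
    dyadic_sum \<mu> (\<gamma> - 1/r) r \<le> ennreal C * ennpowr B r"
    by (rule dyadic_le_unit_ball_bound) blast
  have unit: "D < top" if "\<And>f. f \<in> hardy p \<Longrightarrow> hardy_norm p f \<le> 1 \<Longrightarrow> hardy_norm (ennreal q) (cesaro \<mu> \<gamma> f) \<le> ennreal B" for B
    using C(2)[OF \<mu> that] unfolding D_def by (rule finite_of_le_mult) simp_all
  obtain K :: real where K: "0 < K" "\<And>\<mu> f. \<lbrakk>unit_measure \<mu>; f holomorphic_on ball 0 1\<rbrakk> \<Longrightarrow>
    hardy_norm (ennreal q) (cesaro \<mu> \<gamma> f)
      \<le> ennreal K * ennpowr (potential_int \<mu> \<gamma> r) (1 / r) * hardy_norm p f"
    by (rule cesaro_hardy_norm_le) blast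
  obtain C1 :: real where C1: "\<And>\<mu>. unit_measure \<mu> \<Longrightarrow>
    potential_int \<mu> \<gamma> r \<le> ennreal C1 * dyadic_sum \<mu> (\<gamma> - 1/r) r"
    by (rule potential_le_dyadic[OF r_pos \<gamma>]) blast
  define P where "P = potential_int \<mu> \<gamma> r"
  have Pfin: "P < top" if "D < top"
    unfolding P_def using C1[OF \<mu>] that unfolding D_def by (rule finite_of_le_mult)
  have bd: "bounded_hardy p (ennreal q) (cesaro \<mu> \<gamma>)" if "D < top"
  proof -
    have "ennreal K * ennpowr P (1/r) < top" using Pfin[OF that] by (simp add: ennreal_mult_less_top)
    then obtain B where B: "ennreal K * ennpowr P (1/r) = ennreal B" "0 \<le> B"
      by (metis ennreal_cases less_irrefl)
    have le: "hardy_norm (ennreal q) (cesaro \<mu> \<gamma> f) \<le> ennreal B * hardy_norm p f" if "f \<in> hardy p" for f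
      using K(2)[OF \<mu>, of f] that B(1) by (simp add: hardy_def P_def)
    moreover have "cesaro \<mu> \<gamma> f \<in> hardy (ennreal q)" if "f \<in> hardy p" for f
      using le[OF that] that cesaro_holomorphic[of f \<gamma>] \<gamma>
      by (auto simp: hardy_def ennreal_mult_less_top intro: le_less_trans)
    ultimately show ?thesis unfolding bounded_hardy_def by blast
  qed
  have bd': "D < top" if bh: "bounded_hardy p (ennreal q) (cesaro \<mu> \<gamma>)"
  proof -
    obtain B :: real where B: "\<forall>f\<in>hardy p. hardy_norm (ennreal q) (cesaro \<mu> \<gamma> f) \<le> ennreal B * hardy_norm p f"
      using bh unfolding bounded_hardy_def by blast
    show ?thesis
    proof (rule unit[of B])
      fix f assume f: "f \<in> hardy p" "hardy_norm p f \<le> 1"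
      have "ennreal B * hardy_norm p f \<le> ennreal B * 1" by (intro mult_left_mono f) simp
      then show "hardy_norm (ennreal q) (cesaro \<mu> \<gamma> f) \<le> ennreal B"
        using bspec[OF B f(1)] by (auto intro: order_trans)
    qed
  qed
  show "bounded_hardy p (ennreal q) (cesaro \<mu> \<gamma>) \<longleftrightarrow> D < top" using bd bd' by blast
  show "compact_hardy p (ennreal q) (cesaro \<mu> \<gamma>) \<longleftrightarrow> D < top"
  proof
    assume "D < top"
    then show "compact_hardy p (ennreal q) (cesaro \<mu> \<gamma>)"
      using bd Pfin unfolding P_def bounded_hardy_def by (intro cesaro_compact[OF \<mu>]) auto
  next
    assume c: "compact_hardy p (ennreal q) (cesaro \<mu> \<gamma>)"
    obtain B :: real where "\<And>f. f \<in> hardy p \<Longrightarrow> hardy_norm p f \<le> 1 \<Longrightarrow> hardy_norm (ennreal q) (cesaro \<mu> \<gamma> f) \<le> ennreal B"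
      by (rule compact_hardy_bounded_unit_ball[OF q c]) blast
    then show "D < top" by (rule unit)
  qed
qed

end

theorem theorem1p2:
  fixes p :: ennreal and q \<gamma> r \<sigma> :: real
  assumes "0 < q" and "ennreal q < p" and "0 < \<gamma>"
    and "1 / r = 1 / q - enn2real (1 / p)"
    and "\<sigma> = \<gamma> - 1 / r"
  shows
   "(\<forall>\<mu>. unit_interval_measure \<mu> \<longrightarrow>
       (bounded_hardy p (ennreal q) (cesaro \<mu> \<gamma>) \<longleftrightarrow> compact_hardy p (ennreal q) (cesaro \<mu> \<gamma>)) \<and>
       (bounded_hardy p (ennreal q) (cesaro \<mu> \<gamma>) \<longleftrightarrow> summable (\<lambda>j. dyadic_weight \<mu> \<sigma> j powr r)) \<and>
       (bounded_hardy p (ennreal q) (cesaro \<mu> \<gamma>) \<longleftrightarrow> tail_integral \<mu> \<sigma> r < \<infinity>) \<and>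
       (bounded_hardy p (ennreal q) (cesaro \<mu> \<gamma>) \<longleftrightarrow> potential \<mu> \<gamma> \<in> circle_L r) \<and>
       (bounded_hardy p (ennreal q) (cesaro \<mu> \<gamma>) \<longleftrightarrow> F_fun \<mu> \<gamma> \<in> hardy (ennreal r)) \<and>
       (bounded_hardy p (ennreal q) (cesaro \<mu> \<gamma>) \<longleftrightarrow>
          summable (\<lambda>n. real (n + 1) powr (r * \<gamma> - 2) * moment \<mu> n powr r))) \<and>
    (\<exists>C>0. \<forall>\<mu>. unit_interval_measure \<mu> \<longrightarrow>
       comparable C (hardy_opnorm p (ennreal q) (cesaro \<mu> \<gamma>))
                    (hardy_norm (ennreal r) (F_fun \<mu> \<gamma>)) \<and>
       comparable C (hardy_norm (ennreal r) (F_fun \<mu> \<gamma>))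
                    (circle_norm r (potential \<mu> \<gamma>)) \<and>
       comparable C (circle_norm r (potential \<mu> \<gamma>))
                    (ennpowr (\<Sum>j. ennreal (dyadic_weight \<mu> \<sigma> j powr r)) (1 / r)) \<and>
       comparable C (ennpowr (\<Sum>j. ennreal (dyadic_weight \<mu> \<sigma> j powr r)) (1 / r))
                    (ennpowr (\<Sum>n. ennreal (real (n + 1) powr (r * \<gamma> - 2) * moment \<mu> n powr r)) (1 / r)) \<and>
       comparable C (ennpowr (\<Sum>n. ennreal (real (n + 1) powr (r * \<gamma> - 2) * moment \<mu> n powr r)) (1 / r))
                    (ennpowr (ennpowr (emeasure \<mu> {0..<1}) r + tail_integral \<mu> \<sigma> r) (1 / r)))"
proof -
  interpret exponents p q \<gamma> r
    using assms(1-4) by unfold_locales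
  note r = r_pos
  define D where "D \<mu> = dyadic_sum \<mu> \<sigma> r" for \<mu>
  define F where "F \<mu> = hardy_int r (F_fun \<mu> \<gamma>)" for \<mu>
  define P where "P \<mu> = potential_int \<mu> \<gamma> r" for \<mu>
  define M where "M \<mu> = moment_sum \<mu> \<gamma> r" for \<mu>
  define T where "T \<mu> = ennpowr (emeasure \<mu> {0..<1}) r + tail_integral \<mu> \<sigma> r" for \<mu>
  obtain A :: real where A: "0 < A" and cmp: "\<And>\<mu>. unit_measure \<mu> \<Longrightarrow>
    F \<mu> \<le> ennreal A * D \<mu> \<and> D \<mu> \<le> ennreal A * F \<mu> \<and> P \<mu> \<le> ennreal A * D \<mu> \<and> D \<mu> \<le> ennreal A * P \<mu> \<and>
    M \<mu> \<le> ennreal A * D \<mu> \<and> D \<mu> \<le> ennreal A * M \<mu> \<and> T \<mu> \<le> ennreal A * D \<mu> \<and> D \<mu> \<le> ennreal A * T \<mu>"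
    by (rule quantities_comparable_to_dyadic) (simp add: D_def F_def P_def M_def T_def assms(5))
  have hF: "hardy_norm (ennreal r) (F_fun \<mu> \<gamma>) = ennpowr (F \<mu>) (1/r)" if "unit_measure \<mu>" for \<mu>
    unfolding F_def using unit_measure.F_fun_holomorphic[OF that \<gamma>] r
    by (intro hardy_norm_eq holomorphic_on_imp_continuous_on)
  have cP: "circle_norm r (potential \<mu> \<gamma>) = ennpowr (P \<mu>) (1/r)" if "unit_measure \<mu>" for \<mu>
    unfolding P_def using unit_measure.potential_measurable[OF that] by (rule circle_norm_arc)
  show ?thesis
  proof (intro conjI allI impI)
    fix \<mu> assume "unit_interval_measure \<mu>"
    then have \<mu>: "unit_measure \<mu>" by (simp add: unit_measure_iff)
    interpret unit_measure \<mu> by (rule \<mu>)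
    have bD: "bounded_hardy p (ennreal q) (cesaro \<mu> \<gamma>) \<longleftrightarrow> D \<mu> < top"
      and cD: "compact_hardy p (ennreal q) (cesaro \<mu> \<gamma>) \<longleftrightarrow> D \<mu> < top"
      using bounded_compact_iff_dyadic[OF \<mu>] by (simp_all add: D_def assms(5))
    note cm = cmp[OF \<mu>]
    show "bounded_hardy p (ennreal q) (cesaro \<mu> \<gamma>) \<longleftrightarrow> compact_hardy p (ennreal q) (cesaro \<mu> \<gamma>)"
      by (simp add: bD cD)
    show "bounded_hardy p (ennreal q) (cesaro \<mu> \<gamma>) \<longleftrightarrow> summable (\<lambda>j. dyadic_weight \<mu> \<sigma> j powr r)"
      unfolding bD D_def by (rule suminf_ennreal_finite_iff) simp
    show "bounded_hardy p (ennreal q) (cesaro \<mu> \<gamma>) \<longleftrightarrow> tail_integral \<mu> \<sigma> r < \<infinity>"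
    proof -
      have "D \<mu> < top \<longleftrightarrow> T \<mu> < top" using cm finite_of_le_mult by blast
      \<comment> \<open>The mass is finite, so the integral alone decides.\<close>
      also have "T \<mu> < top \<longleftrightarrow> tail_integral \<mu> \<sigma> r < top"
        using emeasure_tail[of 0] by (simp add: T_def)
      finally show ?thesis by (simp add: bD)
    qed
    show "bounded_hardy p (ennreal q) (cesaro \<mu> \<gamma>) \<longleftrightarrow> potential \<mu> \<gamma> \<in> circle_L r"
    proof -
      have "D \<mu> < top \<longleftrightarrow> P \<mu> < top" using cm finite_of_le_mult by blast
      then show ?thesis by (simp add: bD circle_L_def cP[OF \<mu>])
    qed
    show "bounded_hardy p (ennreal q) (cesaro \<mu> \<gamma>) \<longleftrightarrow> F_fun \<mu> \<gamma> \<in> hardy (ennreal r)"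
    proof -
      have "D \<mu> < top \<longleftrightarrow> F \<mu> < top" using cm finite_of_le_mult by blast
      then show ?thesis by (simp add: bD hardy_def hF[OF \<mu>] F_fun_holomorphic \<gamma>)
    qed
    show "bounded_hardy p (ennreal q) (cesaro \<mu> \<gamma>) \<longleftrightarrow>
          summable (\<lambda>n. real (n + 1) powr (r * \<gamma> - 2) * moment \<mu> n powr r)"
    proof -
      have "D \<mu> < top \<longleftrightarrow> M \<mu> < top" using cm finite_of_le_mult by blast
      then show ?thesis unfolding bD M_def by (simp only:) (rule suminf_ennreal_finite_iff, simp)
    qed
  next
    obtain a :: real where a: "0 < a" "\<And>\<mu>. unit_measure \<mu> \<Longrightarrow>
        hardy_opnorm p (ennreal q) (cesaro \<mu> \<gamma>) \<le> ennreal a * ennpowr (P \<mu>) (1/r)"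
      by (rule opnorm_le_potential) (simp add: P_def)
    obtain b :: real where b: "0 < b" "\<And>\<mu>. unit_measure \<mu> \<Longrightarrow>
        ennpowr (D \<mu>) (1/r) \<le> ennreal b * hardy_opnorm p (ennreal q) (cesaro \<mu> \<gamma>)"
      by (rule dyadic_le_opnorm) (simp add: D_def assms(5))
    define A' where "A' = A powr (1/r)"
    have A': "0 < A'" using A by (simp add: A'_def)
    \<comment> \<open>One constant above all those that occur; comparing two quantities through the
      root \<delta> of the dyadic sum costs its square.\<close>
    define E where "E = 1 + A' + a * A' + b"
    have E: "0 < E" "A' \<le> E" "a * A' \<le> E" "b \<le> E" "1 \<le> E"
      using A' a(1) b(1) by (auto simp: E_def add_pos_pos)
    have up: "X \<le> ennreal E * Y" if "X \<le> ennreal e * Y" "e \<le> E" for X Y e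
      using that(1) mult_right_mono[OF ennreal_leI[OF that(2)], of Y] by (rule order_trans) simp
    have root: "ennpowr X (1/r) \<le> ennreal E * ennpowr Y (1/r)" if "X \<le> ennreal A * Y" for X Y
      using ennpowr_root_le[OF that _ r] A E(2) up[of _ A'] by (simp add: A'_def)
    have comp: "comparable (E * E) X Y"
      if "X \<le> ennreal E * Z" "Z \<le> ennreal E * X" "Y \<le> ennreal E * Z" "Z \<le> ennreal E * Y" for X Y Z
      using that E(1) by (intro comparableI ennreal_le_trans_mult[of _ E Z E]) auto
    show "\<exists>C>0. \<forall>\<mu>. unit_interval_measure \<mu> \<longrightarrow>
       comparable C (hardy_opnorm p (ennreal q) (cesaro \<mu> \<gamma>))
                    (hardy_norm (ennreal r) (F_fun \<mu> \<gamma>)) \<and>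
       comparable C (hardy_norm (ennreal r) (F_fun \<mu> \<gamma>))
                    (circle_norm r (potential \<mu> \<gamma>)) \<and>
       comparable C (circle_norm r (potential \<mu> \<gamma>))
                    (ennpowr (dyadic_sum \<mu> \<sigma> r) (1 / r)) \<and>
       comparable C (ennpowr (dyadic_sum \<mu> \<sigma> r) (1 / r))
                    (ennpowr (moment_sum \<mu> \<gamma> r) (1 / r)) \<and>
       comparable C (ennpowr (moment_sum \<mu> \<gamma> r) (1 / r))
                    (ennpowr (ennpowr (emeasure \<mu> {0..<1}) r + tail_integral \<mu> \<sigma> r) (1 / r))"
    proof (intro exI[of _ "E * E"] conjI[of "0 < E * E"] allI impI)
      show "0 < E * E" using E(1) by simp
      fix \<mu> assume "unit_interval_measure \<mu>"
      then have \<mu>: "unit_measure \<mu>" by (simp add: unit_measure_iff)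
      define N where "N = hardy_opnorm p (ennreal q) (cesaro \<mu> \<gamma>)"
      define \<delta> where "\<delta> = ennpowr (D \<mu>) (1/r)"
      have P\<delta>: "ennpowr (P \<mu>) (1/r) \<le> ennreal A' * \<delta>"
        unfolding \<delta>_def A'_def using cmp[OF \<mu>] A r by (intro ennpowr_root_le) auto
      have "N \<le> ennreal (a * A') * \<delta>"
        unfolding N_def using a(2)[OF \<mu>] P\<delta> a(1) A' by (intro ennreal_le_trans_mult) auto
      then have N: "N \<le> ennreal E * \<delta>" "\<delta> \<le> ennreal E * N"
        using up[OF _ E(3)] up[OF b(2)[OF \<mu>] E(4)] by (auto simp: N_def \<delta>_def)
      have rt: "ennpowr (F \<mu>) (1/r) \<le> ennreal E * \<delta>" "\<delta> \<le> ennreal E * ennpowr (F \<mu>) (1/r)"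
        "ennpowr (P \<mu>) (1/r) \<le> ennreal E * \<delta>" "\<delta> \<le> ennreal E * ennpowr (P \<mu>) (1/r)"
        "ennpowr (M \<mu>) (1/r) \<le> ennreal E * \<delta>" "\<delta> \<le> ennreal E * ennpowr (M \<mu>) (1/r)"
        "ennpowr (T \<mu>) (1/r) \<le> ennreal E * \<delta>" "\<delta> \<le> ennreal E * ennpowr (T \<mu>) (1/r)"
        unfolding \<delta>_def using cmp[OF \<mu>] by (auto intro!: root)
      \<comment> \<open>The dyadic quantity is itself a member of the chain, so it is compared with
        itself, for which E \<ge> 1 is enough.\<close>
      have "\<delta> \<le> ennreal E * \<delta>"
        using up[OF _ E(5), of \<delta> \<delta>] by simp
      then show "comparable (E * E) (hardy_opnorm p (ennreal q) (cesaro \<mu> \<gamma>))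
                    (hardy_norm (ennreal r) (F_fun \<mu> \<gamma>)) \<and>
       comparable (E * E) (hardy_norm (ennreal r) (F_fun \<mu> \<gamma>))
                    (circle_norm r (potential \<mu> \<gamma>)) \<and>
       comparable (E * E) (circle_norm r (potential \<mu> \<gamma>))
                    (ennpowr (dyadic_sum \<mu> \<sigma> r) (1 / r)) \<and>
       comparable (E * E) (ennpowr (dyadic_sum \<mu> \<sigma> r) (1 / r))
                    (ennpowr (moment_sum \<mu> \<gamma> r) (1 / r)) \<and>
       comparable (E * E) (ennpowr (moment_sum \<mu> \<gamma> r) (1 / r))
                    (ennpowr (ennpowr (emeasure \<mu> {0..<1}) r + tail_integral \<mu> \<sigma> r) (1 / r))"
        unfolding hF[OF \<mu>] cP[OF \<mu>] D_def[symmetric] M_def[symmetric] T_def[symmetric] \<delta>_def[symmetric] N_def[symmetric]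
        using N rt by (intro conjI comp[of _ \<delta>]) auto
    qed
  qed
qed

end
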